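(* Let $\mathcal{S}$ be a GTS, let $r$ be a rule of $\mathcal{S}$, and let $\sigma$ be a CHR state with $\sigma \equiv \langle \mathrm{chr}(\mathrm{kp},G); \mathbb{B}; \mathbb{V}\rangle$ such that $\mathcal{G}(\sigma)$ holds with graph $G$. Then $$G \stackrel{r,m}{\Longrightarrow} H \text{ for a match } m \text{ with } \{v \in V_G \mid \mathrm{track}_{G\Rightarrow H}(v) \text{ is defined}\} \supseteq \mathcal{S}(\sigma)$$ if and only if $$\sigma \rightarrowtail^{r} \tau \text{ for a state } \tau \equiv \langle \mathrm{chr}(\mathrm{kp},H); \mathbb{B}'; \mathbb{V}\rangle \text{ (for some } \mathbb{B}'\text{) such that } \mathcal{G}(\tau) \text{ holds with graph } H.$$
   Context: Graphs. A graph $G=(V_G,E_G,\mathrm{src}_G,\mathrm{tgt}_G)$ has a finite node set, a finite edge set and source/target maps $E_G\to V_G$; graph morphisms preserve source and target. A type graph $TG$ is a graph with unique labels on nodes and edges; a typed graph is a graph $G$ with a graph morphism $\mathrm{type}:G\to TG$. $\deg_G(v)=\#\{e\mid \mathrm{src}(e)=v\}+\#\{e\mid\mathrm{tgt}(e)=v\}$ (a loop counts twice). GTS. A graph transformation system (GTS) consists of a type graph $TG$ and a set of rules; a rule $p=(L\leftarrow K\rightarrow R)$ consists of typed graphs $L,K,R$ with $K$ included in $L$ and in $R$. A match is an injective typed graph morphism $m:L\to G$ (only injective matches are considered). $p$ is applicable at $m$ iff no edge of $G$ outside $m(E_L)$ has its source or target in $m(V_L\setminus V_K)$ (no dangling edges).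 The result $G\stackrel{p,m}{\Longrightarrow}H$ (double-pushout construction) is obtained by deleting $m(L\setminus K)$ from $G$, giving $D$, and then adding a fresh copy of $R\setminus K$ glued along $K$. The track morphism $\mathrm{track}_{G\Rightarrow H}$ is the partial morphism $G\to H$ undefined on deleted items and sending each item of $D$ to its image in $H$. CHR. Fix a complete decidable constraint theory $\mathcal{CT}$ on built-in constraints containing syntactic equality and the arithmetic operations $+,-$; $\top$ is true, $\bot$ false. A CHR state is a triple $\langle\mathbb{G};\mathbb{B};\mathbb{V}\rangle$: $\mathbb{G}$ a multiset of user-defined constraints, $\mathbb{B}$ a conjunction of built-in constraints, $\mathbb{V}$ a set of global variables. Variables not in $\mathbb{V}$ are local; local variables not in $\mathbb{G}$ are strictly local. State equivalence $\equiv$ is the smallest equivalence relation with: (1) $\langle\mathbb{G};x\doteq t\wedge\mathbb{B};\mathbb{V}\rangle\equiv\langle\mathbb{G}[x/t];x\doteq t\wedge\mathbb{B};\mathbb{V}\rangle$; (2) $\langle\mathbb{G};\mathbb{B};\mathbb{V}\rangle\equiv\langle\mathbb{G};\mathbb{B}';\mathbb{V}\rangle$ if $\mathcal{CT}\models\exists\bar s.\mathbb{B}\leftrightarrow\exists\bar s'.\mathbb{B}'$ with $\bar s,\bar s'$ the strictly local variables of $\mathbb{B},\mathbb{B}'$; (3) $\langle\mathbb{G};\mathbb{B};\{X\}\cup\mathbb{V}\rangle\equiv\langle\mathbb{G};\mathbb{B};\mathbb{V}\rangle$ if $X$ occurs in neither $\mathbb{G}$ nor $\mathbb{B}$; (4)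 $\langle\mathbb{G};\bot;\mathbb{V}\rangle\equiv\langle\mathbb{G}';\bot;\mathbb{V}\rangle$. A simplification rule $r\ @\ H\Leftrightarrow B_c,B_b$ has $H,B_c$ multisets of user-defined constraints ($H\neq\emptyset$) and $B_b$ a conjunction of built-ins. Transitions act on equivalence classes: with a fresh-variable copy of the rule, $[\langle H\uplus\mathbb{G};\mathbb{B};\mathbb{V}\rangle]\rightarrowtail[\langle B_c\uplus\mathbb{G};B_b\wedge\mathbb{B};\mathbb{V}\rangle]$. Encoding. Each node type $t$ of $TG$ gives a constraint symbol $t/2$ and each edge type a symbol $t/3$. Fix injective maps $\mathrm{var},\mathrm{dvar}$ from graph items to variables with disjoint images. For a node $x$: $\mathrm{chr}_G(\mathrm{gnd},x)=\mathrm{type}(x)(\mathrm{var}(x),\deg_G(x))$, $\mathrm{chr}_G(\mathrm{kp},x)=\mathrm{type}(x)(\mathrm{var}(x),\mathrm{dvar}(x))$; for an edge $x$ both equal $\mathrm{type}(x)(\mathrm{var}(x),\mathrm{var}(\mathrm{src}(x)),\mathrm{var}(\mathrm{tgt}(x)))$. $\mathrm{chr}(\mathrm{gnd},G)$, $\mathrm{chr}(\mathrm{kp},G)$ are the multisets over all items of $G$. For a rule $p=(L\leftarrow K\rightarrow R)$, $\varrho(p)$ is the simplification rule $p\ @\ C_L\Leftrightarrow C_R^u,C_R^b$ with $C_L=\{\mathrm{chr}_L(\mathrm{kp},x)\mid x\in K\}\uplus\{\mathrm{chr}_L(\mathrm{gnd},x)\mid x\in L\setminus K\}$, $C_R^u=\{\mathrm{chr}_R(\mathrm{gnd},x)\mid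 x\in R\setminus K\}\uplus\{\mathrm{chr}_R(\mathrm{kp},e)\mid e\in E_K\}\uplus\{\mathrm{chr}_R(\mathrm{kp},v')\mid v\in V_K\}$, $C_R^b=\bigwedge_{v\in V_K}(\mathrm{var}(v)=\mathrm{var}(v')\wedge\mathrm{dvar}(v')=\mathrm{dvar}(v)-\deg_L(v)+\deg_R(v))$, where $v'$ is a fresh copy of $v$ with fresh variables. The GTS-CHR program of $\mathcal{S}$ is $\{\varrho(p)\}$; $\rightarrowtail^r$ denotes a transition using $\varrho(r)$. Graph invariant. A state $\sigma=\langle\mathbb{G};\mathbb{B}_c\wedge\mathbb{B}_a;\mathbb{V}\rangle$, with $\mathbb{B}_c$ a conjunction of constraints $X=c$ ($c$ constant) and $\mathbb{B}_a$ of constraints $X=Y+c_1-c_2$ ($c_1,c_2$ constants), satisfies $\mathcal{G}(\sigma)$ iff there are a typed graph $G$ and a conjunction $B$ of constraints $X=c$ with $\langle\mathbb{G};\mathbb{B}_c\wedge\mathbb{B}_a\wedge B;\emptyset\rangle\equiv\langle\mathrm{chr}(\mathrm{gnd},G);\top;\emptyset\rangle$; then $\sigma$ is a $\mathcal{G}$-state based on $G$ ("$\mathcal{G}(\sigma)$ holds with graph $G$"). For such $\sigma\equiv\langle\mathrm{chr}(\mathrm{kp},G);\mathbb{B};\mathbb{V}\rangle$, the strong nodes are $\mathcal{S}(\sigma)=\{v\in V_G\mid$ the constraint $\mathrm{dvar}(v)=\deg_G(v)$ is not in $\mathbb{B}\}$.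
   Formalization: A node is strong when dvar(v)=deg(v) is not entailed by B, rather than not literally in B; on the CHR side H is replaced by some typed graph isomorphic to H; the set V of global variables is assumed finite. *)

theory Defs
  imports "Graph_Theory.Digraph" "HOL-Library.Multiset"
begin

section \<open>Typed graphs\<close>

text \<open>
  Graphs are directed multigraphs from Graph_Theory, with \<open>tail\<close> and \<open>head\<close> playing the roles of
  source/target. Graph items are elements of the disjoint sum of nodes and edges.
\<close>

type_synonym ('n, 'e) mor = "('n \<Rightarrow> 'n) \<times> ('e \<Rightarrow> 'e)"

definition items :: "('n, 'e) pre_digraph \<Rightarrow> ('n + 'e) set" where
  "items G = verts G <+> arcs G"

definition deg :: "('n, 'e) pre_digraph \<Rightarrow> 'n \<Rightarrow> nat" where
  "deg G v = out_degree G v + in_degree G v"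

definition graph_morphism ::
  "('n, 'e) pre_digraph \<Rightarrow> ('n2, 'e2) pre_digraph \<Rightarrow> ('n \<Rightarrow> 'n2) \<Rightarrow> ('e \<Rightarrow> 'e2) \<Rightarrow> bool" where
  "graph_morphism G H fv fe \<longleftrightarrow>
     fv ` verts G \<subseteq> verts H \<and> fe ` arcs G \<subseteq> arcs H \<and>
     (\<forall>e\<in>arcs G. tail H (fe e) = fv (tail G e) \<and> head H (fe e) = fv (head G e))"

record ('tn, 'te, 'l) type_graph =
  type_gr :: "('tn, 'te) pre_digraph"
  label :: "'tn + 'te \<Rightarrow> 'l"

definition is_type_graph :: "('tn, 'te, 'l) type_graph \<Rightarrow> bool" where
  "is_type_graph TG \<longleftrightarrow> fin_digraph (type_gr TG) \<and> inj_on (label TG) (items (type_gr TG))"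

record ('n, 'e, 'tn, 'te) tgraph =
  gr :: "('n, 'e) pre_digraph"
  ntype :: "'n \<Rightarrow> 'tn"
  etype :: "'e \<Rightarrow> 'te"

definition typed_graph :: "('tn, 'te, 'l) type_graph \<Rightarrow> ('n, 'e, 'tn, 'te) tgraph \<Rightarrow> bool" where
  "typed_graph TG G \<longleftrightarrow>
     fin_digraph (gr G) \<and> graph_morphism (gr G) (type_gr TG) (ntype G) (etype G)"

definition typed_morphism ::
  "('n, 'e, 'tn, 'te) tgraph \<Rightarrow> ('n, 'e, 'tn, 'te) tgraph \<Rightarrow> ('n, 'e) mor \<Rightarrow> bool" where
  "typed_morphism G H f \<longleftrightarrow>
     graph_morphism (gr G) (gr H) (fst f) (snd f) \<and>
     (\<forall>v\<in>verts (gr G). ntype H (fst f v) = ntype G v) \<and>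
     (\<forall>e\<in>arcs (gr G). etype H (snd f e) = etype G e)"

definition inj_typed_morphism ::
  "('n, 'e, 'tn, 'te) tgraph \<Rightarrow> ('n, 'e, 'tn, 'te) tgraph \<Rightarrow> ('n, 'e) mor \<Rightarrow> bool" where
  "inj_typed_morphism G H f \<longleftrightarrow>
     typed_morphism G H f \<and> inj_on (fst f) (verts (gr G)) \<and> inj_on (snd f) (arcs (gr G))"

definition typed_isomorphic ::
  "('n, 'e, 'tn, 'te) tgraph \<Rightarrow> ('n, 'e, 'tn, 'te) tgraph \<Rightarrow> bool" where
  "typed_isomorphic G H \<longleftrightarrow>
     (\<exists>f. inj_typed_morphism G H f \<and>
          fst f ` verts (gr G) = verts (gr H) \<and> snd f ` arcs (gr G) = arcs (gr H))"

section \<open>Graph transformation systems\<close>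

record ('n, 'e, 'tn, 'te) gt_rule =
  lhs :: "('n, 'e, 'tn, 'te) tgraph"
  ker :: "('n, 'e, 'tn, 'te) tgraph"
  rhs :: "('n, 'e, 'tn, 'te) tgraph"

definition gt_rule_over :: "('tn, 'te, 'l) type_graph \<Rightarrow> ('n, 'e, 'tn, 'te) gt_rule \<Rightarrow> bool" where
  "gt_rule_over TG p \<longleftrightarrow>
     typed_graph TG (lhs p) \<and> typed_graph TG (ker p) \<and> typed_graph TG (rhs p) \<and>
     typed_morphism (ker p) (lhs p) (id, id) \<and> typed_morphism (ker p) (rhs p) (id, id)"

definition gts :: "('tn, 'te, 'l) type_graph \<Rightarrow> ('n, 'e, 'tn, 'te) gt_rule set \<Rightarrow> bool" where
  "gts TG S \<longleftrightarrow> is_type_graph TG \<and> (\<forall>p\<in>S. gt_rule_over TG p)"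

definition applicable ::
  "('n, 'e, 'tn, 'te) gt_rule \<Rightarrow> ('n, 'e) mor \<Rightarrow> ('n, 'e, 'tn, 'te) tgraph \<Rightarrow> bool" where
  "applicable p m G \<longleftrightarrow>
     (\<forall>e \<in> arcs (gr G) - snd m ` arcs (gr (lhs p)).
        tail (gr G) e \<notin> fst m ` (verts (gr (lhs p)) - verts (gr (ker p))) \<and>
        head (gr G) e \<notin> fst m ` (verts (gr (lhs p)) - verts (gr (ker p))))"

text \<open>The context graph $D$ of the double pushout.\<close>

definition remainder ::
  "('n, 'e, 'tn, 'te) gt_rule \<Rightarrow> ('n, 'e) mor \<Rightarrow> ('n, 'e, 'tn, 'te) tgraph
     \<Rightarrow> ('n, 'e, 'tn, 'te) tgraph" where
  "remainder p m G = G\<lparr> gr := (gr G)\<lparr>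
       verts := verts (gr G) - fst m ` (verts (gr (lhs p)) - verts (gr (ker p))),
       arcs := arcs (gr G) - snd m ` (arcs (gr (lhs p)) - arcs (gr (ker p))) \<rparr> \<rparr>"

text \<open>
  \<open>H\<close> consists of an image of \<open>D\<close> under \<open>h\<close> and a disjoint copy of \<open>R - K\<close>, where the copy
  \<open>n\<close> of \<open>R\<close> agrees with \<open>h\<close> on the matched kernel. The names of the items of \<open>H\<close> are left open,
  so \<open>H\<close> is determined up to isomorphism only.
\<close>

definition glued ::
  "('n, 'e, 'tn, 'te) gt_rule \<Rightarrow> ('n, 'e) mor \<Rightarrow> ('n, 'e, 'tn, 'te) tgraph
     \<Rightarrow> ('n, 'e, 'tn, 'te) tgraph \<Rightarrow> ('n, 'e) mor \<Rightarrow> ('n, 'e) mor \<Rightarrow> bool" where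
  "glued p m D H h n \<longleftrightarrow>
     inj_typed_morphism D H h \<and> inj_typed_morphism (rhs p) H n \<and>
     (\<forall>v\<in>verts (gr (ker p)). fst h (fst m v) = fst n v) \<and>
     (\<forall>e\<in>arcs (gr (ker p)). snd h (snd m e) = snd n e) \<and>
     verts (gr H) = fst h ` verts (gr D) \<union> fst n ` (verts (gr (rhs p)) - verts (gr (ker p))) \<and>
     arcs (gr H) = snd h ` arcs (gr D) \<union> snd n ` (arcs (gr (rhs p)) - arcs (gr (ker p))) \<and>
     fst h ` verts (gr D) \<inter> fst n ` (verts (gr (rhs p)) - verts (gr (ker p))) = {} \<and>
     snd h ` arcs (gr D) \<inter> snd n ` (arcs (gr (rhs p)) - arcs (gr (ker p))) = {}"

text \<open>\<open>derivation p m G H trk\<close>: \<open>H\<close> results from \<open>G\<close> by \<open>p\<close> at match \<open>m\<close> with track morphism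
  \<open>trk\<close>.\<close>

definition derivation ::
  "('n, 'e, 'tn, 'te) gt_rule \<Rightarrow> ('n, 'e) mor \<Rightarrow> ('n, 'e, 'tn, 'te) tgraph
     \<Rightarrow> ('n, 'e, 'tn, 'te) tgraph \<Rightarrow> ('n \<rightharpoonup> 'n) \<times> ('e \<rightharpoonup> 'e) \<Rightarrow> bool" where
  "derivation p m G H trk \<longleftrightarrow>
     inj_typed_morphism (lhs p) G m \<and> applicable p m G \<and>
     (\<exists>h n. glued p m (remainder p m G) H h n \<and>
        trk = ((\<lambda>v. if v \<in> verts (gr (remainder p m G)) then Some (fst h v) else None),
               (\<lambda>e. if e \<in> arcs (gr (remainder p m G)) then Some (snd h e) else None)))"

section \<open>Constraints and the constraint theory\<close>

datatype (dead 'f, vars_trm: 'v) trm =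
    Var 'v
  | Num int
  | Plus "('f, 'v) trm" "('f, 'v) trm"
  | Minus "('f, 'v) trm" "('f, 'v) trm"
  | Fun 'f "('f, 'v) trm list"

datatype (dead 'l, dead 'f, vars_uc: 'v) uc = UC 'l "('f, 'v) trm list"

datatype (dead 'f, dead 'p, vars_bic: 'v) bic =
    Bot
  | Eq "('f, 'v) trm" "('f, 'v) trm"
  | Prd 'p "('f, 'v) trm list"

text \<open>
  Conjunctions of built-in constraints are multisets, with \<open>{#}\<close> for true and \<open>+\<close> for conjunction.
\<close>

primrec subst_trm :: "('v \<Rightarrow> ('f, 'w) trm) \<Rightarrow> ('f, 'v) trm \<Rightarrow> ('f, 'w) trm" where
  "subst_trm s (Var x) = s x"
| "subst_trm s (Num k) = Num k"
| "subst_trm s (Plus t u) = Plus (subst_trm s t) (subst_trm s u)"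
| "subst_trm s (Minus t u) = Minus (subst_trm s t) (subst_trm s u)"
| "subst_trm s (Fun f ts) = Fun f (map (subst_trm s) ts)"

primrec subst_uc :: "('v \<Rightarrow> ('f, 'w) trm) \<Rightarrow> ('l, 'f, 'v) uc \<Rightarrow> ('l, 'f, 'w) uc" where
  "subst_uc s (UC c ts) = UC c (map (subst_trm s) ts)"

primrec subst_bic :: "('v \<Rightarrow> ('f, 'w) trm) \<Rightarrow> ('f, 'p, 'v) bic \<Rightarrow> ('f, 'p, 'w) bic" where
  "subst_bic s Bot = Bot"
| "subst_bic s (Eq t u) = Eq (subst_trm s t) (subst_trm s u)"
| "subst_bic s (Prd P ts) = Prd P (map (subst_trm s) ts)"

definition vars_ucs :: "('l, 'f, 'v) uc multiset \<Rightarrow> 'v set" where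
  "vars_ucs A = (\<Union>c\<in>set_mset A. vars_uc c)"

definition vars_bics :: "('f, 'p, 'v) bic multiset \<Rightarrow> 'v set" where
  "vars_bics B = (\<Union>b\<in>set_mset B. vars_bic b)"

text \<open>
  A complete constraint theory is the theory of any one of its models, so it is given by a
  structure on the carrier \<open>'d\<close>; entailment is truth in that structure. Equality is identity on
  the carrier, and integers with addition and subtraction are embedded in it. Nothing is assumed
  about the further symbols (they may, for instance, be free constructors).
\<close>

record ('f, 'p, 'd) struct =
  num_of :: "int \<Rightarrow> 'd"
  plus_of :: "'d \<Rightarrow> 'd \<Rightarrow> 'd"
  minus_of :: "'d \<Rightarrow> 'd \<Rightarrow> 'd"
  fun_of :: "'f \<Rightarrow> 'd list \<Rightarrow> 'd"
  prd_of :: "'p \<Rightarrow> 'd list \<Rightarrow> bool"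

definition constraint_theory :: "('f, 'p, 'd) struct \<Rightarrow> bool" where
  "constraint_theory CT \<longleftrightarrow>
     inj (num_of CT) \<and>
     (\<forall>i j. plus_of CT (num_of CT i) (num_of CT j) = num_of CT (i + j)) \<and>
     (\<forall>i j. minus_of CT (num_of CT i) (num_of CT j) = num_of CT (i - j))"

primrec eval_trm :: "('f, 'p, 'd) struct \<Rightarrow> ('v \<Rightarrow> 'd) \<Rightarrow> ('f, 'v) trm \<Rightarrow> 'd" where
  "eval_trm CT \<alpha> (Var x) = \<alpha> x"
| "eval_trm CT \<alpha> (Num k) = num_of CT k"
| "eval_trm CT \<alpha> (Plus t u) = plus_of CT (eval_trm CT \<alpha> t) (eval_trm CT \<alpha> u)"
| "eval_trm CT \<alpha> (Minus t u) = minus_of CT (eval_trm CT \<alpha> t) (eval_trm CT \<alpha> u)"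
| "eval_trm CT \<alpha> (Fun f ts) = fun_of CT f (map (eval_trm CT \<alpha>) ts)"

primrec holds :: "('f, 'p, 'd) struct \<Rightarrow> ('v \<Rightarrow> 'd) \<Rightarrow> ('f, 'p, 'v) bic \<Rightarrow> bool" where
  "holds CT \<alpha> Bot \<longleftrightarrow> False"
| "holds CT \<alpha> (Eq t u) \<longleftrightarrow> eval_trm CT \<alpha> t = eval_trm CT \<alpha> u"
| "holds CT \<alpha> (Prd P ts) \<longleftrightarrow> prd_of CT P (map (eval_trm CT \<alpha>) ts)"

definition holds_all :: "('f, 'p, 'd) struct \<Rightarrow> ('v \<Rightarrow> 'd) \<Rightarrow> ('f, 'p, 'v) bic multiset \<Rightarrow> bool" where
  "holds_all CT \<alpha> B \<longleftrightarrow> (\<forall>b\<in>#B. holds CT \<alpha> b)"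

text \<open>\<open>holds_ex CT X \<alpha> B\<close>: the formula $\exists X.\, B$ is true under \<open>\<alpha>\<close>.\<close>

definition holds_ex ::
  "('f, 'p, 'd) struct \<Rightarrow> 'v set \<Rightarrow> ('v \<Rightarrow> 'd) \<Rightarrow> ('f, 'p, 'v) bic multiset \<Rightarrow> bool" where
  "holds_ex CT X \<alpha> B \<longleftrightarrow> (\<exists>\<beta>. (\<forall>x. x \<notin> X \<longrightarrow> \<beta> x = \<alpha> x) \<and> holds_all CT \<beta> B)"

section \<open>States and transitions of Constraint Handling Rules\<close>

datatype ('l, 'f, 'p, 'v) state =
  State (user: "('l, 'f, 'v) uc multiset") (builtin: "('f, 'p, 'v) bic multiset") (globals: "'v set")

inductive state_step ::
  "('f, 'p, 'd) struct \<Rightarrow> ('l, 'f, 'p, 'v) state \<Rightarrow> ('l, 'f, 'p, 'v) state \<Rightarrow> bool" for CT where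
  substitution:
    "state_step CT (State A (add_mset (Eq (Var x) t) B) V)
       (State (image_mset (subst_uc (Var(x := t))) A) (add_mset (Eq (Var x) t) B) V)"
| builtins:
    "(\<And>\<alpha>. holds_ex CT (vars_bics B - V - vars_ucs A) \<alpha> B \<longleftrightarrow>
           holds_ex CT (vars_bics B' - V - vars_ucs A) \<alpha> B') \<Longrightarrow>
     state_step CT (State A B V) (State A B' V)"
| unused_global:
    "x \<notin> vars_ucs A \<union> vars_bics B \<Longrightarrow> state_step CT (State A B (insert x V)) (State A B V)"
| failed:
    "state_step CT (State A {#Bot#} V) (State A' {#Bot#} V)"

definition state_equiv ::
  "('f, 'p, 'd) struct \<Rightarrow> ('l, 'f, 'p, 'v) state \<Rightarrow> ('l, 'f, 'p, 'v) state \<Rightarrow> bool" where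
  "state_equiv CT = equivclp (state_step CT)"

record ('l, 'f, 'p, 'v) chr_rule =
  rl_head :: "('l, 'f, 'v) uc multiset"
  rl_user :: "('l, 'f, 'v) uc multiset"
  rl_builtin :: "('f, 'p, 'v) bic multiset"

definition vars_rule :: "('l, 'f, 'p, 'v) chr_rule \<Rightarrow> 'v set" where
  "vars_rule R = vars_ucs (rl_head R) \<union> vars_ucs (rl_user R) \<union> vars_bics (rl_builtin R)"

definition rename_rule ::
  "('v \<Rightarrow> 'v) \<Rightarrow> ('l, 'f, 'p, 'v) chr_rule \<Rightarrow> ('l, 'f, 'p, 'v) chr_rule" where
  "rename_rule \<rho> R =
     \<lparr> rl_head = image_mset (subst_uc (Var \<circ> \<rho>)) (rl_head R),
       rl_user = image_mset (subst_uc (Var \<circ> \<rho>)) (rl_user R),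
       rl_builtin = image_mset (subst_bic (Var \<circ> \<rho>)) (rl_builtin R) \<rparr>"

text \<open>
  A transition between the equivalence classes of \<open>\<sigma>\<close> and \<open>\<tau>\<close> by a fresh copy \<open>R'\<close> of the
  rule \<open>R\<close>. The copied head occurs in the user store of the chosen representative, and its
  variables are connected to the remaining state through equations in \<open>B\<close>; hence freshness with
  respect to \<open>B\<close> can only be demanded of those variables of \<open>R'\<close> that are not in its head.
\<close>

definition chr_transition ::
  "('f, 'p, 'd) struct \<Rightarrow> ('l, 'f, 'p, 'v) chr_rule
     \<Rightarrow> ('l, 'f, 'p, 'v) state \<Rightarrow> ('l, 'f, 'p, 'v) state \<Rightarrow> bool" where
  "chr_transition CT R \<sigma> \<tau> \<longleftrightarrow>
     (\<exists>\<rho> R' A B V.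
        inj_on \<rho> (vars_rule R) \<and> R' = rename_rule \<rho> R \<and>
        vars_rule R' \<inter> (V \<union> vars_ucs A) = {} \<and>
        (vars_rule R' - vars_ucs (rl_head R')) \<inter> vars_bics B = {} \<and>
        state_equiv CT \<sigma> (State (rl_head R' + A) B V) \<and>
        state_equiv CT (State (rl_user R' + A) (rl_builtin R' + B) V) \<tau>)"

section \<open>Encoding of graph transformation systems\<close>

text \<open>
  The constraint symbol of a type is its label together with the number of arguments, two for
  nodes and three for edges.
\<close>

datatype mode = Gnd | Kp

fun chr_item ::
  "('tn, 'te, 'l) type_graph \<Rightarrow> ('n + 'e \<Rightarrow> 'v) \<Rightarrow> ('n + 'e \<Rightarrow> 'v) \<Rightarrow> mode
     \<Rightarrow> ('n, 'e, 'tn, 'te) tgraph \<Rightarrow> 'n + 'e \<Rightarrow> ('l, 'f, 'v) uc" where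
  "chr_item TG var dvar Gnd G (Inl v) =
     UC (label TG (Inl (ntype G v))) [Var (var (Inl v)), Num (int (deg (gr G) v))]"
| "chr_item TG var dvar Kp G (Inl v) =
     UC (label TG (Inl (ntype G v))) [Var (var (Inl v)), Var (dvar (Inl v))]"
| "chr_item TG var dvar _ G (Inr e) =
     UC (label TG (Inr (etype G e)))
       [Var (var (Inr e)), Var (var (Inl (tail (gr G) e))), Var (var (Inl (head (gr G) e)))]"

definition chr ::
  "('tn, 'te, 'l) type_graph \<Rightarrow> ('n + 'e \<Rightarrow> 'v) \<Rightarrow> ('n + 'e \<Rightarrow> 'v) \<Rightarrow> mode
     \<Rightarrow> ('n, 'e, 'tn, 'te) tgraph \<Rightarrow> ('l, 'f, 'v) uc multiset" where
  "chr TG var dvar md G = image_mset (chr_item TG var dvar md G) (mset_set (items (gr G)))"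

text \<open>\<open>cp\<close> sends a kernel node $v$ to its fresh copy $v'$.\<close>

definition fresh_copies :: "('n, 'e, 'tn, 'te) gt_rule \<Rightarrow> ('n \<Rightarrow> 'n) \<Rightarrow> bool" where
  "fresh_copies p cp \<longleftrightarrow>
     inj_on cp (verts (gr (ker p))) \<and>
     cp ` verts (gr (ker p)) \<inter> (verts (gr (lhs p)) \<union> verts (gr (rhs p))) = {}"

definition rule_encoding ::
  "('tn, 'te, 'l) type_graph \<Rightarrow> ('n + 'e \<Rightarrow> 'v) \<Rightarrow> ('n + 'e \<Rightarrow> 'v) \<Rightarrow> ('n \<Rightarrow> 'n)
     \<Rightarrow> ('n, 'e, 'tn, 'te) gt_rule \<Rightarrow> ('l, 'f, 'p, 'v) chr_rule" where
  "rule_encoding TG var dvar cp p =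
     \<lparr> rl_head =
         image_mset (chr_item TG var dvar Kp (lhs p)) (mset_set (items (gr (ker p)))) +
         image_mset (chr_item TG var dvar Gnd (lhs p))
           (mset_set (items (gr (lhs p)) - items (gr (ker p)))),
       rl_user =
         image_mset (chr_item TG var dvar Gnd (rhs p))
           (mset_set (items (gr (rhs p)) - items (gr (ker p)))) +
         image_mset (\<lambda>e. chr_item TG var dvar Kp (rhs p) (Inr e)) (mset_set (arcs (gr (ker p)))) +
         image_mset (\<lambda>v. UC (label TG (Inl (ntype (rhs p) v)))
             [Var (var (Inl (cp v))), Var (dvar (Inl (cp v)))])
           (mset_set (verts (gr (ker p)))),
       rl_builtin =
         image_mset (\<lambda>v. Eq (Var (var (Inl v))) (Var (var (Inl (cp v)))))
           (mset_set (verts (gr (ker p)))) +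
         image_mset (\<lambda>v. Eq (Var (dvar (Inl (cp v))))
             (Plus (Minus (Var (dvar (Inl v))) (Num (int (deg (gr (lhs p)) v))))
               (Num (int (deg (gr (rhs p)) v)))))
           (mset_set (verts (gr (ker p)))) \<rparr>"

section \<open>Graph invariant and strong nodes\<close>

definition is_const :: "('f, 'v) trm \<Rightarrow> bool" where
  "is_const t \<longleftrightarrow> (\<exists>k. t = Num k) \<or> (\<exists>f. t = Fun f [])"

definition const_eq :: "('f, 'p, 'v) bic \<Rightarrow> bool" where
  "const_eq b \<longleftrightarrow> (\<exists>x c. is_const c \<and> b = Eq (Var x) c)"

definition arith_eq :: "('f, 'p, 'v) bic \<Rightarrow> bool" where
  "arith_eq b \<longleftrightarrow>
     (\<exists>x y c1 c2. is_const c1 \<and> is_const c2 \<and> b = Eq (Var x) (Minus (Plus (Var y) c1) c2))"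

definition graph_invariant ::
  "('f, 'p, 'd) struct \<Rightarrow> ('tn, 'te, 'l) type_graph \<Rightarrow> ('n + 'e \<Rightarrow> 'v) \<Rightarrow> ('n + 'e \<Rightarrow> 'v)
     \<Rightarrow> ('l, 'f, 'p, 'v) state \<Rightarrow> ('n, 'e, 'tn, 'te) tgraph \<Rightarrow> bool" where
  "graph_invariant CT TG var dvar \<sigma> G \<longleftrightarrow>
     typed_graph TG G \<and>
     (\<exists>A Bc Ba V B.
        \<sigma> = State A (Bc + Ba) V \<and>
        (\<forall>b\<in>#Bc. const_eq b) \<and> (\<forall>b\<in>#Ba. arith_eq b) \<and> (\<forall>b\<in>#B. const_eq b) \<and>
        state_equiv CT (State A (Bc + Ba + B) {}) (State (chr TG var dvar Gnd G) {#} {}))"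

text \<open>
  States are considered up to equivalence, so whether a constraint is in a conjunction of
  built-ins must not depend on how that conjunction is written: after a transition the
  constraint on \<open>dvar v\<close> is typically of the shape $X = Y + c_1 - c_2$ with $Y = c$, which is
  equivalent to, but does not literally contain, an equation $X = d$.
\<close>

definition in_builtins ::
  "('f, 'p, 'd) struct \<Rightarrow> ('f, 'p, 'v) bic \<Rightarrow> ('f, 'p, 'v) bic multiset \<Rightarrow> bool" where
  "in_builtins CT b B \<longleftrightarrow>
     (\<exists>B'. (\<forall>\<alpha>. holds_all CT \<alpha> B \<longleftrightarrow> holds_all CT \<alpha> B') \<and> b \<in># B')"

lemma in_builtins_iff_entailed:
  "in_builtins CT b B \<longleftrightarrow> (\<forall>\<alpha>. holds_all CT \<alpha> B \<longrightarrow> holds CT \<alpha> b)"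
proof
  assume "in_builtins CT b B"
  then show "\<forall>\<alpha>. holds_all CT \<alpha> B \<longrightarrow> holds CT \<alpha> b"
    unfolding in_builtins_def holds_all_def by blast
next
  assume "\<forall>\<alpha>. holds_all CT \<alpha> B \<longrightarrow> holds CT \<alpha> b"
  then have "\<forall>\<alpha>. holds_all CT \<alpha> B \<longleftrightarrow> holds_all CT \<alpha> (add_mset b B)"
    unfolding holds_all_def by auto
  then show "in_builtins CT b B"
    unfolding in_builtins_def by (meson union_single_eq_member)
qed

text \<open>Strong nodes of a state represented by \<open>State (chr TG var dvar Kp G) B V\<close>.\<close>

definition strong_nodes ::
  "('f, 'p, 'd) struct \<Rightarrow> ('n + 'e \<Rightarrow> 'v) \<Rightarrow> ('n, 'e, 'tn, 'te) tgraph
     \<Rightarrow> ('f, 'p, 'v) bic multiset \<Rightarrow> 'n set" where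
  "strong_nodes CT dvar G B =
     {v \<in> verts (gr G).
        \<not> in_builtins CT (Eq (Var (dvar (Inl v))) (Num (int (deg (gr G) v)))) B}"

end

theory Submission
  imports Defs
begin

text \<open>
  Indexing the user-defined constraints of a state by a set \<open>I\<close>, a state determines the set of
  pairs of a valuation of its global variables and the values that the constraints take, over all
  solutions of the built-ins. State equivalence preserves this set for a suitable indexing, and
  conversely consistent states with the same set are equivalent, so that all questions about
  equivalence become semantic ones.

  By the graph invariant, the identifiers of \<open>G\<close> can be given pairwise distinct values while all
  degrees take their actual values. At such a point the values of the constraints determine the
  graph. Hence the head of a transition determines a morphism from \<open>L\<close>, whose deleted nodes carry
  their actual degree, which excludes dangling edges; and the result of the transition determines
  the pushout up to isomorphism. A deleted node has a constant degree in the head, so its degree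
  must be entailed by the built-ins: it is not strong.

  For the other direction, the state reached is written with the built-in store of \<open>\<sigma>\<close> unchanged
  and all changes of degrees made in the user store, which preserves the shape required by the
  invariant.
\<close>

section \<open>Families representing multisets\<close>

text \<open>State equivalence forgets which constraint came from which graph item: multisets carry
  no positions, and substitution steps may be run backwards. A fixed index set restores positions,
  at the price of an unknown permutation whenever a store is compared with an encoding; distinct
  identifier values are what forces such a permutation to respect the graph. The comparison needs
  consistency, because all user stores over \<open>Bot\<close> are identified; the graph invariant
  supplies it. The theory fixes addition and subtraction on numerals only, while the degree variable
  of a strong node may take other values. Degree updates are therefore carried along as expressions
  and computed only at solutions where all degrees are numerals. The invariant inspects the literal
  form of the built-ins, so it is not closed under equivalence: the state reached has to be
  exhibited.\<close>

lemma image_mset_eq_image_mset_setD: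
  assumes "finite I" "image_mset s A = image_mset f (mset_set I)"
  shows "\<exists>g. A = image_mset g (mset_set I) \<and> (\<forall>i\<in>I. s (g i) = f i)"
  using assms
proof (induction I arbitrary: A rule: finite_induct)
  case (insert i I)
  then have "image_mset s A = add_mset (f i) (image_mset f (mset_set I))"
    by simp
  then obtain A' a where a: "A = add_mset a A'" "s a = f i"
      "image_mset s A' = image_mset f (mset_set I)"
    by (metis msed_map_invR)
  from insert.IH[OF a(3)] obtain g where
    g: "A' = image_mset g (mset_set I)" "\<forall>i\<in>I. s (g i) = f i"
    by blast
  define h where "h j = (if j = i then a else g j)" for j
  have hg: "image_mset h (mset_set I) = image_mset g (mset_set I)"
    using insert.hyps by (intro image_mset_cong) (auto simp: h_def)
  have "h i = a" "\<forall>j\<in>insert i I. s (h j) = f j"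
    using a(2) g(2) by (auto simp: h_def)
  moreover have "A = image_mset h (mset_set (insert i I))"
    by (simp only: a(1) g(1) hg mset_set.insert[OF insert.hyps] image_mset_add_mset \<open>h i = a\<close>)
  ultimately show ?case by blast
qed auto

text \<open>Equal supports give surjectivity, and equal sizes then give injectivity.\<close>

lemma bij_betw_if_mset_set_eq:
  assumes "finite I" "finite J" "mset_set J = image_mset g (mset_set I)"
  shows "bij_betw g I J"
proof -
  have "J = g ` I"
    using arg_cong[OF assms(3), of set_mset] assms(1,2) by simp
  moreover have "card J = card I"
    using arg_cong[OF assms(3), of size] by simp
  ultimately show ?thesis
    using assms(1) by (simp add: bij_betw_def eq_card_imp_inj_on)
qed

lemma image_mset_bij_betw:
  assumes "bij_betw g I J"
  shows "image_mset f (mset_set J) = image_mset (f \<circ> g) (mset_set I)"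
proof -
  have "mset_set J = image_mset g (mset_set I)"
    using assms by (metis bij_betw_def image_mset_mset_set)
  then show ?thesis
    by (simp add: multiset.map_comp)
qed

lemma image_mset_eq_obtain_bij:
  assumes "finite I" "finite J" "image_mset f (mset_set J) = image_mset g (mset_set I)"
  obtains p where "bij_betw p I J" "\<forall>i\<in>I. f (p i) = g i"
  using image_mset_eq_image_mset_setD[OF assms(1,3)] bij_betw_if_mset_set_eq[OF assms(1,2)]
  by blast

text \<open>This locates the head of a rule inside a user store. The index multiset splits as
  \<open>X + Y\<close>; multiplicities are at most one, so both parts are sets, and the part that
  maps to the given family is re-indexed by \<open>J\<close>.\<close>

lemma image_mset_union_obtain_inj:
  assumes "finite I" "finite J"
    "image_mset f (mset_set J) + A = image_mset g (mset_set I)"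
  obtains p where "inj_on p J" "p ` J \<subseteq> I" "\<forall>x\<in>J. g (p x) = f x"
    "A = image_mset g (mset_set (I - p ` J))"
proof -
  obtain X Y where XY: "mset_set I = X + Y" "image_mset g X = image_mset f (mset_set J)"
      "image_mset g Y = A"
    using image_mset_eq_plusD[OF assms(3)[symmetric]] by metis
  define K where "K = set_mset X"
  have K: "K \<subseteq> I" "finite K"
    using arg_cong[OF XY(1), of set_mset] assms(1) by (auto simp: K_def)
  have cnt: "count X x + count Y x = (if x \<in> I then 1 else 0)" for x
    using arg_cong[OF XY(1), of "\<lambda>M. count M x"] assms(1) by (simp add: count_mset_set')
  have X: "X = mset_set K"
  proof (rule multiset_eqI)
    fix x
    have "count X x \<le> 1" using cnt[of x] by (auto split: if_splits)
    moreover have "x \<in> K \<Longrightarrow> count X x \<ge> 1" "x \<notin> K \<Longrightarrow> count X x = 0"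
      unfolding K_def by (simp_all add: not_in_iff)
    moreover have "count (mset_set K) x = (if x \<in> K then 1 else 0)"
      using K(2) by (simp add: count_mset_set')
    ultimately show "count X x = count (mset_set K) x"
      by presburger
  qed
  have Y: "Y = mset_set (I - K)"
  proof (rule multiset_eqI)
    fix x
    show "count Y x = count (mset_set (I - K)) x"
      using cnt[of x] K assms(1) unfolding X by (auto simp: count_mset_set' split: if_splits)
  qed
  obtain p where p: "bij_betw p J K" "\<forall>i\<in>J. g (p i) = f i"
    using image_mset_eq_obtain_bij[OF assms(2) K(2), of g f] XY(2) X by metis
  show thesis
    using that[of p] p K Y XY(3) by (auto simp: bij_betw_def)
qed

lemma mset_set_Plus:
  assumes "finite A" "finite B"
  shows "mset_set (A <+> B) = image_mset Inl (mset_set A) + image_mset Inr (mset_set B)"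
proof -
  have "Inl ` A \<inter> Inr ` B = {}" by auto
  then show ?thesis
    using assms by (simp add: Plus_def mset_set_Union image_mset_mset_set)
qed

lemma ex_fresh_inj_on:
  fixes A :: "'a set" and X :: "'b set"
  assumes "infinite (UNIV :: 'b set)" "finite A" "finite X"
  obtains f where "inj_on f A" "f ` A \<inter> X = {}"
proof -
  have "infinite (UNIV - X)"
    using assms by (simp add: Diff_infinite_finite)
  then obtain Y where "finite Y" "card Y = card A" "Y \<subseteq> UNIV - X"
    by (metis infinite_arbitrarily_large)
  then show thesis
    using finite_same_card_bij[of A Y] assms(2) that
    by (metis Diff_disjoint Int_commute bij_betw_def disjoint_iff subset_iff)
qed

section \<open>Semantics of states\<close>

text \<open>The symbol is kept next to the values, so that equal results force equal symbols and
  arities.\<close>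

primrec eval_uc :: "('f, 'p, 'd) struct \<Rightarrow> ('v \<Rightarrow> 'd) \<Rightarrow> ('l, 'f, 'v) uc \<Rightarrow> 'l \<times> 'd list" where
  "eval_uc CT \<alpha> (UC c ts) = (c, map (eval_trm CT \<alpha>) ts)"

lemma finite_vars_trm [simp]: "finite (vars_trm t)"
  by (induction t) auto

lemma finite_vars_uc [simp]: "finite (vars_uc c)"
  by (cases c) auto

lemma finite_vars_bic [simp]: "finite (vars_bic b)"
  by (cases b) auto

lemma finite_vars_ucs [simp]: "finite (vars_ucs A)"
  by (simp add: vars_ucs_def)

lemma finite_vars_bics [simp]: "finite (vars_bics B)"
  by (simp add: vars_bics_def)

lemma vars_ucs_union [simp]: "vars_ucs (A + A') = vars_ucs A \<union> vars_ucs A'"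
  by (auto simp: vars_ucs_def)

lemma vars_ucs_add_mset [simp]: "vars_ucs (add_mset c A) = vars_uc c \<union> vars_ucs A"
  by (auto simp: vars_ucs_def)

lemma vars_bics_union [simp]: "vars_bics (B + B') = vars_bics B \<union> vars_bics B'"
  by (auto simp: vars_bics_def)

lemma vars_bics_add_mset [simp]: "vars_bics (add_mset b B) = vars_bic b \<union> vars_bics B"
  by (auto simp: vars_bics_def)

lemma vars_empty [simp]: "vars_ucs {#} = {}" "vars_bics {#} = {}"
  by (auto simp: vars_ucs_def vars_bics_def)

lemma eval_trm_cong: "(\<And>x. x \<in> vars_trm t \<Longrightarrow> \<alpha> x = \<beta> x) \<Longrightarrow> eval_trm CT \<alpha> t = eval_trm CT \<beta> t"
proof (induction t)
  case (Fun g ts)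
  then have "map (eval_trm CT \<alpha>) ts = map (eval_trm CT \<beta>) ts"
    by (intro map_cong) auto
  then show ?case by (metis eval_trm.simps(5))
qed auto

lemma eval_uc_cong: "(\<And>x. x \<in> vars_uc c \<Longrightarrow> \<alpha> x = \<beta> x) \<Longrightarrow> eval_uc CT \<alpha> c = eval_uc CT \<beta> c"
  by (cases c) (auto intro: eval_trm_cong)

lemma holds_cong:
  assumes "\<And>x. x \<in> vars_bic b \<Longrightarrow> \<alpha> x = \<beta> x"
  shows "holds CT \<alpha> b \<longleftrightarrow> holds CT \<beta> b"
proof (cases b)
  case (Eq t u)
  then have "eval_trm CT \<alpha> t = eval_trm CT \<beta> t" "eval_trm CT \<alpha> u = eval_trm CT \<beta> u"
    using assms by (auto intro: eval_trm_cong)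
  then show ?thesis using Eq by simp
next
  case (Prd P ts)
  then have "map (eval_trm CT \<alpha>) ts = map (eval_trm CT \<beta>) ts"
    using assms by (auto intro!: eval_trm_cong)
  then show ?thesis using Prd by (metis holds.simps(3))
qed auto

lemma holds_all_cong:
  "(\<And>x. x \<in> vars_bics B \<Longrightarrow> \<alpha> x = \<beta> x) \<Longrightarrow> holds_all CT \<alpha> B \<longleftrightarrow> holds_all CT \<beta> B"
  unfolding holds_all_def vars_bics_def by (intro ball_cong refl holds_cong) auto

lemma holds_all_simps [simp]:
  "holds_all CT \<alpha> {#}"
  "holds_all CT \<alpha> (add_mset b B) \<longleftrightarrow> holds CT \<alpha> b \<and> holds_all CT \<alpha> B"
  "holds_all CT \<alpha> (B + B') \<longleftrightarrow> holds_all CT \<alpha> B \<and> holds_all CT \<alpha> B'"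
  by (auto simp: holds_all_def)

lemma eval_subst_trm: "eval_trm CT \<alpha> (subst_trm s t) = eval_trm CT (\<lambda>x. eval_trm CT \<alpha> (s x)) t"
  by (induction t) (auto intro!: arg_cong[where f = "fun_of CT _"])

lemma eval_subst_uc: "eval_uc CT \<alpha> (subst_uc s c) = eval_uc CT (\<lambda>x. eval_trm CT \<alpha> (s x)) c"
  by (cases c) (auto simp: eval_subst_trm)

lemma holds_subst_bic: "holds CT \<alpha> (subst_bic s b) \<longleftrightarrow> holds CT (\<lambda>x. eval_trm CT \<alpha> (s x)) b"
  by (cases b) (simp_all add: eval_subst_trm comp_def)

lemma holds_all_subst_bic:
  "holds_all CT \<alpha> (image_mset (subst_bic s) B) \<longleftrightarrow> holds_all CT (\<lambda>x. eval_trm CT \<alpha> (s x)) B"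
  by (auto simp: holds_all_def holds_subst_bic)

lemma vars_subst_trm: "vars_trm (subst_trm s t) = (\<Union>x\<in>vars_trm t. vars_trm (s x))"
  by (induction t) auto

lemma vars_subst_uc: "vars_uc (subst_uc s c) = (\<Union>x\<in>vars_uc c. vars_trm (s x))"
  by (cases c) (auto simp: vars_subst_trm)

lemma vars_subst_bic: "vars_bic (subst_bic s b) = (\<Union>x\<in>vars_bic b. vars_trm (s x))"
  by (cases b) (auto simp: vars_subst_trm)

lemma vars_ucs_image_subst:
  "vars_ucs (image_mset (subst_uc s) A) = (\<Union>x\<in>vars_ucs A. vars_trm (s x))"
  by (auto simp: vars_ucs_def vars_subst_uc)

lemma vars_bics_image_subst:
  "vars_bics (image_mset (subst_bic s) B) = (\<Union>x\<in>vars_bics B. vars_trm (s x))"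
  by (auto simp: vars_bics_def vars_subst_bic)

lemma subst_trm_cong: "(\<And>x. x \<in> vars_trm t \<Longrightarrow> s x = s' x) \<Longrightarrow> subst_trm s t = subst_trm s' t"
  by (induction t) auto

lemma subst_uc_cong: "(\<And>x. x \<in> vars_uc c \<Longrightarrow> s x = s' x) \<Longrightarrow> subst_uc s c = subst_uc s' c"
  by (cases c) (auto intro: subst_trm_cong)

lemma subst_trm_Var [simp]: "subst_trm Var t = t"
  by (induction t) (auto intro: map_idI)

lemma subst_uc_Var [simp]: "subst_uc Var c = c"
  by (cases c) (auto intro: map_idI)

text \<open>
  The values that a family \<open>f\<close> of user-defined constraints may take when the global variables are
  read off \<open>\<alpha>\<close>. As a set of pairs \<open>(\<alpha>, M)\<close>, this is invariant under state equivalence.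
\<close>

definition reach ::
  "('f, 'p, 'd) struct \<Rightarrow> ('f, 'p, 'v) bic multiset \<Rightarrow> 'v set \<Rightarrow> 'i set \<Rightarrow> ('i \<Rightarrow> ('l, 'f, 'v) uc)
     \<Rightarrow> ('v \<Rightarrow> 'd) \<Rightarrow> ('i \<Rightarrow> 'l \<times> 'd list) \<Rightarrow> bool" where
  "reach CT B V I f \<alpha> M \<longleftrightarrow>
     (\<exists>\<beta>. (\<forall>x\<in>V. \<beta> x = \<alpha> x) \<and> holds_all CT \<beta> B \<and> (\<forall>i\<in>I. eval_uc CT \<beta> (f i) = M i))"

text \<open>A solution that agrees with \<alpha> on \<open>Y\<close> can be reset to \<alpha>
  outside the variables of \<open>B\<close> without harm. The right-hand side no longer mentions the
  variables of \<open>B\<close>, which makes the two sides of the built-in rule comparable.\<close>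

lemma holds_ex_iff:
  "holds_ex CT (vars_bics B - Y) \<alpha> B \<longleftrightarrow> (\<exists>\<beta>. (\<forall>x\<in>Y. \<beta> x = \<alpha> x) \<and> holds_all CT \<beta> B)"
    (is "?L \<longleftrightarrow> ?R")
proof
  assume ?R
  then obtain \<beta> where \<beta>: "\<forall>x\<in>Y. \<beta> x = \<alpha> x" "holds_all CT \<beta> B" by blast
  let ?\<gamma> = "\<lambda>x. if x \<in> vars_bics B - Y then \<beta> x else \<alpha> x"
  have "holds_all CT ?\<gamma> B \<longleftrightarrow> holds_all CT \<beta> B"
    using \<beta>(1) by (intro holds_all_cong) auto
  then show ?L
    using \<beta> unfolding holds_ex_def by (intro exI[of _ ?\<gamma>]) auto
qed (auto simp: holds_ex_def)

lemma Diff_Diff_Un: "A - B - C = A - (B \<union> C)"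
  by blast

lemma state_step_builtins:
  assumes "\<And>\<alpha>. (\<exists>\<beta>. (\<forall>x\<in>V \<union> vars_ucs A. \<beta> x = \<alpha> x) \<and> holds_all CT \<beta> B) \<longleftrightarrow>
                 (\<exists>\<beta>. (\<forall>x\<in>V \<union> vars_ucs A. \<beta> x = \<alpha> x) \<and> holds_all CT \<beta> B')"
  shows "state_step CT (State A B V) (State A B' V)"
proof (rule state_step.builtins)
  fix \<alpha>
  show "holds_ex CT (vars_bics B - V - vars_ucs A) \<alpha> B \<longleftrightarrow>
        holds_ex CT (vars_bics B' - V - vars_ucs A) \<alpha> B'"
    using assms[of \<alpha>] by (simp only: holds_ex_iff Diff_Diff_Un)
qed

lemma reach_self: "holds_all CT \<beta> B \<Longrightarrow> reach CT B V I f \<beta> (\<lambda>i. eval_uc CT \<beta> (f i))"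
  unfolding reach_def by blast

text \<open>Consistency can be read off \<open>reach\<close>, hence it is preserved whenever
  \<open>reach\<close> is.\<close>

lemma reach_nonempty_iff: "(\<exists>\<alpha> M. reach CT B V I f \<alpha> M) \<longleftrightarrow> (\<exists>\<beta>. holds_all CT \<beta> B)"
  by (meson reach_def reach_self)

lemma reach_cong:
  assumes "\<And>x. x \<in> V \<Longrightarrow> \<alpha> x = \<alpha>' x" "\<And>i. i \<in> I \<Longrightarrow> M i = M' i"
  shows "reach CT B V I f \<alpha> M \<longleftrightarrow> reach CT B V I f \<alpha>' M'"
  unfolding reach_def using assms by (metis (no_types, lifting))

lemma vars_uc_subset_vars_ucs:
  "finite I \<Longrightarrow> i \<in> I \<Longrightarrow> vars_uc (f i) \<subseteq> vars_ucs (image_mset f (mset_set I))"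
  by (auto simp: vars_ucs_def)

lemma eval_uc_subst_entailed:
  assumes "\<beta> x = eval_trm CT \<beta> t"
  shows "eval_uc CT \<beta> (subst_uc (Var(x := t)) c) = eval_uc CT \<beta> c"
proof -
  have "(\<lambda>y. eval_trm CT \<beta> ((Var(x := t)) y)) = \<beta>"
    using assms by auto
  then show ?thesis by (simp add: eval_subst_uc)
qed

lemma reach_builtins_mono:
  assumes "finite I"
    and "\<And>\<beta>. holds_all CT \<beta> B \<Longrightarrow>
      \<exists>\<gamma>. (\<forall>x\<in>V \<union> vars_ucs (image_mset f (mset_set I)). \<gamma> x = \<beta> x) \<and> holds_all CT \<gamma> B'"
    and "reach CT B V I f \<alpha> M"
  shows "reach CT B' V I f \<alpha> M"
proof -
  from assms(3) obtain \<beta> where \<beta>: "\<forall>x\<in>V. \<beta> x = \<alpha> x" "holds_all CT \<beta> B"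
    "\<forall>i\<in>I. eval_uc CT \<beta> (f i) = M i"
    unfolding reach_def by blast
  obtain \<gamma> where \<gamma>: "\<forall>x\<in>V \<union> vars_ucs (image_mset f (mset_set I)). \<gamma> x = \<beta> x" "holds_all CT \<gamma> B'"
    using assms(2)[OF \<beta>(2)] by blast
  have "eval_uc CT \<gamma> (f i) = eval_uc CT \<beta> (f i)" if "i \<in> I" for i
    using \<gamma>(1) vars_uc_subset_vars_ucs[OF assms(1) that, of f] by (intro eval_uc_cong) auto
  then show ?thesis
    using \<beta> \<gamma> unfolding reach_def by (intro exI[of _ \<gamma>]) auto
qed

lemma reach_builtins_eq:
  assumes "finite I" "A = image_mset f (mset_set I)"
    and "\<And>\<alpha>. holds_ex CT (vars_bics B - V - vars_ucs A) \<alpha> B \<longleftrightarrow>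
           holds_ex CT (vars_bics B' - V - vars_ucs A) \<alpha> B'"
  shows "reach CT B V I f = reach CT B' V I f"
proof -
  have *: "(\<exists>\<beta>. (\<forall>x\<in>V \<union> vars_ucs (image_mset f (mset_set I)). \<beta> x = \<alpha> x) \<and> holds_all CT \<beta> B) \<longleftrightarrow>
      (\<exists>\<beta>. (\<forall>x\<in>V \<union> vars_ucs (image_mset f (mset_set I)). \<beta> x = \<alpha> x) \<and> holds_all CT \<beta> B')" for \<alpha>
    using assms(3)[of \<alpha>] unfolding assms(2) Diff_Diff_Un holds_ex_iff .
  show ?thesis
  proof (intro ext iffI)
    show "reach CT B' V I f \<alpha> M" if "reach CT B V I f \<alpha> M" for \<alpha> M
      using * that by (intro reach_builtins_mono[OF assms(1) _ that]) metis
    show "reach CT B V I f \<alpha> M" if "reach CT B' V I f \<alpha> M" for \<alpha> M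
      using * that by (intro reach_builtins_mono[OF assms(1) _ that]) metis
  qed
qed

lemma reach_insert_unused:
  assumes "finite I" "x \<notin> vars_ucs (image_mset f (mset_set I)) \<union> vars_bics B"
  shows "reach CT B (insert x V) I f = reach CT B V I f"
proof (intro ext iffI)
  fix \<alpha> M
  assume "reach CT B V I f \<alpha> M"
  then obtain \<beta> where \<beta>: "\<forall>x\<in>V. \<beta> x = \<alpha> x" "holds_all CT \<beta> B"
    "\<forall>i\<in>I. eval_uc CT \<beta> (f i) = M i"
    unfolding reach_def by blast
  have "eval_uc CT (\<beta>(x := \<alpha> x)) (f i) = eval_uc CT \<beta> (f i)" if "i \<in> I" for i
    using assms(2) vars_uc_subset_vars_ucs[OF assms(1) that, of f] by (intro eval_uc_cong) auto
  moreover have "holds_all CT (\<beta>(x := \<alpha> x)) B \<longleftrightarrow> holds_all CT \<beta> B"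
    using assms(2) by (intro holds_all_cong) auto
  ultimately show "reach CT B (insert x V) I f \<alpha> M"
    using \<beta> unfolding reach_def by (intro exI[of _ "\<beta>(x := \<alpha> x)"]) auto
qed (auto simp: reach_def)

text \<open>Consistency excludes the rule \<open>failed\<close>, the only one that exchanges the
  user store at will. In a backward substitution step the earlier constraints are not determined by
  the later ones; any family that the substitution sends to \<open>f\<close> serves, because under
  the equation \<open>x = t\<close> both have the same values.\<close>

lemma state_step_reach:
  assumes "state_step CT \<sigma> \<tau> \<or> state_step CT \<tau> \<sigma>" "\<exists>\<beta>. holds_all CT \<beta> (builtin \<sigma>)"
    and "finite I" "user \<sigma> = image_mset f (mset_set I)"
  shows "\<exists>g. user \<tau> = image_mset g (mset_set I) \<and>
    reach CT (builtin \<tau>) (globals \<tau>) I g = reach CT (builtin \<sigma>) (globals \<sigma>) I f"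
  using assms(1)
proof (elim disjE)
  assume "state_step CT \<sigma> \<tau>"
  then show ?thesis
  proof cases
    case (substitution A x t B V)
    define g where "g = (\<lambda>i. subst_uc (Var(x := t)) (f i))"
    have "user \<tau> = image_mset g (mset_set I)"
      using substitution assms(4) by (simp add: g_def multiset.map_comp comp_def)
    moreover have "reach CT (builtin \<tau>) (globals \<tau>) I g = reach CT (builtin \<sigma>) (globals \<sigma>) I f"
      using substitution
      by (auto simp: reach_def fun_eq_iff g_def eval_uc_subst_entailed intro!: ex_cong1)
    ultimately show ?thesis by blast
  next
    case (builtins B V A B')
    have "A = image_mset f (mset_set I)" using builtins assms(4) by simp
    then have "reach CT B V I f = reach CT B' V I f"
      by (rule reach_builtins_eq[OF assms(3) _ builtins(3)])
    then show ?thesis using builtins assms(4) by auto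
  next
    case (unused_global x A B V)
    then show ?thesis using assms(3,4) reach_insert_unused[of I x f B CT V] by auto
  next
    case (failed A V A')
    then show ?thesis using assms(2) by auto
  qed
next
  assume "state_step CT \<tau> \<sigma>"
  then show ?thesis
  proof cases
    case (substitution A x t B V)
    then have "image_mset (subst_uc (Var(x := t))) A = image_mset f (mset_set I)"
      using assms(4) by simp
    from image_mset_eq_image_mset_setD[OF assms(3) this] obtain g where
      g: "A = image_mset g (mset_set I)" "\<forall>i\<in>I. subst_uc (Var(x := t)) (g i) = f i"
      by blast
    have "eval_uc CT \<beta> (g i) = eval_uc CT \<beta> (f i)" if "i \<in> I" "\<beta> x = eval_trm CT \<beta> t" for \<beta> i
      using that g(2) eval_uc_subst_entailed by metis
    then have "reach CT (builtin \<tau>) (globals \<tau>) I g = reach CT (builtin \<sigma>) (globals \<sigma>) I f"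
      using substitution by (auto simp: reach_def fun_eq_iff intro!: ex_cong1)
    then show ?thesis using g substitution by auto
  next
    case (builtins B V A B')
    have "A = image_mset f (mset_set I)" using builtins assms(4) by simp
    then have "reach CT B V I f = reach CT B' V I f"
      by (rule reach_builtins_eq[OF assms(3) _ builtins(3)])
    then show ?thesis using builtins assms(4) by auto
  next
    case (unused_global x A B V)
    then show ?thesis using assms(3,4) reach_insert_unused[of I x f B CT V] by auto
  next
    case (failed A V A')
    then show ?thesis using assms(2) by auto
  qed
qed

text \<open>The index set stays the same along the whole chain of steps, so each index traces one
  constraint from the first state to the last. The family \<open>g\<close> is only some arrangement
  of \<open>A'\<close>; how it relates to a given arrangement has to be found out
  afterwards.\<close>

theorem state_equiv_reach:
  assumes "state_equiv CT (State (image_mset f (mset_set I)) B V) (State A' B' V')"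
    and "\<exists>\<beta>. holds_all CT \<beta> B" "finite I"
  obtains g where "A' = image_mset g (mset_set I)" "reach CT B' V' I g = reach CT B V I f"
    "\<exists>\<beta>. holds_all CT \<beta> B'"
proof -
  define \<sigma> where "\<sigma> = State (image_mset f (mset_set I)) B V"
  define \<tau> where "\<tau> = State A' B' V'"
  have "equivclp (state_step CT) \<sigma> \<tau>"
    using assms(1) by (simp add: state_equiv_def \<sigma>_def \<tau>_def)
  then have "\<exists>g. user \<tau> = image_mset g (mset_set I) \<and>
    reach CT (builtin \<tau>) (globals \<tau>) I g = reach CT B V I f"
  proof (induction rule: equivclp_induct)
    case base
    show ?case unfolding \<sigma>_def by auto
  next
    case (step \<rho> \<tau>)
    then obtain g where g: "user \<rho> = image_mset g (mset_set I)"
      "reach CT (builtin \<rho>) (globals \<rho>) I g = reach CT B V I f"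
      by blast
    have "\<exists>\<beta>. holds_all CT \<beta> (builtin \<rho>)"
      using g(2) assms(2) reach_nonempty_iff by metis
    then show ?case
      using state_step_reach[OF step.hyps(2) _ assms(3) g(1)] g(2) by metis
  qed
  then obtain g where g: "A' = image_mset g (mset_set I)"
    "reach CT B' V' I g = reach CT B V I f"
    unfolding \<tau>_def by auto
  then have "\<exists>\<beta>. holds_all CT \<beta> B'"
    using assms(2) reach_nonempty_iff by metis
  with g that show thesis by blast
qed

lemma state_equiv_refl [simp]: "state_equiv CT \<sigma> \<sigma>"
  by (simp add: state_equiv_def)

lemma state_equiv_sym: "state_equiv CT \<sigma> \<tau> \<Longrightarrow> state_equiv CT \<tau> \<sigma>"
  by (simp add: state_equiv_def equivclp_sym)

lemma state_equiv_trans [trans]: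
  "state_equiv CT \<sigma> \<tau> \<Longrightarrow> state_equiv CT \<tau> \<rho> \<Longrightarrow> state_equiv CT \<sigma> \<rho>"
  unfolding state_equiv_def by (rule equivclp_trans)

lemma state_step_imp_equiv: "state_step CT \<sigma> \<tau> \<Longrightarrow> state_equiv CT \<sigma> \<tau>"
  by (simp add: state_equiv_def r_into_equivclp)

lemma state_equiv_builtins:
  assumes "\<And>\<beta>. holds_all CT \<beta> B \<longleftrightarrow> holds_all CT \<beta> B'"
  shows "state_equiv CT (State A B V) (State A B' V)"
  using assms by (intro state_step_imp_equiv state_step_builtins) auto

section \<open>Rewriting user-defined constraints under entailed equations\<close>

lemma subst_ucs_fresh:
  assumes "x \<notin> vars_ucs A"
  shows "image_mset (subst_uc (Var(x := t))) A = A"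
proof -
  have "image_mset (subst_uc (Var(x := t))) A = image_mset (\<lambda>c. c) A"
    using assms by (intro image_mset_cong)
      (metis (no_types, lifting) UN_I fun_upd_apply subst_uc_Var subst_uc_cong vars_ucs_def)
  then show ?thesis by simp
qed

lemma subst_trms_fresh:
  "x \<notin> (\<Union>u\<in>set us. vars_trm u) \<Longrightarrow> map (subst_trm (Var(x := t))) us = us"
  by (intro map_idI) (metis (no_types, lifting) UN_I fun_upd_apply subst_trm_Var subst_trm_cong)

text \<open>Since \<open>x\<close> is strictly local, adding \<open>x = t\<close> is an instance of
  the built-in rule: give \<open>x\<close> the value of \<open>t\<close>. The substitution rule,
  read backwards, then moves \<open>x\<close> into the argument position.\<close>

lemma state_equiv_abstract_arg:
  assumes "x \<notin> V \<union> vars_ucs (add_mset (UC c (us @ t # ts)) A) \<union> vars_bics B"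
  shows "state_equiv CT (State (add_mset (UC c (us @ t # ts)) A) B V)
    (State (add_mset (UC c (us @ Var x # ts)) A) (add_mset (Eq (Var x) t) B) V)"
proof -
  let ?A = "add_mset (UC c (us @ t # ts)) A"
  have x: "x \<notin> V" "x \<notin> vars_ucs A" "x \<notin> vars_bics B" "x \<notin> vars_trm t"
    "x \<notin> (\<Union>u\<in>set us. vars_trm u)" "x \<notin> (\<Union>u\<in>set ts. vars_trm u)"
    using assms by auto
  have "state_step CT (State ?A B V) (State ?A (add_mset (Eq (Var x) t) B) V)"
  proof (intro state_step_builtins iffI; elim exE conjE)
    fix \<alpha> \<beta>
    assume \<beta>: "\<forall>x\<in>V \<union> vars_ucs ?A. \<beta> x = \<alpha> x" "holds_all CT \<beta> B"
    let ?\<gamma> = "\<beta>(x := eval_trm CT \<beta> t)"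
    have "holds_all CT ?\<gamma> B \<longleftrightarrow> holds_all CT \<beta> B"
      using x by (intro holds_all_cong) auto
    moreover have "eval_trm CT ?\<gamma> t = eval_trm CT \<beta> t"
      using x by (intro eval_trm_cong) auto
    moreover have "\<forall>y\<in>V \<union> vars_ucs ?A. ?\<gamma> y = \<alpha> y"
      using assms \<beta>(1) by auto
    ultimately show "\<exists>\<gamma>. (\<forall>x\<in>V \<union> vars_ucs ?A. \<gamma> x = \<alpha> x) \<and>
        holds_all CT \<gamma> (add_mset (Eq (Var x) t) B)"
      using \<beta>(2) by (intro exI[of _ ?\<gamma>]) auto
  qed auto
  moreover have "image_mset (subst_uc (Var(x := t))) (add_mset (UC c (us @ Var x # ts)) A) = ?A"
    using subst_ucs_fresh[OF x(2)] subst_trms_fresh[OF x(5)] subst_trms_fresh[OF x(6)] by simp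
  then have "state_step CT (State (add_mset (UC c (us @ Var x # ts)) A) (add_mset (Eq (Var x) t) B) V)
    (State ?A (add_mset (Eq (Var x) t) B) V)"
    using substitution[of CT "add_mset (UC c (us @ Var x # ts)) A" x t B V] by simp
  ultimately show ?thesis
    by (meson state_equiv_sym state_equiv_trans state_step_imp_equiv)
qed

text \<open>No single rule replaces one term by another in the user store. A common fresh variable
  abstracts both arguments; the abstracted states differ only in \<open>x = t\<close> against
  \<open>x = u\<close>, which are equivalent under \<open>B\<close>.\<close>

lemma state_equiv_replace_arg:
  fixes V :: "'v set"
  assumes "infinite (UNIV :: 'v set)" "finite V"
    and "\<And>\<beta>. holds_all CT \<beta> B \<Longrightarrow> eval_trm CT \<beta> t = eval_trm CT \<beta> u"
  shows "state_equiv CT (State (add_mset (UC c (us @ t # ts)) A) B V)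
    (State (add_mset (UC c (us @ u # ts)) A) B V)"
proof -
  have *: "finite (V \<union> vars_ucs (add_mset (UC c (us @ t # ts)) A) \<union>
      vars_ucs (add_mset (UC c (us @ u # ts)) A) \<union> vars_bics B)"
    using assms(2) by (simp del: vars_ucs_add_mset)
  obtain x where x: "x \<notin> V \<union> vars_ucs (add_mset (UC c (us @ t # ts)) A) \<union>
      vars_ucs (add_mset (UC c (us @ u # ts)) A) \<union> vars_bics B"
    using ex_new_if_finite[OF assms(1) *] by blast
  have "state_equiv CT
      (State (add_mset (UC c (us @ Var x # ts)) A) (add_mset (Eq (Var x) t) B) V)
      (State (add_mset (UC c (us @ Var x # ts)) A) (add_mset (Eq (Var x) u) B) V)"
    using assms(3) by (intro state_equiv_builtins) auto
  moreover have "state_equiv CT (State (add_mset (UC c (us @ t # ts)) A) B V)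
      (State (add_mset (UC c (us @ Var x # ts)) A) (add_mset (Eq (Var x) t) B) V)"
    using x by (intro state_equiv_abstract_arg) blast
  moreover have "state_equiv CT (State (add_mset (UC c (us @ u # ts)) A) B V)
      (State (add_mset (UC c (us @ Var x # ts)) A) (add_mset (Eq (Var x) u) B) V)"
    using x by (intro state_equiv_abstract_arg) blast
  ultimately show ?thesis
    by (meson state_equiv_sym state_equiv_trans)
qed

lemma state_equiv_replace_args:
  fixes V :: "'v set"
  assumes "infinite (UNIV :: 'v set)" "finite V"
    and "length ts = length ss"
    and "\<And>\<beta>. holds_all CT \<beta> B \<Longrightarrow> map (eval_trm CT \<beta>) ts = map (eval_trm CT \<beta>) ss"
  shows "state_equiv CT (State (add_mset (UC c (us @ ts)) A) B V)
    (State (add_mset (UC c (us @ ss)) A) B V)"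
  using assms(3,4)
proof (induction ts ss arbitrary: us rule: list_induct2)
  case (Cons t ts s ss)
  have "state_equiv CT (State (add_mset (UC c (us @ t # ts)) A) B V)
    (State (add_mset (UC c (us @ s # ts)) A) B V)"
    using Cons.prems by (intro state_equiv_replace_arg assms(1,2)) auto
  also have "state_equiv CT (State (add_mset (UC c ((us @ [s]) @ ts)) A) B V)
    (State (add_mset (UC c ((us @ [s]) @ ss)) A) B V)"
    using Cons.prems by (intro Cons.IH) auto
  ultimately show ?case
    using state_equiv_trans by fastforce
qed auto

text \<open>A solution of \<open>B\<close> shows that both constraints have the same symbol and
  arity; then the arguments are replaced one by one.\<close>

lemma state_equiv_replace_uc:
  fixes V :: "'v set"
  assumes "infinite (UNIV :: 'v set)" "finite V" "\<exists>\<beta>. holds_all CT \<beta> B"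
    and "\<And>\<beta>. holds_all CT \<beta> B \<Longrightarrow> eval_uc CT \<beta> c = eval_uc CT \<beta> d"
  shows "state_equiv CT (State (add_mset c A) B V) (State (add_mset d A) B V)"
proof -
  obtain k ts l ss where cd: "c = UC k ts" "d = UC l ss"
    by (metis uc.exhaust)
  obtain \<beta> where "holds_all CT \<beta> B" using assms(3) by blast
  then have "k = l" "length ts = length ss"
    using assms(4)[of \<beta>] cd map_eq_imp_length_eq by auto
  then show ?thesis
    using state_equiv_replace_args[OF assms(1,2), of ts ss CT B k "[]" A] assms(4) cd by auto
qed

lemma state_equiv_replace_family:
  fixes V :: "'v set"
  assumes "infinite (UNIV :: 'v set)" "finite V" "\<exists>\<beta>. holds_all CT \<beta> B" "finite I"
    and "\<And>\<beta> i. holds_all CT \<beta> B \<Longrightarrow> i \<in> I \<Longrightarrow> eval_uc CT \<beta> (f i) = eval_uc CT \<beta> (g i)"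
  shows "state_equiv CT (State (image_mset f (mset_set I) + A) B V)
    (State (image_mset g (mset_set I) + A) B V)"
  using assms(4,5)
proof (induction I arbitrary: A rule: finite_induct)
  case (insert i I)
  have "state_equiv CT (State (add_mset (f i) (image_mset f (mset_set I) + A)) B V)
    (State (add_mset (g i) (image_mset f (mset_set I) + A)) B V)"
    using insert.prems by (intro state_equiv_replace_uc assms(1-3)) auto
  moreover have "state_equiv CT (State (image_mset f (mset_set I) + add_mset (g i) A) B V)
    (State (image_mset g (mset_set I) + add_mset (g i) A) B V)"
    using insert.prems by (intro insert.IH) auto
  ultimately show ?case
    using insert.hyps state_equiv_trans by fastforce
qed simp

section \<open>Equal semantics implies equivalence\<close>

fun uc_args :: "('l, 'f, 'v) uc \<Rightarrow> ('f, 'v) trm list" where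
  "uc_args (UC c ts) = ts"

definition uc_eqs :: "('l, 'f, 'v) uc \<Rightarrow> ('l, 'f, 'v) uc \<Rightarrow> ('f, 'p, 'v) bic multiset" where
  "uc_eqs c d = mset (map2 Eq (uc_args c) (uc_args d))"

text \<open>The truncation in \<open>map2\<close> does no harm: a common value, even under two
  different valuations, forces the same symbol and arity.\<close>

lemma holds_uc_eqs:
  assumes "eval_uc CT \<gamma> c = eval_uc CT \<delta> d"
  shows "holds_all CT \<beta> (uc_eqs c d) \<longleftrightarrow> eval_uc CT \<beta> c = eval_uc CT \<beta> d"
proof -
  obtain k ts l ss where cd: "c = UC k ts" "d = UC l ss"
    by (metis uc.exhaust)
  then have "k = l" "length ts = length ss"
    using assms map_eq_imp_length_eq by auto
  then show ?thesis
    by (simp add: uc_eqs_def holds_all_def cd list_eq_iff_nth_eq all_set_conv_all_nth)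
qed

lemma holds_all_sum:
  "finite I \<Longrightarrow> holds_all CT \<beta> (\<Sum>i\<in>I. F i) \<longleftrightarrow> (\<forall>i\<in>I. holds_all CT \<beta> (F i))"
  by (induction I rule: finite_induct) auto

text \<open>A solution of \<open>B\<close> yields values that are also reached in the second state.
  The solution found there can be glued to the first one, because common variables are global and
  global values agree; so the added store and equations only constrain further local
  variables.\<close>

lemma state_equiv_join_builtins:
  assumes "finite I"
    and "(vars_ucs (image_mset f (mset_set I)) \<union> vars_bics B) \<inter>
         (vars_ucs (image_mset g (mset_set I)) \<union> vars_bics B') \<subseteq> V"
    and "reach CT B V I f = reach CT B' V I g"
    and eqs: "\<And>\<beta>. holds_all CT \<beta> E \<longleftrightarrow> (\<forall>i\<in>I. eval_uc CT \<beta> (f i) = eval_uc CT \<beta> (g i))"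
  shows "state_equiv CT (State (image_mset f (mset_set I)) B V)
    (State (image_mset f (mset_set I)) (B + E + B') V)"
proof (intro state_step_imp_equiv state_step_builtins iffI; elim exE conjE)
  let ?A = "vars_ucs (image_mset f (mset_set I))" and ?A' = "vars_ucs (image_mset g (mset_set I))"
  fix \<alpha> \<beta>
  assume \<beta>: "\<forall>x\<in>V \<union> ?A. \<beta> x = \<alpha> x" "holds_all CT \<beta> B"
  then have "reach CT B' V I g \<beta> (\<lambda>i. eval_uc CT \<beta> (f i))"
    using assms(3) reach_self by metis
  then obtain \<gamma> where \<gamma>: "\<forall>x\<in>V. \<gamma> x = \<beta> x" "holds_all CT \<gamma> B'"
    "\<forall>i\<in>I. eval_uc CT \<gamma> (g i) = eval_uc CT \<beta> (f i)"
    unfolding reach_def by blast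
  define \<delta> where "\<delta> x = (if x \<in> ?A' \<union> vars_bics B' then \<gamma> x else \<beta> x)" for x
  have \<delta>: "\<delta> x = \<beta> x" if "x \<in> V \<union> ?A \<union> vars_bics B" for x
    using that assms(2) \<gamma>(1) by (auto simp: \<delta>_def)
  have "holds_all CT \<delta> B \<longleftrightarrow> holds_all CT \<beta> B"
    by (intro holds_all_cong \<delta>) auto
  moreover have "holds_all CT \<delta> B' \<longleftrightarrow> holds_all CT \<gamma> B'"
    by (intro holds_all_cong) (auto simp: \<delta>_def)
  moreover have "eval_uc CT \<delta> (f i) = eval_uc CT \<beta> (f i)" if "i \<in> I" for i
    using vars_uc_subset_vars_ucs[OF assms(1) that, of f] by (intro eval_uc_cong \<delta>) auto
  moreover have "eval_uc CT \<delta> (g i) = eval_uc CT \<gamma> (g i)" if "i \<in> I" for i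
    using vars_uc_subset_vars_ucs[OF assms(1) that, of g] by (intro eval_uc_cong) (auto simp: \<delta>_def)
  ultimately show "\<exists>\<beta>. (\<forall>x\<in>V \<union> ?A. \<beta> x = \<alpha> x) \<and> holds_all CT \<beta> (B + E + B')"
    using \<beta> \<gamma> \<delta> eqs by (intro exI[of _ \<delta>]) auto
qed auto

text \<open>Both states are extended to the joint store \<open>B + E + B'\<close>, where
  \<open>E\<close> equates the families index by index; under this store one family may be replaced
  by the other.\<close>

lemma state_equivI_disjoint:
  fixes V :: "'v set" and B :: "('f, 'p, 'v) bic multiset"
  assumes "infinite (UNIV :: 'v set)" "finite V" "finite I" "\<exists>\<beta>. holds_all CT \<beta> B"
    and vars: "(vars_ucs (image_mset f (mset_set I)) \<union> vars_bics B) \<inter>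
         (vars_ucs (image_mset g (mset_set I)) \<union> vars_bics B') \<subseteq> V"
    and reach: "reach CT B V I f = reach CT B' V I g"
  shows "state_equiv CT (State (image_mset f (mset_set I)) B V)
    (State (image_mset g (mset_set I)) B' V)"
proof -
  define E :: "('f, 'p, 'v) bic multiset" where "E = (\<Sum>i\<in>I. uc_eqs (f i) (g i))"
  obtain \<beta>0 where \<beta>0: "holds_all CT \<beta>0 B"
    using assms(4) by blast
  then have "reach CT B' V I g \<beta>0 (\<lambda>i. eval_uc CT \<beta>0 (f i))"
    using reach reach_self by metis
  then obtain \<gamma>0 where \<gamma>0: "\<forall>i\<in>I. eval_uc CT \<gamma>0 (g i) = eval_uc CT \<beta>0 (f i)"
    unfolding reach_def by blast
  have E: "holds_all CT \<beta> E \<longleftrightarrow> (\<forall>i\<in>I. eval_uc CT \<beta> (f i) = eval_uc CT \<beta> (g i))" for \<beta>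
    unfolding E_def holds_all_sum[OF assms(3)] using \<gamma>0 holds_uc_eqs by (metis (mono_tags, lifting))
  have E': "holds_all CT \<beta> E \<longleftrightarrow> (\<forall>i\<in>I. eval_uc CT \<beta> (g i) = eval_uc CT \<beta> (f i))" for \<beta>
    unfolding E by auto
  let ?B = "B + E + B'"
  have f: "state_equiv CT (State (image_mset f (mset_set I)) B V) (State (image_mset f (mset_set I)) ?B V)"
    by (rule state_equiv_join_builtins[OF assms(3) vars reach E])
  have g: "state_equiv CT (State (image_mset g (mset_set I)) B' V)
      (State (image_mset g (mset_set I)) (B' + E + B) V)"
    using vars by (intro state_equiv_join_builtins[OF assms(3) _ reach[symmetric] E']) auto
  obtain g' where "image_mset f (mset_set I) = image_mset g' (mset_set I)" "\<exists>\<beta>. holds_all CT \<beta> ?B"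
    using state_equiv_reach[OF f assms(4,3)] by metis
  then have "state_equiv CT (State (image_mset f (mset_set I)) ?B V) (State (image_mset g (mset_set I)) ?B V)"
    using state_equiv_replace_family[OF assms(1,2) _ assms(3), of CT ?B f g "{#}"] E by auto
  moreover have "?B = B' + E + B" by (simp add: ac_simps)
  ultimately show ?thesis
    using f g by (metis state_equiv_sym state_equiv_trans)
qed

lemma state_equiv_unused_globals:
  assumes "finite D" "D \<inter> (vars_ucs A \<union> vars_bics B) = {}"
  shows "state_equiv CT (State A B (D \<union> V)) (State A B V)"
  using assms
proof (induction D rule: finite_induct)
  case (insert x D)
  then have "state_equiv CT (State A B (insert x (D \<union> V))) (State A B (D \<union> V))"
    by (intro state_step_imp_equiv state_step.unused_global) auto
  then show ?case
    using insert state_equiv_trans by fastforce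
qed simp

theorem state_equivI:
  fixes V V' :: "'v set"
  assumes inf: "infinite (UNIV :: 'v set)" and fin: "finite V" "finite V'" "finite I"
    and cons: "\<exists>\<beta>. holds_all CT \<beta> B"
    and reach: "reach CT B V I f = reach CT B' V' I g"
  shows "state_equiv CT (State (image_mset f (mset_set I)) B V)
    (State (image_mset g (mset_set I)) B' V')"
proof -
  let ?A = "image_mset f (mset_set I)" and ?A' = "image_mset g (mset_set I)"
  define W where "W = V \<inter> V'"
  define X where "X = vars_ucs ?A \<union> vars_bics B - W"
  define Y where "Y = V \<union> V' \<union> vars_ucs ?A \<union> vars_bics B \<union> vars_ucs ?A' \<union> vars_bics B'"
  obtain \<rho> where \<rho>: "inj_on \<rho> X" "\<rho> ` X \<inter> Y = {}"
    by (rule ex_fresh_inj_on[OF inf, of X Y]) (auto simp: X_def Y_def fin)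
  define \<theta> where "\<theta> x = (if x \<in> X then \<rho> x else x)" for x
  define h where "h = (\<lambda>i. subst_uc (\<lambda>x. Var (\<theta> x)) (f i))"
  define C where "C = image_mset (subst_bic (\<lambda>x. Var (\<theta> x))) B"
  let ?H = "image_mset h (mset_set I)"
  have H: "?H = image_mset (subst_uc (\<lambda>x. Var (\<theta> x))) ?A"
    by (simp add: h_def multiset.map_comp comp_def)
  have vars: "vars_ucs ?H \<union> vars_bics C \<subseteq> W \<union> \<rho> ` X"
    unfolding H C_def vars_ucs_image_subst vars_bics_image_subst by (auto simp: \<theta>_def X_def)
  \<comment> \<open>The left state reads only \<open>V\<close> and the right one only
    \<open>V'\<close>; since their semantics coincide, values outside \<open>W\<close> do not
    matter. The mixed valuation \<open>\<alpha>2\<close> carries this out.\<close>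
  have L: "reach CT B V I f \<alpha> M \<longleftrightarrow> reach CT B V I f \<alpha>' M" if "\<And>x. x \<in> W \<Longrightarrow> \<alpha> x = \<alpha>' x" for \<alpha> \<alpha>' M
  proof -
    define \<alpha>2 where "\<alpha>2 x = (if x \<in> V then \<alpha> x else \<alpha>' x)" for x
    have "reach CT B V I f \<alpha> M \<longleftrightarrow> reach CT B V I f \<alpha>2 M"
      by (rule reach_cong) (auto simp: \<alpha>2_def)
    also have "\<dots> \<longleftrightarrow> reach CT B' V' I g \<alpha>' M"
      unfolding reach using that by (intro reach_cong) (auto simp: \<alpha>2_def W_def)
    finally show ?thesis by (simp add: reach)
  qed
  \<comment> \<open>\<open>U\<close> will be \<open>V\<close> and \<open>V'\<close>. Values on
    \<open>U - W\<close> are harmless: those variables do not occur in the renamed state, as the new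
    names avoid them.\<close>
  have R: "reach CT C U I h = reach CT B V I f" if "W \<subseteq> U" "U \<subseteq> V \<union> V'" for U
  proof (intro ext iffI)
    fix \<alpha> M
    assume "reach CT C U I h \<alpha> M"
    then obtain \<beta> where \<beta>: "\<forall>x\<in>U. \<beta> x = \<alpha> x" "holds_all CT \<beta> C" "\<forall>i\<in>I. eval_uc CT \<beta> (h i) = M i"
      unfolding reach_def by blast
    then have "reach CT B V I f (\<lambda>x. \<beta> (\<theta> x)) M"
      unfolding reach_def by (intro exI[of _ "\<lambda>x. \<beta> (\<theta> x)"])
        (auto simp: h_def C_def eval_subst_uc holds_all_subst_bic)
    moreover have "\<beta> (\<theta> x) = \<alpha> x" if "x \<in> W" for x
      using that \<open>W \<subseteq> U\<close> \<beta>(1) by (auto simp: \<theta>_def X_def)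
    ultimately show "reach CT B V I f \<alpha> M" using L by metis
  next
    fix \<alpha> M
    assume "reach CT B V I f \<alpha> M"
    then obtain \<beta> where \<beta>: "\<forall>x\<in>V. \<beta> x = \<alpha> x" "holds_all CT \<beta> B" "\<forall>i\<in>I. eval_uc CT \<beta> (f i) = M i"
      unfolding reach_def by blast
    define \<gamma> where "\<gamma> y = (if y \<in> \<rho> ` X then \<beta> (inv_into X \<rho> y) else \<alpha> y)" for y
    have \<gamma>: "\<gamma> (\<theta> x) = \<beta> x" if "x \<in> vars_ucs ?A \<union> vars_bics B" for x
    proof (cases "x \<in> X")
      case True
      then show ?thesis using \<rho>(1) by (simp add: \<gamma>_def \<theta>_def)
    next
      case False
      then have "x \<in> W" "x \<notin> \<rho> ` X" using that \<rho>(2) by (auto simp: X_def Y_def)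
      then show ?thesis using False \<beta>(1) by (simp add: \<gamma>_def \<theta>_def W_def)
    qed
    have "holds_all CT \<gamma> C"
      unfolding C_def holds_all_subst_bic using \<beta>(2) holds_all_cong[of B "\<lambda>x. \<gamma> (\<theta> x)" \<beta>] \<gamma> by auto
    moreover have "eval_uc CT \<gamma> (h i) = eval_uc CT \<beta> (f i)" if "i \<in> I" for i
      unfolding h_def eval_subst_uc using \<gamma> vars_uc_subset_vars_ucs[OF fin(3) that, of f]
      by (intro eval_uc_cong) auto
    moreover have "\<gamma> x = \<alpha> x" if "x \<in> U" for x
      using that \<open>U \<subseteq> V \<union> V'\<close> \<rho>(2) by (auto simp: \<gamma>_def Y_def)
    ultimately show "reach CT C U I h \<alpha> M"
      using \<beta>(3) unfolding reach_def by (intro exI[of _ \<gamma>]) auto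
  qed
  have "state_equiv CT (State ?A B V) (State ?H C V)"
  proof (rule state_equivI_disjoint[OF inf fin(1,3) cons _ R[symmetric]])
    show "(vars_ucs ?A \<union> vars_bics B) \<inter> (vars_ucs ?H \<union> vars_bics C) \<subseteq> V"
      using vars \<rho>(2) unfolding Y_def W_def by blast
  qed (auto simp: W_def)
  also have "state_equiv CT \<dots> (State ?H C W)"
  proof -
    have "(V - W) \<inter> (vars_ucs ?H \<union> vars_bics C) = {}" "V - W \<union> W = V"
      using vars \<rho>(2) unfolding Y_def W_def by blast+
    then show ?thesis
      using state_equiv_unused_globals[of "V - W" ?H C CT W] fin by simp
  qed
  also have "state_equiv CT \<dots> (State ?H C V')"
  proof -
    have "(V' - W) \<inter> (vars_ucs ?H \<union> vars_bics C) = {}" "V' - W \<union> W = V'"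
      using vars \<rho>(2) unfolding Y_def W_def by blast+
    then show ?thesis
      using state_equiv_unused_globals[of "V' - W" ?H C CT W] fin by (simp add: state_equiv_sym)
  qed
  also have "state_equiv CT \<dots> (State ?A' B' V')"
  proof (rule state_equiv_sym, rule state_equivI_disjoint[OF inf fin(2,3)])
    show "reach CT B' V' I g = reach CT C V' I h" using R[of V'] reach by (auto simp: W_def)
    show "\<exists>\<beta>. holds_all CT \<beta> B'" using cons reach reach_nonempty_iff by metis
    show "(vars_ucs ?A' \<union> vars_bics B') \<inter> (vars_ucs ?H \<union> vars_bics C) \<subseteq> V'"
      using vars \<rho>(2) unfolding Y_def W_def by blast
  qed
  finally show ?thesis .
qed

section \<open>Embeddings of typed graphs\<close>

text \<open>Unlike in \<open>inj_typed_morphism\<close>, source and target may have different HOL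
  types of items; the concrete pushout lives on sum types.\<close>

definition typed_embedding ::
  "('n \<Rightarrow> 'n2) \<Rightarrow> ('e \<Rightarrow> 'e2) \<Rightarrow> ('n, 'e, 'tn, 'te) tgraph \<Rightarrow> ('n2, 'e2, 'tn, 'te) tgraph \<Rightarrow> bool" where
  "typed_embedding fn fe G H \<longleftrightarrow>
     inj_on fn (verts (gr G)) \<and> inj_on fe (arcs (gr G)) \<and>
     fn ` verts (gr G) \<subseteq> verts (gr H) \<and> fe ` arcs (gr G) \<subseteq> arcs (gr H) \<and>
     (\<forall>v\<in>verts (gr G). ntype H (fn v) = ntype G v) \<and>
     (\<forall>e\<in>arcs (gr G). etype H (fe e) = etype G e \<and>
        tail (gr H) (fe e) = fn (tail (gr G) e) \<and> head (gr H) (fe e) = fn (head (gr G) e))"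

definition typed_iso ::
  "('n \<Rightarrow> 'n2) \<Rightarrow> ('e \<Rightarrow> 'e2) \<Rightarrow> ('n, 'e, 'tn, 'te) tgraph \<Rightarrow> ('n2, 'e2, 'tn, 'te) tgraph \<Rightarrow> bool" where
  "typed_iso fn fe G H \<longleftrightarrow>
     typed_embedding fn fe G H \<and> fn ` verts (gr G) = verts (gr H) \<and> fe ` arcs (gr G) = arcs (gr H)"

lemma inj_typed_morphism_iff: "inj_typed_morphism G H (fn, fe) \<longleftrightarrow> typed_embedding fn fe G H"
  by (auto simp: inj_typed_morphism_def typed_morphism_def graph_morphism_def typed_embedding_def)

lemma inj_typed_morphism_imp_embedding:
  "inj_typed_morphism G H m \<Longrightarrow> typed_embedding (fst m) (snd m) G H"
  by (simp add: inj_typed_morphism_iff[symmetric])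

lemma typed_isomorphic_iff: "typed_isomorphic G H \<longleftrightarrow> (\<exists>fn fe. typed_iso fn fe G H)"
  by (auto simp: typed_isomorphic_def typed_iso_def inj_typed_morphism_iff)

lemma typed_embedding_comp:
  assumes "typed_embedding fn fe G H" "typed_embedding gn ge H J"
  shows "typed_embedding (gn \<circ> fn) (ge \<circ> fe) G J"
proof -
  have "inj_on (gn \<circ> fn) (verts (gr G))" "inj_on (ge \<circ> fe) (arcs (gr G))"
    by (rule comp_inj_on; use assms in \<open>auto simp: typed_embedding_def intro: inj_on_subset\<close>)+
  then show ?thesis
    using assms unfolding typed_embedding_def by (auto simp: image_subset_iff)
qed

lemma typed_iso_comp:
  assumes "typed_iso fn fe G H" "typed_iso gn ge H J"
  shows "typed_iso (gn \<circ> fn) (ge \<circ> fe) G J"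
proof -
  have "typed_embedding fn fe G H" "typed_embedding gn ge H J"
    using assms by (simp_all add: typed_iso_def)
  then have "typed_embedding (gn \<circ> fn) (ge \<circ> fe) G J"
    by (rule typed_embedding_comp)
  then show ?thesis
    using assms unfolding typed_iso_def by (metis image_comp)
qed

lemma typed_graphD:
  assumes "typed_graph TG G"
  shows "finite (verts (gr G))" "finite (arcs (gr G))"
    "e \<in> arcs (gr G) \<Longrightarrow> tail (gr G) e \<in> verts (gr G)"
    "e \<in> arcs (gr G) \<Longrightarrow> head (gr G) e \<in> verts (gr G)"
    "v \<in> verts (gr G) \<Longrightarrow> ntype G v \<in> verts (type_gr TG)"
    "e \<in> arcs (gr G) \<Longrightarrow> etype G e \<in> arcs (type_gr TG)"
    "e \<in> arcs (gr G) \<Longrightarrow> tail (type_gr TG) (etype G e) = ntype G (tail (gr G) e)"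
    "e \<in> arcs (gr G) \<Longrightarrow> head (type_gr TG) (etype G e) = ntype G (head (gr G) e)"
  using assms
  by (auto simp: typed_graph_def fin_digraph_def fin_digraph_axioms_def wf_digraph_def graph_morphism_def)

lemma typed_graphI:
  assumes "finite (verts (gr G))" "finite (arcs (gr G))"
    "\<And>e. e \<in> arcs (gr G) \<Longrightarrow> tail (gr G) e \<in> verts (gr G)"
    "\<And>e. e \<in> arcs (gr G) \<Longrightarrow> head (gr G) e \<in> verts (gr G)"
    "\<And>v. v \<in> verts (gr G) \<Longrightarrow> ntype G v \<in> verts (type_gr TG)"
    "\<And>e. e \<in> arcs (gr G) \<Longrightarrow> etype G e \<in> arcs (type_gr TG)"
    "\<And>e. e \<in> arcs (gr G) \<Longrightarrow> tail (type_gr TG) (etype G e) = ntype G (tail (gr G) e)"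
    "\<And>e. e \<in> arcs (gr G) \<Longrightarrow> head (type_gr TG) (etype G e) = ntype G (head (gr G) e)"
  shows "typed_graph TG G"
  using assms
  by (auto simp: typed_graph_def fin_digraph_def fin_digraph_axioms_def wf_digraph_def graph_morphism_def)

lemma finite_items: "typed_graph TG G \<Longrightarrow> finite (items (gr G))"
  by (simp add: items_def typed_graphD)

lemma items_simps [simp]:
  "Inl v \<in> items G \<longleftrightarrow> v \<in> verts G" "Inr e \<in> items G \<longleftrightarrow> e \<in> arcs G"
  by (auto simp: items_def)

lemma typed_iso_sym:
  assumes "typed_iso fn fe G H" "typed_graph TG G"
  shows "typed_iso (inv_into (verts (gr G)) fn) (inv_into (arcs (gr G)) fe) H G"
proof -
  note f = assms(1)[unfolded typed_iso_def typed_embedding_def]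
  have n: "bij_betw fn (verts (gr G)) (verts (gr H))" and e: "bij_betw fe (arcs (gr G)) (arcs (gr H))"
    using f by (auto simp: bij_betw_def)
  let ?gn = "inv_into (verts (gr G)) fn" and ?ge = "inv_into (arcs (gr G)) fe"
  have gn: "?gn ` verts (gr H) = verts (gr G)" "inj_on ?gn (verts (gr H))"
    using bij_betw_inv_into[OF n] by (auto simp: bij_betw_def)
  have ge: "?ge ` arcs (gr H) = arcs (gr G)" "inj_on ?ge (arcs (gr H))"
    using bij_betw_inv_into[OF e] by (auto simp: bij_betw_def)
  have "ntype G (?gn v) = ntype H v" if "v \<in> verts (gr H)" for v
    using that f gn(1) by (metis bij_betw_inv_into_right imageI n)
  moreover have "etype G (?ge a) = etype H a \<and> tail (gr G) (?ge a) = ?gn (tail (gr H) a) \<and>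
      head (gr G) (?ge a) = ?gn (head (gr H) a)" if "a \<in> arcs (gr H)" for a
  proof -
    have a: "?ge a \<in> arcs (gr G)" "fe (?ge a) = a"
      using that e ge(1) by (auto simp: bij_betw_inv_into_right)
    moreover from f a(1) have "tail (gr H) (fe (?ge a)) = fn (tail (gr G) (?ge a))"
      "head (gr H) (fe (?ge a)) = fn (head (gr G) (?ge a))" "etype H (fe (?ge a)) = etype G (?ge a)"
      by simp_all
    ultimately have "tail (gr H) a = fn (tail (gr G) (?ge a))" "head (gr H) a = fn (head (gr G) (?ge a))"
      "etype H a = etype G (?ge a)"
      by simp_all
    then show ?thesis
      using typed_graphD(3,4)[OF assms(2) a(1)] n by (simp add: bij_betw_inv_into_left)
  qed
  ultimately show ?thesis
    using gn ge unfolding typed_iso_def typed_embedding_def by auto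
qed

lemma typed_graph_iso:
  assumes "typed_iso fn fe G H" "typed_graph TG G"
  shows "typed_graph TG H"
proof -
  note f = assms(1)[unfolded typed_iso_def typed_embedding_def]
  have n: "\<exists>w\<in>verts (gr G). v = fn w" if "v \<in> verts (gr H)" for v using f that by auto
  have a: "\<exists>d\<in>arcs (gr G). e = fe d" if "e \<in> arcs (gr H)" for e using f that by auto
  note G = typed_graphD[OF assms(2)]
  show ?thesis
  proof (rule typed_graphI)
    show "finite (verts (gr H))" "finite (arcs (gr H))"
      using f G(1,2) by (metis finite_imageI)+
    show "ntype H v \<in> verts (type_gr TG)" if "v \<in> verts (gr H)" for v
      using n[OF that] f G(5) by auto
    fix e assume "e \<in> arcs (gr H)"
    then obtain d where d: "d \<in> arcs (gr G)" "e = fe d" using a by blast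
    then have *: "tail (gr H) e = fn (tail (gr G) d)" "head (gr H) e = fn (head (gr G) d)"
      "etype H e = etype G d"
      using f by auto
    show "tail (gr H) e \<in> verts (gr H)" "head (gr H) e \<in> verts (gr H)"
      unfolding * using f G(3,4)[OF d(1)] by auto
    show "etype H e \<in> arcs (type_gr TG)"
      "tail (type_gr TG) (etype H e) = ntype H (tail (gr H) e)"
      "head (type_gr TG) (etype H e) = ntype H (head (gr H) e)"
      unfolding * using f G(3,4,6-8)[OF d(1)] by auto
  qed
qed

text \<open>Used to bring a graph on sum types back to the original types of names, away from
  finitely many names already taken.\<close>

lemma ex_fresh_typed_iso:
  fixes G :: "('n, 'e, 'tn, 'te) tgraph"
  assumes "infinite (UNIV :: 'n2 set)" "infinite (UNIV :: 'e2 set)" "finite X" "finite Y" "typed_graph TG G"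
  obtains fn fe and H :: "('n2, 'e2, 'tn, 'te) tgraph"
  where "typed_iso fn fe G H" "verts (gr H) \<inter> X = {}" "arcs (gr H) \<inter> Y = {}"
proof -
  note G = typed_graphD[OF assms(5)]
  obtain fn :: "'n \<Rightarrow> 'n2" where fn: "inj_on fn (verts (gr G))" "fn ` verts (gr G) \<inter> X = {}"
    by (rule ex_fresh_inj_on[OF assms(1) G(1) assms(3)])
  obtain fe :: "'e \<Rightarrow> 'e2" where fe: "inj_on fe (arcs (gr G))" "fe ` arcs (gr G) \<inter> Y = {}"
    by (rule ex_fresh_inj_on[OF assms(2) G(2) assms(4)])
  let ?gn = "inv_into (verts (gr G)) fn" and ?ge = "inv_into (arcs (gr G)) fe"
  define H where "H = \<lparr> gr = \<lparr> verts = fn ` verts (gr G), arcs = fe ` arcs (gr G),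
      tail = (\<lambda>e. fn (tail (gr G) (?ge e))), head = (\<lambda>e. fn (head (gr G) (?ge e))) \<rparr>,
    ntype = (\<lambda>v. ntype G (?gn v)), etype = (\<lambda>e. etype G (?ge e)) \<rparr>"
  have "typed_iso fn fe G H"
    using fn(1) fe(1) by (auto simp: typed_iso_def typed_embedding_def H_def)
  with fn(2) fe(2) that show thesis
    by (auto simp: H_def)
qed

lemma card_ends_image:
  assumes "inj_on fn V" "inj_on fe A" "v \<in> V"
    "\<And>e. e \<in> A \<Longrightarrow> t e \<in> V" "\<And>e. e \<in> A \<Longrightarrow> t' (fe e) = fn (t e)"
  shows "card {e \<in> fe ` A. t' e = fn v} = card {e \<in> A. t e = v}"
proof -
  have "t' (fe e) = fn v \<longleftrightarrow> t e = v" if "e \<in> A" for e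
    using assms that by (metis inj_onD)
  then have "{e \<in> fe ` A. t' e = fn v} = fe ` {e \<in> A. t e = v}"
    by auto
  moreover have "inj_on fe {e \<in> A. t e = v}"
    using assms(2) by (rule inj_on_subset) auto
  ultimately show ?thesis by (simp add: card_image)
qed

lemma deg_eq:
  "deg G v = card {e \<in> arcs G. tail G e = v} + card {e \<in> arcs G. head G e = v}"
  by (simp add: deg_def out_degree_def in_degree_def out_arcs_def in_arcs_def)

lemma deg_typed_iso:
  assumes "typed_iso fn fe G H" "typed_graph TG G" "v \<in> verts (gr G)"
  shows "deg (gr H) (fn v) = deg (gr G) v"
proof -
  note f = assms(1)[unfolded typed_iso_def typed_embedding_def]
  have inj: "inj_on fn (verts (gr G))" "inj_on fe (arcs (gr G))" using f by simp_all
  have "card {e \<in> fe ` arcs (gr G). tail (gr H) e = fn v} = card {e \<in> arcs (gr G). tail (gr G) e = v}"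
    using f typed_graphD(3)[OF assms(2)] by (intro card_ends_image[OF inj assms(3)]) simp_all
  moreover have "card {e \<in> fe ` arcs (gr G). head (gr H) e = fn v} = card {e \<in> arcs (gr G). head (gr G) e = v}"
    using f typed_graphD(4)[OF assms(2)] by (intro card_ends_image[OF inj assms(3)]) simp_all
  moreover have "fe ` arcs (gr G) = arcs (gr H)" using f by simp
  ultimately show ?thesis
    unfolding deg_eq by simp
qed

section \<open>Values of graph items\<close>

text \<open>Identifiers \<iota> and degrees \<delta> are separate parameters, so that one function
  describes ground encodings (actual degrees), kernel encodings (free degrees) and the mixed head of
  a rule.\<close>

fun item_val ::
  "('tn, 'te, 'l) type_graph \<Rightarrow> ('n, 'e, 'tn, 'te) tgraph \<Rightarrow> ('n + 'e \<Rightarrow> 'd) \<Rightarrow> ('n \<Rightarrow> 'd)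
     \<Rightarrow> 'n + 'e \<Rightarrow> 'l \<times> 'd list" where
  "item_val TG G \<iota> \<delta> (Inl v) = (label TG (Inl (ntype G v)), [\<iota> (Inl v), \<delta> v])"
| "item_val TG G \<iota> \<delta> (Inr e) = (label TG (Inr (etype G e)),
     [\<iota> (Inr e), \<iota> (Inl (tail (gr G) e)), \<iota> (Inl (head (gr G) e))])"

lemma item_val_cong:
  assumes "typed_graph TG G" "x \<in> items (gr G)"
    "\<And>y. y \<in> items (gr G) \<Longrightarrow> \<iota> y = \<iota>' y" "\<And>v. v \<in> verts (gr G) \<Longrightarrow> \<delta> v = \<delta>' v"
  shows "item_val TG G \<iota> \<delta> x = item_val TG G \<iota>' \<delta>' x"
  using assms typed_graphD(3,4)[OF assms(1)] by (cases x) auto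

lemma item_val_iso:
  assumes "typed_iso fn fe G H" "typed_graph TG G" "x \<in> items (gr G)"
  shows "item_val TG H \<iota> \<delta> (map_sum fn fe x) = item_val TG G (\<iota> \<circ> map_sum fn fe) (\<delta> \<circ> fn) x"
  using assms typed_graphD(3,4)[OF assms(2)]
  by (cases x) (auto simp: typed_iso_def typed_embedding_def)

text \<open>Where the identifiers are pairwise distinct, the values of the items determine the graph.\<close>

lemma item_val_embedding:
  assumes TG: "is_type_graph TG" and L: "typed_graph TG L" and G: "typed_graph TG G"
    and f: "inj_on f (items (gr L))" "f ` items (gr L) \<subseteq> items (gr G)"
    and \<iota>: "inj_on \<iota> (items (gr G))"
    and val: "\<And>x. x \<in> items (gr L) \<Longrightarrow> item_val TG G \<iota> \<delta> (f x) = item_val TG L \<iota>' \<delta>' x"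
  obtains fn fe where "typed_embedding fn fe L G" "\<forall>x\<in>items (gr L). f x = map_sum fn fe x"
    "\<forall>x\<in>items (gr L). \<iota>' x = \<iota> (f x)" "\<forall>v\<in>verts (gr L). \<delta>' v = \<delta> (fn v)"
proof -
  define fn where "fn v = projl (f (Inl v))" for v
  define fe where "fe e = projr (f (Inr e))" for e
  have lab: "inj_on (label TG) (items (type_gr TG))"
    using TG by (simp add: is_type_graph_def)
  have n: "f (Inl v) = Inl (fn v)" "fn v \<in> verts (gr G)" "ntype G (fn v) = ntype L v"
      "\<iota>' (Inl v) = \<iota> (Inl (fn v))" "\<delta>' v = \<delta> (fn v)"
    if "v \<in> verts (gr L)" for v
  proof -
    \<comment> \<open>A node has two argument values and an edge three, so the two cannot be
      matched.\<close>
    show *: "f (Inl v) = Inl (fn v)"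
      using val[of "Inl v"] that by (cases "f (Inl v)") (auto simp: fn_def)
    show **: "fn v \<in> verts (gr G)"
      using f(2) that * by (metis image_subset_iff items_simps(1))
    \<comment> \<open>Labels are unique on the type graph, so equal labels give equal types.\<close>
    show "ntype G (fn v) = ntype L v" "\<iota>' (Inl v) = \<iota> (Inl (fn v))" "\<delta>' v = \<delta> (fn v)"
      using val[of "Inl v"] that * typed_graphD(5)[OF L that] typed_graphD(5)[OF G **]
      by (auto dest: inj_onD[OF lab])
  qed
  have e: "f (Inr a) = Inr (fe a)" "fe a \<in> arcs (gr G)" "etype G (fe a) = etype L a"
      "\<iota>' (Inr a) = \<iota> (Inr (fe a))" "tail (gr G) (fe a) = fn (tail (gr L) a)"
      "head (gr G) (fe a) = fn (head (gr L) a)"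
    if "a \<in> arcs (gr L)" for a
  proof -
    show *: "f (Inr a) = Inr (fe a)"
      using val[of "Inr a"] that by (cases "f (Inr a)") (auto simp: fe_def)
    show **: "fe a \<in> arcs (gr G)"
      using f(2) that * by (metis image_subset_iff items_simps(2))
    note LG = typed_graphD(3,4,6)[OF L that] typed_graphD(3,4,6)[OF G **]
    show "etype G (fe a) = etype L a" "\<iota>' (Inr a) = \<iota> (Inr (fe a))"
      using val[of "Inr a"] that * LG by (auto dest: inj_onD[OF lab])
    \<comment> \<open>End points are known only through their identifiers; injectivity of \<iota>
      turns this into equality of nodes.\<close>
    have "\<iota> (Inl (tail (gr G) (fe a))) = \<iota> (Inl (fn (tail (gr L) a)))"
      "\<iota> (Inl (head (gr G) (fe a))) = \<iota> (Inl (fn (head (gr L) a)))"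
      using val[of "Inr a"] that * n(4) LG by auto
    then show "tail (gr G) (fe a) = fn (tail (gr L) a)" "head (gr G) (fe a) = fn (head (gr L) a)"
      using n(2) LG by (auto dest!: inj_onD[OF \<iota>])
  qed
  have "inj_on fn (verts (gr L))"
  proof (rule inj_onI)
    fix v w assume *: "v \<in> verts (gr L)" "w \<in> verts (gr L)" "fn v = fn w"
    then have "f (Inl v) = f (Inl w)" using n(1) by simp
    with * show "v = w" by (auto dest: inj_onD[OF f(1)])
  qed
  moreover have "inj_on fe (arcs (gr L))"
  proof (rule inj_onI)
    fix v w assume *: "v \<in> arcs (gr L)" "w \<in> arcs (gr L)" "fe v = fe w"
    then have "f (Inr v) = f (Inr w)" using e(1) by simp
    with * show "v = w" by (auto dest: inj_onD[OF f(1)])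
  qed
  ultimately have "typed_embedding fn fe L G"
    unfolding typed_embedding_def using n e by auto
  moreover have "f x = map_sum fn fe x" "\<iota>' x = \<iota> (f x)" if "x \<in> items (gr L)" for x
    using that n(1,4) e(1,4) by (cases x; simp)+
  ultimately show thesis
    using that n(5) by blast
qed

lemma Inl_in_Plus_iff: "Inl x \<in> A <+> B \<longleftrightarrow> x \<in> A"
  and Inr_in_Plus_iff: "Inr y \<in> A <+> B \<longleftrightarrow> y \<in> B"
  by auto

lemma Plus_eq_iff: "A <+> B = C <+> D \<longleftrightarrow> A = C \<and> B = D"
  by (metis Inl_in_Plus_iff Inr_in_Plus_iff set_eqI)

lemma items_map_sum: "map_sum fn fe ` items G = fn ` verts G <+> fe ` arcs G"
  by (simp add: items_def Plus_def image_Un image_image)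

lemma item_val_bij_iso:
  assumes "is_type_graph TG" "typed_graph TG L" "typed_graph TG G"
    and f: "bij_betw f (items (gr L)) (items (gr G))"
    and "inj_on \<iota> (items (gr G))"
    and "\<And>x. x \<in> items (gr L) \<Longrightarrow> item_val TG G \<iota> \<delta> (f x) = item_val TG L \<iota>' \<delta>' x"
  obtains fn fe where "typed_iso fn fe L G" "\<forall>x\<in>items (gr L). f x = map_sum fn fe x"
    "\<forall>x\<in>items (gr L). \<iota>' x = \<iota> (f x)" "\<forall>v\<in>verts (gr L). \<delta>' v = \<delta> (fn v)"
proof -
  have f': "inj_on f (items (gr L))" "f ` items (gr L) = items (gr G)"
    using f by (auto simp: bij_betw_def)
  obtain fn fe where fne: "typed_embedding fn fe L G" "\<forall>x\<in>items (gr L). f x = map_sum fn fe x"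
    "\<forall>x\<in>items (gr L). \<iota>' x = \<iota> (f x)" "\<forall>v\<in>verts (gr L). \<delta>' v = \<delta> (fn v)"
    by (rule item_val_embedding[OF assms(1-3) f'(1) eq_refl[OF f'(2)] assms(5,6)])
  have "fn ` verts (gr L) <+> fe ` arcs (gr L) = items (gr G)"
    using f'(2) fne(2) unfolding items_map_sum[symmetric] by (metis image_cong)
  then have "fn ` verts (gr L) = verts (gr G)" "fe ` arcs (gr L) = arcs (gr G)"
    unfolding items_def Plus_eq_iff by simp_all
  then show thesis
    using that fne unfolding typed_iso_def by blast
qed

section \<open>A concrete pushout\<close>

text \<open>
  The item of the result that stands for an item \<open>y\<close> of the context graph \<open>D\<close>: images of the
  kernel are represented by their counterpart in the right-hand side.
\<close>

definition survivor :: "'a set \<Rightarrow> ('a \<Rightarrow> 'b) \<Rightarrow> 'b \<Rightarrow> 'a + 'b" where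
  "survivor K f y = (if y \<in> f ` K then Inl (inv_into K f y) else Inr y)"

text \<open>The sum types provide fresh names: \<open>Inl\<close> for all of \<open>R\<close>,
  kernel included, and \<open>Inr\<close> for the unmatched items of \<open>G\<close>. A dangling
  edge would end in \<open>Inr\<close> of a deleted node, which is not a node here; applicability
  makes the graph well-formed.\<close>

definition pushout ::
  "('n, 'e, 'tn, 'te) gt_rule \<Rightarrow> ('n, 'e) mor \<Rightarrow> ('n, 'e, 'tn, 'te) tgraph
     \<Rightarrow> ('n + 'n, 'e + 'e, 'tn, 'te) tgraph" where
  "pushout p m G =
     \<lparr> gr = \<lparr> verts = verts (gr (rhs p)) <+> (verts (gr G) - fst m ` verts (gr (lhs p))),
        arcs = arcs (gr (rhs p)) <+> (arcs (gr G) - snd m ` arcs (gr (lhs p))),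
        tail = case_sum (\<lambda>e. Inl (tail (gr (rhs p)) e))
          (\<lambda>e. survivor (verts (gr (ker p))) (fst m) (tail (gr G) e)),
        head = case_sum (\<lambda>e. Inl (head (gr (rhs p)) e))
          (\<lambda>e. survivor (verts (gr (ker p))) (fst m) (head (gr G) e)) \<rparr>,
      ntype = case_sum (ntype (rhs p)) (ntype G),
      etype = case_sum (etype (rhs p)) (etype G) \<rparr>"

lemma survivor_image: "inj_on f K \<Longrightarrow> k \<in> K \<Longrightarrow> survivor K f (f k) = Inl k"
  by (simp add: survivor_def)

lemma survivor_other: "y \<notin> f ` K \<Longrightarrow> survivor K f y = Inr y"
  by (simp add: survivor_def)

lemma inj_on_case_sum:
  assumes "inj_on f A" "inj_on g B" "g ` B \<inter> f ` A = {}"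
  shows "inj_on (case_sum f g) (A <+> B)"
proof (rule inj_onI)
  fix x y
  assume "x \<in> A <+> B" "y \<in> A <+> B" "case_sum f g x = case_sum f g y"
  then show "x = y"
    using assms(3) by (cases x; cases y) (auto dest: inj_onD[OF assms(1)] inj_onD[OF assms(2)])
qed

locale typed_rule =
  fixes TG :: "('tn, 'te, 'l) type_graph" and r :: "('n, 'e, 'tn, 'te) gt_rule"
  assumes TG: "is_type_graph TG" and rule: "gt_rule_over TG r"
begin

abbreviation "L \<equiv> gr (lhs r)"
abbreviation "K \<equiv> gr (ker r)"
abbreviation "R \<equiv> gr (rhs r)"

lemma L: "typed_graph TG (lhs r)" and K: "typed_graph TG (ker r)" and R: "typed_graph TG (rhs r)"
  using rule by (auto simp: gt_rule_over_def)

lemma ker_sub: "verts K \<subseteq> verts L" "verts K \<subseteq> verts R" "arcs K \<subseteq> arcs L" "arcs K \<subseteq> arcs R"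
  using rule by (auto simp: gt_rule_over_def typed_morphism_def graph_morphism_def)

lemma ker_eq:
  "v \<in> verts K \<Longrightarrow> ntype (lhs r) v = ntype (ker r) v"
  "v \<in> verts K \<Longrightarrow> ntype (rhs r) v = ntype (ker r) v"
  "e \<in> arcs K \<Longrightarrow> etype (lhs r) e = etype (ker r) e"
  "e \<in> arcs K \<Longrightarrow> etype (rhs r) e = etype (ker r) e"
  "e \<in> arcs K \<Longrightarrow> tail L e = tail K e" "e \<in> arcs K \<Longrightarrow> head L e = head K e"
  "e \<in> arcs K \<Longrightarrow> tail R e = tail K e" "e \<in> arcs K \<Longrightarrow> head R e = head K e"
  using rule by (auto simp: gt_rule_over_def typed_morphism_def graph_morphism_def)

end

locale gt_match = typed_rule TG r
  for TG :: "('tn, 'te, 'l) type_graph" and r :: "('n, 'e, 'tn, 'te) gt_rule" +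
  fixes G :: "('n, 'e, 'tn, 'te) tgraph" and m :: "('n, 'e) mor"
  assumes G: "typed_graph TG G" and match: "inj_typed_morphism (lhs r) G m"
begin

abbreviation "PO \<equiv> pushout r m G"
abbreviation "\<kappa> \<equiv> survivor (verts K) (fst m)"
abbreviation "\<kappa>\<^sub>e \<equiv> survivor (arcs K) (snd m)"
abbreviation "ctx_verts \<equiv> verts (gr G) - fst m ` verts L"
abbreviation "ctx_arcs \<equiv> arcs (gr G) - snd m ` arcs L"

lemma emb: "typed_embedding (fst m) (snd m) (lhs r) G"
  using match by (rule inj_typed_morphism_imp_embedding)

lemma m_inj: "inj_on (fst m) (verts L)" "inj_on (snd m) (arcs L)"
  using emb by (simp_all add: typed_embedding_def)

lemma m_inj_ker: "inj_on (fst m) (verts K)" "inj_on (snd m) (arcs K)"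
  using m_inj ker_sub by (auto intro: inj_on_subset)

lemma m_in: "v \<in> verts L \<Longrightarrow> fst m v \<in> verts (gr G)" "e \<in> arcs L \<Longrightarrow> snd m e \<in> arcs (gr G)"
  using emb by (auto simp: typed_embedding_def)

lemma m_eq:
  "v \<in> verts L \<Longrightarrow> ntype G (fst m v) = ntype (lhs r) v"
  "e \<in> arcs L \<Longrightarrow> etype G (snd m e) = etype (lhs r) e"
  "e \<in> arcs L \<Longrightarrow> tail (gr G) (snd m e) = fst m (tail L e)"
  "e \<in> arcs L \<Longrightarrow> head (gr G) (snd m e) = fst m (head L e)"
  using emb by (auto simp: typed_embedding_def)

lemma m_eq_iff:
  "v \<in> verts L \<Longrightarrow> w \<in> verts L \<Longrightarrow> fst m v = fst m w \<longleftrightarrow> v = w"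
  "e \<in> arcs L \<Longrightarrow> d \<in> arcs L \<Longrightarrow> snd m e = snd m d \<longleftrightarrow> e = d"
  using m_inj by (auto dest: inj_onD)

lemma m_image_ker:
  "v \<in> verts L \<Longrightarrow> fst m v \<in> fst m ` verts K \<longleftrightarrow> v \<in> verts K"
  "e \<in> arcs L \<Longrightarrow> snd m e \<in> snd m ` arcs K \<longleftrightarrow> e \<in> arcs K"
  using m_inj ker_sub by (auto dest: inj_onD)

lemma remainder_verts: "verts (gr (remainder r m G)) = ctx_verts \<union> fst m ` verts K"
  using m_in(1) m_image_ker(1) ker_sub(1) by (auto simp: remainder_def m_eq_iff)

lemma remainder_arcs: "arcs (gr (remainder r m G)) = ctx_arcs \<union> snd m ` arcs K"
  using m_in(2) m_image_ker(2) ker_sub(3) by (auto simp: remainder_def m_eq_iff)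

lemma remainder_simps:
  "tail (gr (remainder r m G)) = tail (gr G)" "head (gr (remainder r m G)) = head (gr G)"
  "ntype (remainder r m G) = ntype G" "etype (remainder r m G) = etype G"
  by (simp_all add: remainder_def)

lemma pushout_simps [simp]:
  "verts (gr PO) = verts R <+> ctx_verts" "arcs (gr PO) = arcs R <+> ctx_arcs"
  "tail (gr PO) (Inl e) = Inl (tail R e)" "tail (gr PO) (Inr e) = \<kappa> (tail (gr G) e)"
  "head (gr PO) (Inl e) = Inl (head R e)" "head (gr PO) (Inr e) = \<kappa> (head (gr G) e)"
  "ntype PO (Inl v) = ntype (rhs r) v" "ntype PO (Inr v) = ntype G v"
  "etype PO (Inl e) = etype (rhs r) e" "etype PO (Inr e) = etype G e"
  by (simp_all add: pushout_def)

lemma \<kappa>_ker: "k \<in> verts K \<Longrightarrow> \<kappa> (fst m k) = Inl k" "e \<in> arcs K \<Longrightarrow> \<kappa>\<^sub>e (snd m e) = Inl e"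
  using m_inj_ker by (simp_all add: survivor_image)

lemma \<kappa>_ctx: "v \<in> ctx_verts \<Longrightarrow> \<kappa> v = Inr v" "e \<in> ctx_arcs \<Longrightarrow> \<kappa>\<^sub>e e = Inr e"
  using ker_sub by (auto intro!: survivor_other)

section \<open>Pushouts and derivations\<close>

lemma ctx_arc_ends:
  assumes "applicable r m G" "e \<in> ctx_arcs"
  shows "tail (gr G) e \<in> ctx_verts \<union> fst m ` verts K" "head (gr G) e \<in> ctx_verts \<union> fst m ` verts K"
  using assms typed_graphD(3,4)[OF G, of e] by (auto simp: applicable_def)

lemma ntype_survivor: "v \<in> ctx_verts \<union> fst m ` verts K \<Longrightarrow> ntype PO (\<kappa> v) = ntype G v"
  using ker_sub(1) by (auto simp: \<kappa>_ker \<kappa>_ctx ker_eq m_eq subset_iff)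

lemma survivor_in_pushout: "v \<in> ctx_verts \<union> fst m ` verts K \<Longrightarrow> \<kappa> v \<in> verts (gr PO)"
  using ker_sub(2) by (auto simp: \<kappa>_ker \<kappa>_ctx)

lemma typed_graph_pushout:
  assumes "applicable r m G"
  shows "typed_graph TG PO"
proof (rule typed_graphI)
  fix e assume e: "e \<in> arcs (gr PO)"
  note ends = ctx_arc_ends[OF assms] and RD = typed_graphD[OF R] and GD = typed_graphD[OF G]
  show "tail (gr PO) e \<in> verts (gr PO)" "head (gr PO) e \<in> verts (gr PO)"
    using e survivor_in_pushout[OF ends(1)] survivor_in_pushout[OF ends(2)] RD(3,4)
    by (cases e; force)+
  show "etype PO e \<in> arcs (type_gr TG)"
    "tail (type_gr TG) (etype PO e) = ntype PO (tail (gr PO) e)"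
    "head (type_gr TG) (etype PO e) = ntype PO (head (gr PO) e)"
    using e ntype_survivor[OF ends(1)] ntype_survivor[OF ends(2)] RD(6-8) GD(6-8)
    by (cases e; force)+
qed (use typed_graphD(1,2,5)[OF R] typed_graphD(1,2,5)[OF G] in auto)

text \<open>The maps \<open>n\<close> on \<open>R\<close> and \<open>h\<close> on the context
  together form the isomorphism. Their images are disjoint also on the kernel part of
  \<open>R\<close>, where \<open>n\<close> is \<open>h\<close> after the match and \<open>h\<close>
  is injective.\<close>

lemma derivation_imp_pushout_iso:
  assumes "derivation r m G H trk"
  shows "\<exists>fn fe. typed_iso fn fe PO H"
proof -
  obtain h n where gl: "glued r m (remainder r m G) H h n"
    using assms by (auto simp: derivation_def)
  note gl = this[unfolded glued_def]
  have h: "typed_embedding (fst h) (snd h) (remainder r m G) H"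
    and n: "typed_embedding (fst n) (snd n) (rhs r) H"
    using gl by (simp_all add: inj_typed_morphism_imp_embedding)
  note hD = h[unfolded typed_embedding_def remainder_verts remainder_arcs remainder_simps]
  note nD = n[unfolded typed_embedding_def]
  have hn: "fst h (fst m v) = fst n v" if "v \<in> verts K" for v using gl that by simp
  have hne: "snd h (snd m e) = snd n e" if "e \<in> arcs K" for e using gl that by simp
  have imv: "fst h ` (ctx_verts \<union> fst m ` verts K) = fst h ` ctx_verts \<union> fst n ` verts K"
    by (simp add: image_Un image_image hn)
  have ima: "snd h ` (ctx_arcs \<union> snd m ` arcs K) = snd h ` ctx_arcs \<union> snd n ` arcs K"
    by (simp add: image_Un image_image hne)
  have H: "verts (gr H) = fst h ` ctx_verts \<union> fst n ` verts R"
    "arcs (gr H) = snd h ` ctx_arcs \<union> snd n ` arcs R"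
    using gl ker_sub unfolding remainder_verts remainder_arcs imv ima by auto
  have disj: "fst h ` ctx_verts \<inter> fst n ` verts R = {}" "snd h ` ctx_arcs \<inter> snd n ` arcs R = {}"
  proof -
    have "fst h x \<noteq> fst n k" if "x \<in> ctx_verts" "k \<in> verts R" for x k
    proof (cases "k \<in> verts K")
      case True
      then have "fst m k \<in> fst m ` verts K" "x \<noteq> fst m k" using that(1) ker_sub by auto
      then have "fst h x \<noteq> fst h (fst m k)"
        using that(1) hD by (meson UnCI inj_onD)
      then show ?thesis using hn True by simp
    next
      case False
      then show ?thesis
        using that gl unfolding remainder_verts by (auto simp: disjoint_iff)
    qed
    then show "fst h ` ctx_verts \<inter> fst n ` verts R = {}" by blast
    have "snd h x \<noteq> snd n k" if "x \<in> ctx_arcs" "k \<in> arcs R" for x k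
    proof (cases "k \<in> arcs K")
      case True
      then have "snd m k \<in> snd m ` arcs K" "x \<noteq> snd m k" using that(1) ker_sub by auto
      then have "snd h x \<noteq> snd h (snd m k)"
        using that(1) hD by (meson UnCI inj_onD)
      then show ?thesis using hne True by simp
    next
      case False
      then show ?thesis
        using that gl unfolding remainder_arcs by (auto simp: disjoint_iff)
    qed
    then show "snd h ` ctx_arcs \<inter> snd n ` arcs R = {}" by blast
  qed
  define fn where "fn = case_sum (fst n) (fst h)"
  define fe where "fe = case_sum (snd n) (snd h)"
  \<comment> \<open>This holds for every \<open>v\<close> and so yields the end points of context
    edges in \<open>H\<close>.\<close>
  have fn_\<kappa>: "fn (\<kappa> v) = fst h v" for v
    using ker_sub(1) by (auto simp: fn_def survivor_def hn f_inv_into_f m_inj_ker)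
  have "inj_on fn (verts (gr PO))"
    unfolding fn_def pushout_simps using hD nD disj(1)
    by (intro inj_on_case_sum) (auto intro: inj_on_subset)
  moreover have "inj_on fe (arcs (gr PO))"
    unfolding fe_def pushout_simps using hD nD disj(2)
    by (intro inj_on_case_sum) (auto intro: inj_on_subset)
  moreover have "fn ` verts (gr PO) = verts (gr H)" "fe ` arcs (gr PO) = arcs (gr H)"
    unfolding H by (auto simp: fn_def fe_def Plus_def image_Un image_image)
  moreover have "ntype H (fn v) = ntype PO v" if "v \<in> verts (gr PO)" for v
    using that nD hD by (auto simp: fn_def)
  moreover have "etype H (fe e) = etype PO e \<and> tail (gr H) (fe e) = fn (tail (gr PO) e) \<and>
      head (gr H) (fe e) = fn (head (gr PO) e)" if "e \<in> arcs (gr PO)" for e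
  proof (cases e)
    case (Inl d)
    then show ?thesis using that nD by (auto simp: fn_def fe_def)
  next
    case (Inr d)
    then show ?thesis using that hD by (auto simp: fn_\<kappa>) (auto simp: fe_def)
  qed
  ultimately show ?thesis
    unfolding typed_iso_def typed_embedding_def by (intro exI[of _ fn] exI[of _ fe]) auto
qed

text \<open>Up to the isomorphism, \<open>h\<close> sends an item of \<open>D\<close> to its
  survivor and \<open>n\<close> is the inclusion of \<open>R\<close>. The survivors fill the kernel
  part of \<open>R\<close> and the whole context, which leaves exactly the copy of
  \<open>R - K\<close>.\<close>

lemma pushout_iso_imp_derivation:
  assumes "applicable r m G" "typed_iso fn fe PO H"
  shows "\<exists>trk. derivation r m G H trk"
proof -
  note f = assms(2)[unfolded typed_iso_def typed_embedding_def]
  let ?D = "remainder r m G"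
  define h where "h = (fn \<circ> \<kappa>, fe \<circ> \<kappa>\<^sub>e)"
  define n where "n = (fn \<circ> Inl, fe \<circ> Inl)"
  have \<kappa>in: "\<kappa> v \<in> verts (gr PO)" if "v \<in> verts (gr ?D)" for v
    using survivor_in_pushout that unfolding remainder_verts by blast
  have \<kappa>ein: "\<kappa>\<^sub>e e \<in> arcs (gr PO)" if "e \<in> arcs (gr ?D)" for e
    using ker_sub(4) that unfolding remainder_arcs by (auto simp: \<kappa>_ker \<kappa>_ctx)
  have \<kappa>inj: "inj_on \<kappa> (verts (gr ?D))" "inj_on \<kappa>\<^sub>e (arcs (gr ?D))"
    unfolding remainder_verts remainder_arcs inj_on_def by (auto simp: \<kappa>_ker \<kappa>_ctx)
  have \<kappa>im: "\<kappa> ` verts (gr ?D) = verts K <+> ctx_verts" "\<kappa>\<^sub>e ` arcs (gr ?D) = arcs K <+> ctx_arcs"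
  proof -
    have "\<kappa> ` ctx_verts = Inr ` ctx_verts" "\<kappa>\<^sub>e ` ctx_arcs = Inr ` ctx_arcs"
      by (intro image_cong refl \<kappa>_ctx; assumption)+
    moreover have "\<kappa> ` fst m ` verts K = Inl ` verts K" "\<kappa>\<^sub>e ` snd m ` arcs K = Inl ` arcs K"
      by (simp_all add: image_image \<kappa>_ker)
    ultimately show "\<kappa> ` verts (gr ?D) = verts K <+> ctx_verts" "\<kappa>\<^sub>e ` arcs (gr ?D) = arcs K <+> ctx_arcs"
      unfolding remainder_verts remainder_arcs by (simp_all add: image_Un Plus_def Un_commute)
  qed
  have "typed_embedding (fst h) (snd h) ?D H"
    unfolding typed_embedding_def
  proof (intro conjI ballI)
    show "inj_on (fst h) (verts (gr ?D))"
      using \<kappa>inj(1) \<kappa>in f unfolding h_def fst_conv by (auto intro!: comp_inj_on intro: inj_on_subset)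
    show "inj_on (snd h) (arcs (gr ?D))"
      using \<kappa>inj(2) \<kappa>ein f unfolding h_def snd_conv by (auto intro!: comp_inj_on intro: inj_on_subset)
    show "fst h ` verts (gr ?D) \<subseteq> verts (gr H)" "snd h ` arcs (gr ?D) \<subseteq> arcs (gr H)"
      using \<kappa>in \<kappa>ein f unfolding h_def by auto
    show "ntype H (fst h v) = ntype ?D v" if "v \<in> verts (gr ?D)" for v
      using \<kappa>in[OF that] that f ntype_survivor[of v] unfolding h_def remainder_verts remainder_simps
      by simp
    fix e assume e: "e \<in> arcs (gr ?D)"
    have "etype PO (\<kappa>\<^sub>e e) = etype G e \<and> tail (gr PO) (\<kappa>\<^sub>e e) = \<kappa> (tail (gr G) e) \<and>
      head (gr PO) (\<kappa>\<^sub>e e) = \<kappa> (head (gr G) e)"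
      using e ker_sub(3) typed_graphD(3,4)[OF K] unfolding remainder_arcs
      by (auto simp: \<kappa>_ker \<kappa>_ctx ker_eq m_eq subset_iff)
    then show "etype H (snd h e) = etype ?D e" "tail (gr H) (snd h e) = fst h (tail (gr ?D) e)"
      "head (gr H) (snd h e) = fst h (head (gr ?D) e)"
      using \<kappa>ein[OF e] f unfolding h_def remainder_simps by simp_all
  qed
  moreover have "typed_embedding (fst n) (snd n) (rhs r) H"
  proof -
    have "typed_embedding Inl Inl (rhs r) PO"
      by (auto simp: typed_embedding_def)
    moreover have "typed_embedding fn fe PO H"
      using assms(2) by (simp add: typed_iso_def)
    ultimately show ?thesis
      unfolding n_def fst_conv snd_conv by (rule typed_embedding_comp)
  qed
  moreover have "verts (gr H) = fn ` (verts K <+> ctx_verts) \<union> fn ` Inl ` (verts R - verts K)"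
    "arcs (gr H) = fe ` (arcs K <+> ctx_arcs) \<union> fe ` Inl ` (arcs R - arcs K)"
  proof -
    have "verts (gr PO) = (verts K <+> ctx_verts) \<union> Inl ` (verts R - verts K)"
      "arcs (gr PO) = (arcs K <+> ctx_arcs) \<union> Inl ` (arcs R - arcs K)"
      using ker_sub by auto
    then show "verts (gr H) = fn ` (verts K <+> ctx_verts) \<union> fn ` Inl ` (verts R - verts K)"
      "arcs (gr H) = fe ` (arcs K <+> ctx_arcs) \<union> fe ` Inl ` (arcs R - arcs K)"
      using f by (metis image_Un)+
  qed
  moreover have "fn ` (verts K <+> ctx_verts) \<inter> fn ` Inl ` (verts R - verts K) = {}"
    "fe ` (arcs K <+> ctx_arcs) \<inter> fe ` Inl ` (arcs R - arcs K) = {}"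
  proof -
    have i: "inj_on fn (verts (gr PO))" and j: "inj_on fe (arcs (gr PO))" using f by simp_all
    show "fn ` (verts K <+> ctx_verts) \<inter> fn ` Inl ` (verts R - verts K) = {}"
      by (subst inj_on_image_Int[OF i, symmetric]) (use ker_sub in auto)
    show "fe ` (arcs K <+> ctx_arcs) \<inter> fe ` Inl ` (arcs R - arcs K) = {}"
      by (subst inj_on_image_Int[OF j, symmetric]) (use ker_sub in auto)
  qed
  moreover have im: "fst h ` verts (gr ?D) = fn ` (verts K <+> ctx_verts)"
    "snd h ` arcs (gr ?D) = fe ` (arcs K <+> ctx_arcs)"
    "fst n ` X = fn ` Inl ` X" "snd n ` Y = fe ` Inl ` Y" for X Y
    unfolding h_def n_def fst_conv snd_conv \<kappa>im[symmetric] image_comp by simp_all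
  ultimately have "glued r m ?D H h n"
    unfolding glued_def im by (auto simp: inj_typed_morphism_iff[symmetric] h_def n_def \<kappa>_ker)
  then show ?thesis
    using match assms(1) unfolding derivation_def by blast
qed

section \<open>Tracks and degrees\<close>

lemma derivation_track:
  assumes "derivation r m G H trk"
  shows "{v \<in> verts (gr G). fst trk v \<noteq> None} = verts (gr G) - fst m ` (verts L - verts K)"
  using assms by (auto simp: derivation_def remainder_def)

text \<open>The share of the degree of \<open>w\<close> that stems from edges outside the match. The
  rule does not touch these edges, so degrees in \<open>G\<close> and in the result are compared
  through it.\<close>

definition ctx_deg :: "'n \<Rightarrow> nat" where
  "ctx_deg w = card {e \<in> ctx_arcs. tail (gr G) e = w} + card {e \<in> ctx_arcs. head (gr G) e = w}"

lemma card_Collect_Un: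
  assumes "finite A" "finite B" "A \<inter> B = {}"
  shows "card {e \<in> A \<union> B. P e} = card {e \<in> A. P e} + card {e \<in> B. P e}"
proof -
  have "{e \<in> A \<union> B. P e} = {e \<in> A. P e} \<union> {e \<in> B. P e}" by auto
  then show ?thesis using assms by (simp add: card_Un_disjoint disjoint_iff)
qed

lemma finite_arcs: "finite (arcs L)" "finite (arcs R)" "finite ctx_arcs"
  using typed_graphD(2)[OF L] typed_graphD(2)[OF R] typed_graphD(2)[OF G] by auto

lemma deg_split:
  "deg (gr G) w = ctx_deg w + card {e \<in> snd m ` arcs L. tail (gr G) e = w} +
     card {e \<in> snd m ` arcs L. head (gr G) e = w}"
proof -
  have u: "ctx_arcs \<union> snd m ` arcs L = arcs (gr G)" using m_in(2) by auto
  have "card {e \<in> ctx_arcs \<union> snd m ` arcs L. P e} =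
      card {e \<in> ctx_arcs. P e} + card {e \<in> snd m ` arcs L. P e}" for P
    using finite_arcs by (intro card_Collect_Un) auto
  note split = this[unfolded u]
  show ?thesis
    unfolding deg_eq ctx_deg_def split by simp
qed

lemma deg_matched: "v \<in> verts L \<Longrightarrow> deg (gr G) (fst m v) = ctx_deg (fst m v) + deg L v"
  unfolding deg_split deg_eq[of L]
  using card_ends_image[OF m_inj, of v "tail L" "tail (gr G)"]
    card_ends_image[OF m_inj, of v "head L" "head (gr G)"] m_eq(3,4) typed_graphD(3,4)[OF L]
  by simp

lemma deg_ctx:
  assumes "v \<in> ctx_verts"
  shows "deg (gr G) v = ctx_deg v"
proof -
  have t: "{e \<in> snd m ` arcs L. tail (gr G) e = v} = {}" and h: "{e \<in> snd m ` arcs L. head (gr G) e = v} = {}"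
    using assms m_eq(3,4) typed_graphD(3,4)[OF L] by auto
  show ?thesis unfolding deg_split t h by simp
qed

lemma applicable_iff_ctx_deg: "applicable r m G \<longleftrightarrow> (\<forall>v\<in>verts L - verts K. ctx_deg (fst m v) = 0)"
proof -
  have fin: "finite {e \<in> ctx_arcs. P e}" for P
    by (rule finite_subset[OF _ finite_arcs(3)]) blast
  have "ctx_deg w = 0 \<longleftrightarrow> (\<forall>e\<in>ctx_arcs. tail (gr G) e \<noteq> w \<and> head (gr G) e \<noteq> w)" for w
    unfolding ctx_deg_def add_is_0 card_0_eq[OF fin] by auto
  then show ?thesis
    unfolding applicable_def by auto
qed

text \<open>The matched edges at \<open>fst m v\<close> contribute exactly \<open>deg L v\<close>,
  so equality says that no edge outside the match ends there.\<close>

lemma applicable_iff_deg: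
  "applicable r m G \<longleftrightarrow> (\<forall>v\<in>verts L - verts K. deg (gr G) (fst m v) = deg L v)"
  unfolding applicable_iff_ctx_deg by (auto simp: deg_matched)

lemma card_Collect_Plus:
  assumes "finite A" "finite B"
  shows "card {e \<in> A <+> B. P e} = card {e \<in> A. P (Inl e)} + card {e \<in> B. P (Inr e)}"
proof -
  have "{e \<in> A <+> B. P e} = {e \<in> A. P (Inl e)} <+> {e \<in> B. P (Inr e)}" by auto
  then show ?thesis using assms by (simp add: card_Plus)
qed

text \<open>The node \<open>w\<close> is arbitrary, deleted ones included, so that the equivalences
  can be used when counting over all context edges.\<close>

lemma survivor_eq_iff:
  "k \<in> verts K \<Longrightarrow> \<kappa> w = Inl k \<longleftrightarrow> w = fst m k"
  "v \<notin> verts K \<Longrightarrow> \<kappa> w \<noteq> Inl v"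
  "v \<in> ctx_verts \<Longrightarrow> \<kappa> w = Inr v \<longleftrightarrow> w = v"
  using ker_sub(1) m_inj_ker(1) by (auto simp: survivor_def inv_into_into f_inv_into_f)

text \<open>A kernel node exchanges its matched edges for those of \<open>R\<close>. Together with
  \<open>deg_matched\<close> this explains the degree update in the rule body.\<close>

lemma deg_pushout:
  "v \<in> verts K \<Longrightarrow> deg (gr PO) (Inl v) = ctx_deg (fst m v) + deg R v"
  "v \<in> verts R - verts K \<Longrightarrow> deg (gr PO) (Inl v) = deg R v"
  "v \<in> ctx_verts \<Longrightarrow> deg (gr PO) (Inr v) = deg (gr G) v"
  using finite_arcs
  by (simp_all add: deg_eq[of "gr PO"] deg_eq[of R] deg_ctx ctx_deg_def card_Collect_Plus survivor_eq_iff)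

section \<open>Items of the pushout and their values\<close>

lemma map_sum_Plus: "map_sum f g ` (A <+> B) = f ` A <+> g ` B"
  by (simp add: Plus_def image_Un image_image)

abbreviation "m_item \<equiv> map_sum (fst m) (snd m)"
abbreviation "ctx_items \<equiv> items (gr G) - m_item ` items L"

lemma ctx_items_eq: "ctx_items = ctx_verts <+> ctx_arcs"
  unfolding items_map_sum by (auto simp: items_def)

lemma m_item_inj: "inj_on m_item (items L)" and m_item_in: "m_item ` items L \<subseteq> items (gr G)"
proof -
  show "inj_on m_item (items L)"
  proof (rule inj_onI)
    fix x y
    assume "x \<in> items L" "y \<in> items L" "m_item x = m_item y"
    then show "x = y" by (cases x; cases y) (simp_all add: m_eq_iff)
  qed
  show "m_item ` items L \<subseteq> items (gr G)"
    using m_in unfolding items_map_sum items_def[of "gr G"] by blast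
qed

lemma item_val_matched:
  "x \<in> items L \<Longrightarrow>
     item_val TG G \<iota> \<delta> (m_item x) = item_val TG (lhs r) (\<iota> \<circ> m_item) (\<delta> \<circ> fst m) x"
  by (cases x) (simp_all add: m_eq)

text \<open>A family on the items of the result, glued from a family on \<open>R\<close> and one on
  the context. It is not a plain \<open>case_sum\<close> because nodes and edges are separated first
  and the two origins second.\<close>

definition po_case :: "('n + 'e \<Rightarrow> 'b) \<Rightarrow> ('n + 'e \<Rightarrow> 'b) \<Rightarrow> ('n + 'n) + ('e + 'e) \<Rightarrow> 'b" where
  "po_case f g = case_sum (case_sum (f \<circ> Inl) (g \<circ> Inl)) (case_sum (f \<circ> Inr) (g \<circ> Inr))"

abbreviation rhs_item :: "'n + 'e \<Rightarrow> ('n + 'n) + ('e + 'e)" where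
  "rhs_item \<equiv> map_sum Inl Inl"

abbreviation ctx_item :: "'n + 'e \<Rightarrow> ('n + 'n) + ('e + 'e)" where
  "ctx_item \<equiv> map_sum Inr Inr"

lemma po_case_simps [simp]:
  "po_case f g (Inl (Inl v)) = f (Inl v)" "po_case f g (Inl (Inr v)) = g (Inl v)"
  "po_case f g (Inr (Inl e)) = f (Inr e)" "po_case f g (Inr (Inr e)) = g (Inr e)"
  "po_case f g (rhs_item x) = f x" "po_case f g (ctx_item x) = g x"
  by (auto simp: po_case_def split: sum.splits) (cases x; simp)+

lemma po_items_cases:
  assumes "y \<in> items (gr PO)"
  obtains (rhs) x where "x \<in> items R" "y = rhs_item x"
  | (ctx) x where "x \<in> ctx_items" "y = ctx_item x"
proof -
  have "y \<in> (Inl ` verts R \<union> Inr ` ctx_verts) <+> (Inl ` arcs R \<union> Inr ` ctx_arcs)"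
    using assms unfolding items_def pushout_simps by (simp add: Plus_def)
  then have "y \<in> rhs_item ` items R \<union> ctx_item ` ctx_items"
    unfolding ctx_items_eq items_def[of R] map_sum_Plus by blast
  then show thesis using that by blast
qed

lemma po_item_in: "x \<in> items R \<Longrightarrow> rhs_item x \<in> items (gr PO)"
    "x \<in> ctx_items \<Longrightarrow> ctx_item x \<in> items (gr PO)"
  unfolding ctx_items_eq by (auto simp: items_def)

lemma image_mset_po_case:
  "image_mset (po_case f g) (mset_set (items (gr PO))) =
     image_mset f (mset_set (items R)) + image_mset g (mset_set ctx_items)"
proof -
  have fin: "finite (verts R)" "finite (arcs R)" "finite ctx_verts" "finite ctx_arcs"
    using typed_graphD(1,2)[OF R] typed_graphD(1,2)[OF G] by auto
  show ?thesis
    unfolding ctx_items_eq items_def[of "gr PO"] items_def[of R] pushout_simps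
    by (simp add: mset_set_Plus fin multiset.map_comp comp_def)
qed

text \<open>A context edge may end in a kernel node, whose identifier in the result comes from
  \<open>\<iota>'\<close>; the condition on the kernel makes it the identifier that the edge already
  carries.\<close>

lemma po_case_item_val:
  assumes "applicable r m G" "y \<in> items (gr PO)"
    and f: "\<And>x. x \<in> items R \<Longrightarrow> f x = item_val TG (rhs r) \<iota>' \<delta>' x"
    and g: "\<And>x. x \<in> ctx_items \<Longrightarrow> g x = item_val TG G \<iota> \<delta> x"
    and ker: "\<And>v. v \<in> verts K \<Longrightarrow> \<iota>' (Inl v) = \<iota> (Inl (fst m v))"
  shows "po_case f g y = item_val TG PO (po_case \<iota>' \<iota>) (case_sum \<delta>' \<delta>) y"
proof -
  have \<kappa>: "po_case \<iota>' \<iota> (Inl (\<kappa> w)) = \<iota> (Inl w)" if "w \<in> ctx_verts \<union> fst m ` verts K" for w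
    using that by (auto simp: \<kappa>_ctx \<kappa>_ker ker)
  from assms(2) show ?thesis
  proof (cases rule: po_items_cases)
    case (rhs x)
    then show ?thesis using f[of x] by (cases x) auto
  next
    case (ctx x)
    show ?thesis
    proof (cases x)
      case (Inr e)
      then have "e \<in> ctx_arcs" using ctx unfolding ctx_items_eq by auto
      then show ?thesis
        using ctx g[of x] \<kappa>[OF ctx_arc_ends(1)[OF assms(1)]] \<kappa>[OF ctx_arc_ends(2)[OF assms(1)]] Inr
        by simp
    qed (use ctx g[of x] in auto)
  qed
qed

end

section \<open>The encoding\<close>

lemma reach_reindex:
  assumes "bij_betw p I J"
  shows "reach CT B V J f \<alpha> M \<longleftrightarrow> reach CT B V I (f \<circ> p) \<alpha> (M \<circ> p)"
proof -
  have "J = p ` I" using assms by (simp add: bij_betw_def)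
  then show ?thesis unfolding reach_def by simp
qed

lemma image_mset_Diff_split:
  assumes "finite A" "B \<subseteq> A"
  shows "image_mset f (mset_set A) = image_mset f (mset_set (A - B)) + image_mset f (mset_set B)"
proof -
  have "mset_set A = mset_set (A - B) + mset_set B"
    using assms mset_set_Union[of "A - B" B] finite_subset by (auto simp: Un_absorb2)
  then show ?thesis by simp
qed

lemma holds_all_image_mset:
  "finite A \<Longrightarrow> holds_all CT \<beta> (image_mset f (mset_set A)) \<longleftrightarrow> (\<forall>x\<in>A. holds CT \<beta> (f x))"
  by (simp add: holds_all_def)

locale chr_encoding =
  fixes CT :: "('f, 'p, 'd) struct" and TG :: "('tn, 'te, 'l) type_graph"
    and var dvar :: "'n + 'e \<Rightarrow> 'v"
  assumes CT: "constraint_theory CT" and type_graph: "is_type_graph TG"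
    and infinite_nodes: "infinite (UNIV :: 'n set)" and infinite_edges: "infinite (UNIV :: 'e set)"
    and inj_var: "inj var" and inj_dvar: "inj dvar" and var_dvar: "range var \<inter> range dvar = {}"
begin

lemma infinite_vars: "infinite (UNIV :: 'v set)"
proof -
  have "inj (var \<circ> Inl)" using inj_var by (simp add: inj_compose)
  then show ?thesis
    using infinite_nodes by (metis finite_imageD finite_subset subset_UNIV)
qed

lemma inj_num: "inj (num_of CT)"
  and plus_num: "plus_of CT (num_of CT i) (num_of CT j) = num_of CT (i + j)"
  and minus_num: "minus_of CT (num_of CT i) (num_of CT j) = num_of CT (i - j)"
  using CT by (auto simp: constraint_theory_def)

text \<open>Room for pairwise distinct identifiers, on which the recovery of graphs from values
  rests.\<close>

lemma infinite_carrier: "infinite (UNIV :: 'd set)"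
  using inj_num infinite_UNIV_int by (metis finite_imageD finite_subset subset_UNIV)

lemma var_eq_iff [simp]: "var x = var y \<longleftrightarrow> x = y" "dvar x = dvar y \<longleftrightarrow> x = y"
    "var x \<noteq> dvar y" "dvar y \<noteq> var x"
  using inj_var inj_dvar var_dvar by (auto dest: injD) (metis disjoint_iff rangeI)+

abbreviation "num_deg G v \<equiv> num_of CT (int (deg (gr G) v))"

abbreviation kp_item :: "('n, 'e, 'tn, 'te) tgraph \<Rightarrow> 'n + 'e \<Rightarrow> ('l, 'f, 'v) uc" where
  "kp_item G \<equiv> chr_item TG var dvar Kp G"

abbreviation gnd_item :: "('n, 'e, 'tn, 'te) tgraph \<Rightarrow> 'n + 'e \<Rightarrow> ('l, 'f, 'v) uc" where
  "gnd_item G \<equiv> chr_item TG var dvar Gnd G"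

lemma eval_chr_item:
  "eval_uc CT \<beta> (kp_item G x) = item_val TG G (\<beta> \<circ> var) (\<lambda>v. \<beta> (dvar (Inl v))) x"
  "eval_uc CT \<beta> (gnd_item G x) = item_val TG G (\<beta> \<circ> var) (num_deg G) x"
  by (cases x; simp)+

text \<open>A valuation prescribed on identifiers and degrees. Variables in neither range fall into
  the second branch and get some unspecified value.\<close>

definition var_case :: "('n + 'e \<Rightarrow> 'b) \<Rightarrow> ('n + 'e \<Rightarrow> 'b) \<Rightarrow> 'v \<Rightarrow> 'b" where
  "var_case f g z = (if z \<in> range var then f (inv var z) else g (inv dvar z))"

lemma var_case_simps [simp]: "var_case f g (var x) = f x" "var_case f g (dvar x) = g x"
  using inj_var inj_dvar by (auto simp: var_case_def)

text \<open>
  The two states related by the graph invariant may match up the nodes of \<open>G\<close> differently;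
  evaluating them where the identifiers are pairwise distinct shows that the two matchings differ
  by an automorphism of \<open>G\<close>, so that a common matching can be chosen.
\<close>

lemma graph_invariant_family:
  assumes G: "typed_graph TG G"
    and equiv: "state_equiv CT \<sigma> (State (chr TG var dvar Kp G) B V)"
    and inv: "graph_invariant CT TG var dvar \<sigma> G"
  obtains a Bc Ba V\<^sub>0 Bx
  where "\<sigma> = State (image_mset a (mset_set (items (gr G)))) (Bc + Ba) V\<^sub>0"
    "\<forall>b\<in>#Bc. const_eq b" "\<forall>b\<in>#Ba. arith_eq b" "\<forall>b\<in>#Bx. const_eq b"
    "reach CT (Bc + Ba) V\<^sub>0 (items (gr G)) a = reach CT B V (items (gr G)) (kp_item G)"
    "\<forall>\<alpha> M. reach CT (Bc + Ba + Bx) {} (items (gr G)) a \<alpha> M \<longleftrightarrow>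
       (\<exists>\<iota>. \<forall>x\<in>items (gr G). M x = item_val TG G \<iota> (num_deg G) x)"
proof -
  let ?I = "items (gr G)"
  have fin: "finite ?I" using G by (rule finite_items)
  obtain A Bc Ba V\<^sub>0 Bx where \<sigma>: "\<sigma> = State A (Bc + Ba) V\<^sub>0"
    and shape: "\<forall>b\<in>#Bc. const_eq b" "\<forall>b\<in>#Ba. arith_eq b" "\<forall>b\<in>#Bx. const_eq b"
    and gnd: "state_equiv CT (State A (Bc + Ba + Bx) {}) (State (chr TG var dvar Gnd G) {#} {})"
    using inv unfolding graph_invariant_def by blast
  have "state_equiv CT (State (image_mset (gnd_item G) (mset_set ?I)) {#} {}) (State A (Bc + Ba + Bx) {})"
    using gnd unfolding chr_def by (rule state_equiv_sym)
  then obtain a where a: "A = image_mset a (mset_set ?I)"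
    "reach CT (Bc + Ba + Bx) {} ?I a = reach CT {#} {} ?I (gnd_item G)"
    "\<exists>\<beta>. holds_all CT \<beta> (Bc + Ba + Bx)"
    by (rule state_equiv_reach) (auto simp: fin)
  \<comment> \<open>With true as the built-in store the identifiers are independent, so every choice
    of \<iota> occurs.\<close>
  have gnd_reach: "reach CT {#} {} ?I (gnd_item G) \<alpha> M \<longleftrightarrow>
      (\<exists>\<iota>. \<forall>x\<in>?I. M x = item_val TG G \<iota> (num_deg G) x)" for \<alpha> M
  proof
    assume "\<exists>\<iota>. \<forall>x\<in>?I. M x = item_val TG G \<iota> (num_deg G) x"
    then obtain \<iota> where \<iota>: "\<forall>x\<in>?I. M x = item_val TG G \<iota> (num_deg G) x" by blast
    have "var_case \<iota> undefined \<circ> var = \<iota>" by auto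
    then show "reach CT {#} {} ?I (gnd_item G) \<alpha> M"
      using \<iota> unfolding reach_def by (intro exI[of _ "var_case \<iota> undefined"]) (simp add: eval_chr_item)
  qed (auto simp: reach_def eval_chr_item; metis)
  have "state_equiv CT (State (image_mset a (mset_set ?I)) (Bc + Ba) V\<^sub>0)
      (State (image_mset (kp_item G) (mset_set ?I)) B V)"
    using equiv unfolding \<sigma> a(1) chr_def .
  moreover have "\<exists>\<beta>. holds_all CT \<beta> (Bc + Ba)" using a(3) by auto
  ultimately obtain g where g: "image_mset (kp_item G) (mset_set ?I) = image_mset g (mset_set ?I)"
    "reach CT B V ?I g = reach CT (Bc + Ba) V\<^sub>0 ?I a"
    using fin by (rule state_equiv_reach)
  \<comment> \<open>The families match up to a permutation \<open>p\<close> of the items, about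
    which nothing is known yet.\<close>
  obtain p where p: "bij_betw p ?I ?I" "\<forall>i\<in>?I. kp_item G (p i) = g i"
    by (rule image_mset_eq_obtain_bij[OF fin fin g(1)])
  define q where "q = inv_into ?I p"
  have q: "bij_betw q ?I ?I" "\<And>i. i \<in> ?I \<Longrightarrow> p (q i) = i" "\<And>i. i \<in> ?I \<Longrightarrow> q (p i) = i"
    using p(1) by (auto simp: q_def bij_betw_inv_into bij_betw_inv_into_right bij_betw_inv_into_left)
  have pq_in: "i \<in> ?I \<Longrightarrow> p i \<in> ?I" "i \<in> ?I \<Longrightarrow> q i \<in> ?I" for i
    using p(1) q(1) by (auto simp: bij_betw_def)
  obtain \<iota>0 :: "'n + 'e \<Rightarrow> 'd" where \<iota>0: "inj_on \<iota>0 ?I"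
    by (rule ex_fresh_inj_on[OF infinite_carrier fin, of "{}"]) auto
  let ?M0 = "item_val TG G \<iota>0 (num_deg G)"
  have "reach CT (Bc + Ba + Bx) {} ?I a \<alpha> ?M0" for \<alpha>
    unfolding a(2) gnd_reach by blast
  then obtain \<beta> where "holds_all CT \<beta> (Bc + Ba)" "\<forall>i\<in>?I. eval_uc CT \<beta> (a i) = ?M0 i"
    unfolding reach_def by auto
  then have "reach CT B V ?I g \<beta> ?M0"
    unfolding g(2) reach_def by auto
  then obtain \<gamma> where \<gamma>: "\<forall>i\<in>?I. eval_uc CT \<gamma> (g i) = ?M0 i"
    unfolding reach_def by auto
  \<comment> \<open>Both arrangements are evaluated at one point with distinct identifiers, so the
    inverse \<open>q\<close> of \<open>p\<close> has to be an automorphism of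
    \<open>G\<close>.\<close>
  have "?M0 (q j) = item_val TG G (\<gamma> \<circ> var) (\<lambda>v. \<gamma> (dvar (Inl v))) j" if "j \<in> ?I" for j
    using \<gamma> p(2) q(2)[OF that] pq_in(2)[OF that] by (metis eval_chr_item(1))
  then obtain qn qe where iso: "typed_iso qn qe G G" and "\<forall>x\<in>?I. q x = map_sum qn qe x"
    and "\<forall>x\<in>?I. (\<gamma> \<circ> var) x = \<iota>0 (q x)" "\<forall>v\<in>verts (gr G). \<gamma> (dvar (Inl v)) = num_deg G (qn v)"
    by (rule item_val_bij_iso[OF type_graph G G q(1) \<iota>0])
  then have q_eq: "q x = map_sum qn qe x" if "x \<in> ?I" for x
    using that by blast
  have deg: "deg (gr G) (qn v) = deg (gr G) v" if "v \<in> verts (gr G)" for v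
    using deg_typed_iso[OF iso G that] .
  \<comment> \<open>An automorphism preserves degrees, so permuting the items by \<open>q\<close>
    only permutes the identifiers, and the set of ground values stays the same.\<close>
  have val: "item_val TG G \<iota> (num_deg G) (q x) = item_val TG G (\<iota> \<circ> q) (num_deg G) x"
    if "x \<in> ?I" for x \<iota>
    unfolding q_eq[OF that] item_val_iso[OF iso G that]
    by (intro item_val_cong[OF G that]) (auto simp: q_eq deg)
  show thesis
  proof (rule that[of "a \<circ> q" Bc Ba V\<^sub>0 Bx])
    show "\<sigma> = State (image_mset (a \<circ> q) (mset_set ?I)) (Bc + Ba) V\<^sub>0"
      unfolding \<sigma> a(1) image_mset_bij_betw[OF q(1), of a] ..
    have pq: "reach CT B' U ?I (f \<circ> q) \<alpha> M \<longleftrightarrow> reach CT B' U ?I f \<alpha> (M \<circ> p)"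
      for B' U \<alpha> M and f :: "'n + 'e \<Rightarrow> ('l, 'f, 'v) uc"
    proof -
      have "reach CT B' U ?I f \<alpha> (M \<circ> p) \<longleftrightarrow> reach CT B' U ?I (f \<circ> q) \<alpha> (M \<circ> p \<circ> q)"
        by (rule reach_reindex[OF q(1)])
      also have "\<dots> \<longleftrightarrow> reach CT B' U ?I (f \<circ> q) \<alpha> M"
        by (rule reach_cong) (auto simp: q(2))
      finally show ?thesis ..
    qed
    show "reach CT (Bc + Ba) V\<^sub>0 ?I (a \<circ> q) = reach CT B V ?I (kp_item G)"
    proof (intro ext)
      fix \<alpha> M
      have "reach CT (Bc + Ba) V\<^sub>0 ?I (a \<circ> q) \<alpha> M \<longleftrightarrow> reach CT B V ?I g \<alpha> (M \<circ> p)"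
        unfolding pq g(2) ..
      also have "\<dots> \<longleftrightarrow> reach CT B V ?I (kp_item G \<circ> p) \<alpha> (M \<circ> p)"
        using p(2) unfolding reach_def by simp
      also have "\<dots> \<longleftrightarrow> reach CT B V ?I (kp_item G) \<alpha> M"
        unfolding reach_reindex[OF p(1), of _ _ _ "kp_item G"] ..
      finally show "reach CT (Bc + Ba) V\<^sub>0 ?I (a \<circ> q) \<alpha> M = reach CT B V ?I (kp_item G) \<alpha> M" .
    qed
    have "reach CT (Bc + Ba + Bx) {} ?I (a \<circ> q) \<alpha> M \<longleftrightarrow>
       (\<exists>\<iota>. \<forall>x\<in>?I. M x = item_val TG G \<iota> (num_deg G) x)" (is "_ \<longleftrightarrow> ?R \<alpha> M") for \<alpha> M
      unfolding pq a(2) gnd_reach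
    proof (intro iffI; elim exE)
      fix \<iota> assume \<iota>: "\<forall>x\<in>?I. (M \<circ> p) x = item_val TG G \<iota> (num_deg G) x"
      have "M x = item_val TG G (\<iota> \<circ> q) (num_deg G) x" if "x \<in> ?I" for x
        using \<iota> pq_in(2)[OF that] q(2)[OF that] val[OF that] by (metis comp_apply)
      then show "?R \<alpha> M" by blast
    next
      fix \<iota> assume \<iota>: "\<forall>x\<in>?I. M x = item_val TG G \<iota> (num_deg G) x"
      have "(M \<circ> p) x = item_val TG G (\<iota> \<circ> p) (num_deg G) x" if "x \<in> ?I" for x
      proof -
        have "item_val TG G (\<iota> \<circ> p) (num_deg G) x = item_val TG G (\<iota> \<circ> p \<circ> q) (num_deg G) (p x)"
          using val[OF pq_in(1)[OF that], of "\<iota> \<circ> p"] q(3)[OF that] by simp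
        also have "\<dots> = item_val TG G \<iota> (num_deg G) (p x)"
          using q(2) by (intro item_val_cong[OF G pq_in(1)[OF that]]) auto
        finally show ?thesis using \<iota> pq_in(1)[OF that] by simp
      qed
      then show "\<exists>\<iota>. \<forall>x\<in>?I. (M \<circ> p) x = item_val TG G \<iota> (num_deg G) x" by blast
    qed
    then show "\<forall>\<alpha> M. reach CT (Bc + Ba + Bx) {} ?I (a \<circ> q) \<alpha> M \<longleftrightarrow>
       (\<exists>\<iota>. \<forall>x\<in>?I. M x = item_val TG G \<iota> (num_deg G) x)" by blast
  qed (use shape in auto)
qed

end

locale chr_rule_encoding = chr_encoding CT TG var dvar + typed_rule TG r
  for CT :: "('f, 'p, 'd) struct" and TG :: "('tn, 'te, 'l) type_graph"
    and var dvar :: "'n + 'e \<Rightarrow> 'v" and r :: "('n, 'e, 'tn, 'te) gt_rule" +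
  fixes cp :: "'n \<Rightarrow> 'n"
  assumes cp: "fresh_copies r cp"
begin

definition head_item :: "'n + 'e \<Rightarrow> ('l, 'f, 'v) uc" where
  "head_item x = (if x \<in> items K then kp_item (lhs r) x else gnd_item (lhs r) x)"

fun user_item :: "'n + 'e \<Rightarrow> ('l, 'f, 'v) uc" where
  "user_item (Inl v) = (if v \<in> verts K
     then UC (label TG (Inl (ntype (rhs r) v))) [Var (var (Inl (cp v))), Var (dvar (Inl (cp v)))]
     else gnd_item (rhs r) (Inl v))"
| "user_item (Inr e) = kp_item (rhs r) (Inr e)"

abbreviation enc :: "('l, 'f, 'p, 'v) chr_rule" where
  "enc \<equiv> rule_encoding TG var dvar cp r"

text \<open>The operations of the structure are left in place: \<delta> may take values that are no
  numerals, where nothing is known about them.\<close>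

definition rhs_deg :: "('n \<Rightarrow> 'd) \<Rightarrow> 'n \<Rightarrow> 'd" where
  "rhs_deg \<delta> v = (if v \<in> verts K
     then plus_of CT (minus_of CT (\<delta> v) (num_deg (lhs r) v)) (num_deg (rhs r) v)
     else num_deg (rhs r) v)"

lemma cp_simps:
  "v \<in> verts K \<Longrightarrow> cp v \<notin> verts L" "v \<in> verts K \<Longrightarrow> cp v \<notin> verts R" "v \<in> verts K \<Longrightarrow> cp v \<notin> verts K"
  "v \<in> verts K \<Longrightarrow> inv_into (verts K) cp (cp v) = v"
  using cp ker_sub by (auto simp: fresh_copies_def)

lemma items_ker_sub: "items K \<subseteq> items L" "items K \<subseteq> items R"
  using ker_sub by (auto simp: items_def)

lemma rl_head_enc: "rl_head enc = image_mset head_item (mset_set (items L))"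
proof -
  have "image_mset head_item (mset_set (items L - items K)) =
      image_mset (gnd_item (lhs r)) (mset_set (items L - items K))"
    "image_mset head_item (mset_set (items K)) = image_mset (kp_item (lhs r)) (mset_set (items K))"
    using finite_items[OF L] finite_items[OF K] by (auto intro!: image_mset_cong simp: head_item_def)
  then show ?thesis
    using image_mset_Diff_split[OF finite_items[OF L] items_ker_sub(1), of head_item]
    by (simp add: rule_encoding_def add.commute)
qed

lemma rl_user_enc: "rl_user enc = image_mset user_item (mset_set (items R))"
proof -
  have fin: "finite (verts R)" "finite (arcs R)" "finite (verts K)" "finite (arcs K)"
    using typed_graphD(1,2)[OF R] typed_graphD(1,2)[OF K] by auto
  have "image_mset user_item (mset_set (items R - items K)) =
      image_mset (gnd_item (rhs r)) (mset_set (items R - items K))"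
  proof (rule image_mset_cong)
    fix x assume "x \<in># mset_set (items R - items K)"
    then show "user_item x = gnd_item (rhs r) x"
      using finite_items[OF R] by (cases x) auto
  qed
  moreover have "image_mset user_item (mset_set (items K)) =
      image_mset (\<lambda>e. kp_item (rhs r) (Inr e)) (mset_set (arcs K)) +
      image_mset (\<lambda>v. UC (label TG (Inl (ntype (rhs r) v)))
             [Var (var (Inl (cp v))), Var (dvar (Inl (cp v)))]) (mset_set (verts K))"
    unfolding items_def mset_set_Plus[OF fin(3,4)] image_mset_union multiset.map_comp
    using fin by (subst add.commute, intro arg_cong2[where f = "(+)"] image_mset_cong) simp_all
  ultimately show ?thesis
    using image_mset_Diff_split[OF finite_items[OF R] items_ker_sub(2), of user_item]
    by (simp add: rule_encoding_def ac_simps)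
qed

lemma eval_head_item:
  "eval_uc CT \<xi> (head_item x) = item_val TG (lhs r) (\<xi> \<circ> var)
     (\<lambda>v. if v \<in> verts K then \<xi> (dvar (Inl v)) else num_deg (lhs r) v) x"
  unfolding head_item_def by (cases x) (auto simp: eval_chr_item)

lemma holds_rl_builtin:
  "holds_all CT \<xi> (rl_builtin enc) \<longleftrightarrow> (\<forall>v\<in>verts K. \<xi> (var (Inl (cp v))) = \<xi> (var (Inl v)) \<and>
     \<xi> (dvar (Inl (cp v))) = rhs_deg (\<lambda>v. \<xi> (dvar (Inl v))) v)"
  using typed_graphD(1)[OF K]
  by (simp add: rule_encoding_def holds_all_image_mset rhs_deg_def) metis

text \<open>The body equates the copy of a kernel node with the original. At its solutions the
  copies can thus be forgotten, and the body reads like \<open>R\<close> with updated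
  degrees.\<close>

lemma eval_user_item:
  assumes "holds_all CT \<xi> (rl_builtin enc)"
  shows "eval_uc CT \<xi> (user_item x) =
    item_val TG (rhs r) (\<xi> \<circ> var) (rhs_deg (\<lambda>v. \<xi> (dvar (Inl v)))) x"
  using assms unfolding holds_rl_builtin by (cases x) (auto simp: eval_chr_item rhs_deg_def)

lemma vars_head: "vars_ucs (rl_head enc) = var ` items L \<union> dvar ` Inl ` verts K"
proof -
  have "vars_uc (head_item x) \<subseteq> var ` items L \<union> dvar ` Inl ` verts K" if "x \<in> items L" for x
    using that typed_graphD(3,4)[OF L] by (cases x) (auto simp: head_item_def)
  then have "(\<Union>x\<in>items L. vars_uc (head_item x)) \<subseteq> var ` items L \<union> dvar ` Inl ` verts K"
    by blast
  moreover have "var ` items L \<subseteq> (\<Union>x\<in>items L. vars_uc (head_item x))"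
  proof (rule image_subsetI)
    fix x assume "x \<in> items L"
    moreover have "var x \<in> vars_uc (head_item x)"
      by (cases x) (auto simp: head_item_def)
    ultimately show "var x \<in> (\<Union>x\<in>items L. vars_uc (head_item x))" by blast
  qed
  moreover have "dvar ` Inl ` verts K \<subseteq> (\<Union>x\<in>items L. vars_uc (head_item x))"
    unfolding image_image
  proof (rule image_subsetI)
    fix v assume "v \<in> verts K"
    then have "Inl v \<in> items L" "dvar (Inl v) \<in> vars_uc (head_item (Inl v))"
      using ker_sub(1) by (auto simp: head_item_def)
    then show "dvar (Inl v) \<in> (\<Union>x\<in>items L. vars_uc (head_item x))" by blast
  qed
  moreover have "vars_ucs (rl_head enc) = (\<Union>x\<in>items L. vars_uc (head_item x))"
    unfolding rl_head_enc vars_ucs_def using finite_items[OF L] by simp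
  ultimately show ?thesis by (metis Un_least subset_antisym)
qed

lemma vars_enc:
  "vars_rule enc \<subseteq> var ` (items L \<union> items R \<union> Inl ` cp ` verts K) \<union>
     dvar ` Inl ` (verts K \<union> cp ` verts K)"
proof -
  have "vars_uc (user_item x) \<subseteq> var ` (items R \<union> Inl ` cp ` verts K) \<union> dvar ` Inl ` cp ` verts K"
    if "x \<in> items R" for x
    using that typed_graphD(3,4)[OF R] by (cases x) auto
  then have u: "vars_ucs (rl_user enc) \<subseteq> var ` (items R \<union> Inl ` cp ` verts K) \<union> dvar ` Inl ` cp ` verts K"
    unfolding rl_user_enc vars_ucs_def using finite_items[OF R] by auto
  have b: "vars_bics (rl_builtin enc) \<subseteq> var ` (items L \<union> Inl ` cp ` verts K) \<union>
     dvar ` Inl ` (verts K \<union> cp ` verts K)"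
    using typed_graphD(1)[OF K] ker_sub(1) unfolding rule_encoding_def vars_bics_def by auto
  let ?X = "var ` (items L \<union> items R \<union> Inl ` cp ` verts K) \<union> dvar ` Inl ` (verts K \<union> cp ` verts K)"
  have "vars_ucs (rl_user enc) \<subseteq> ?X"
    by (rule order_trans[OF u]) (unfold image_Un, blast)
  moreover have "vars_bics (rl_builtin enc) \<subseteq> ?X"
    by (rule order_trans[OF b]) (unfold image_Un, blast)
  moreover have "var ` items L \<union> dvar ` Inl ` verts K \<subseteq> ?X"
    unfolding image_Un by blast
  ultimately show ?thesis
    unfolding vars_rule_def vars_head by (intro Un_least) simp_all
qed

lemma finite_vars_rule [simp]: "finite (vars_rule enc)"
  by (simp add: vars_rule_def)

text \<open>
  Extends values \<open>f\<close> and \<open>g\<close> of the head variables by values \<open>g'\<close> for the degrees of the copies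
  of kernel nodes and \<open>h\<close> for the identifiers of new items.
\<close>

definition rule_val ::
  "('n + 'e \<Rightarrow> 'b) \<Rightarrow> ('n \<Rightarrow> 'b) \<Rightarrow> ('n \<Rightarrow> 'b) \<Rightarrow> ('n + 'e \<Rightarrow> 'b) \<Rightarrow> 'v \<Rightarrow> 'b" where
  "rule_val f g g' h = var_case
     (\<lambda>x. if x \<in> items L then f x
          else if x \<in> Inl ` cp ` verts K then f (Inl (inv_into (verts K) cp (projl x))) else h x)
     (\<lambda>x. if projl x \<in> verts K then g (projl x) else g' (inv_into (verts K) cp (projl x)))"

lemma rule_val_simps [simp]:
  "x \<in> items L \<Longrightarrow> rule_val f g g' h (var x) = f x"
  "x \<in> items R \<Longrightarrow> x \<notin> items L \<Longrightarrow> rule_val f g g' h (var x) = h x"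
  "v \<in> verts K \<Longrightarrow> rule_val f g g' h (var (Inl (cp v))) = f (Inl v)"
  "v \<in> verts K \<Longrightarrow> rule_val f g g' h (dvar (Inl v)) = g v"
  "v \<in> verts K \<Longrightarrow> rule_val f g g' h (dvar (Inl (cp v))) = g' v"
  using cp_simps by (auto simp: rule_val_def)

lemma rule_val_builtin:
  "holds_all CT (rule_val f g (rhs_deg g) h) (rl_builtin enc)"
proof -
  have "rhs_deg (\<lambda>v. rule_val f g (rhs_deg g) h (dvar (Inl v))) v = rhs_deg g v" if "v \<in> verts K" for v
    using that by (simp add: rhs_deg_def)
  then show ?thesis
    unfolding holds_rl_builtin using ker_sub(1) by auto
qed

end

section \<open>From transitions to derivations\<close>

lemma eval_rename_uc: "eval_uc CT \<beta> (subst_uc (Var \<circ> \<rho>) c) = eval_uc CT (\<beta> \<circ> \<rho>) c"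
  by (simp add: eval_subst_uc comp_def)

lemma holds_all_rename:
  "holds_all CT \<beta> (image_mset (subst_bic (Var \<circ> \<rho>)) B) \<longleftrightarrow> holds_all CT (\<beta> \<circ> \<rho>) B"
  by (simp add: holds_all_subst_bic comp_def)

lemma vars_rename_ucs: "vars_ucs (image_mset (subst_uc (Var \<circ> \<rho>)) A) = \<rho> ` vars_ucs A"
  by (auto simp: vars_ucs_image_subst)

lemma vars_rename_bics: "vars_bics (image_mset (subst_bic (Var \<circ> \<rho>)) B) = \<rho> ` vars_bics B"
  by (auto simp: vars_bics_image_subst)

lemma vars_rename_rule: "vars_rule (rename_rule \<rho> Q) = \<rho> ` vars_rule Q"
  by (simp add: vars_rule_def rename_rule_def vars_rename_ucs vars_rename_bics image_Un)

lemma (in gt_match) po_case_comp: "F (po_case f g y) = po_case (F \<circ> f) (F \<circ> g) y"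
  by (auto simp: po_case_def split: sum.splits)

context chr_rule_encoding
begin

lemma vars_user_item: "x \<in> items R \<Longrightarrow> vars_uc (user_item x) \<subseteq> vars_rule enc"
  using vars_uc_subset_vars_ucs[OF finite_items[OF R], of x user_item]
  unfolding rl_user_enc[symmetric] vars_rule_def by blast

text \<open>Values are read twice, before the transition to find the match and after it to identify
  the result. Both readings need distinct identifiers: the second solution is the first, changed
  only on variables of the rule copy outside its head.\<close>

lemma transition_imp_derivation:
  assumes G: "typed_graph TG G" and H: "typed_graph TG H" and H': "typed_graph TG H'"
    and iso: "typed_isomorphic H H'"
    and equiv: "state_equiv CT \<sigma> (State (chr TG var dvar Kp G) B V)"
    and inv: "graph_invariant CT TG var dvar \<sigma> G"
    and trans: "chr_transition CT enc \<sigma> \<tau>"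
    and equiv': "state_equiv CT \<tau> (State (chr TG var dvar Kp H') B' V)"
  shows "\<exists>m trk. derivation r m G H trk \<and>
    strong_nodes CT dvar G B \<subseteq> {v \<in> verts (gr G). fst trk v \<noteq> None}"
proof -
  let ?I = "items (gr G)"
  have fin: "finite ?I" using G by (rule finite_items)
  obtain a Bc Ba V\<^sub>0 Bx
  where \<sigma>: "\<sigma> = State (image_mset a (mset_set ?I)) (Bc + Ba) V\<^sub>0"
    and "\<forall>b\<in>#Bc. const_eq b" "\<forall>b\<in>#Ba. arith_eq b" "\<forall>b\<in>#Bx. const_eq b"
    and kp: "reach CT (Bc + Ba) V\<^sub>0 ?I a = reach CT B V ?I (kp_item G)"
    and gnd: "\<forall>\<alpha> M. reach CT (Bc + Ba + Bx) {} ?I a \<alpha> M \<longleftrightarrow>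
       (\<exists>\<iota>. \<forall>x\<in>?I. M x = item_val TG G \<iota> (num_deg G) x)"
    by (rule graph_invariant_family[OF G equiv inv])
  obtain \<rho> R' A B\<^sub>1 V\<^sub>1 where \<rho>: "inj_on \<rho> (vars_rule enc)" and R': "R' = rename_rule \<rho> enc"
    and fresh: "vars_rule R' \<inter> (V\<^sub>1 \<union> vars_ucs A) = {}"
      "(vars_rule R' - vars_ucs (rl_head R')) \<inter> vars_bics B\<^sub>1 = {}"
    and pre: "state_equiv CT \<sigma> (State (rl_head R' + A) B\<^sub>1 V\<^sub>1)"
    and post: "state_equiv CT (State (rl_user R' + A) (rl_builtin R' + B\<^sub>1) V\<^sub>1) \<tau>"
    using trans unfolding chr_transition_def by blast
  define hr where "hr = (\<lambda>x. subst_uc (Var \<circ> \<rho>) (head_item x))"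
  define ur where "ur = (\<lambda>x. subst_uc (Var \<circ> \<rho>) (user_item x))"
  have R'_eq: "rl_head R' = image_mset hr (mset_set (items L))"
    "rl_user R' = image_mset ur (mset_set (items R))"
    "rl_builtin R' = image_mset (subst_bic (Var \<circ> \<rho>)) (rl_builtin enc)"
    by (simp_all add: R' rename_rule_def rl_head_enc rl_user_enc hr_def ur_def multiset.map_comp comp_def)
  have vars_R': "vars_rule R' = \<rho> ` vars_rule enc" "vars_ucs (rl_head R') = \<rho> ` vars_ucs (rl_head enc)"
    unfolding R' vars_rename_rule by (simp_all add: rename_rule_def vars_rename_ucs)
  obtain \<iota>0 :: "'n + 'e \<Rightarrow> 'd" where \<iota>0: "inj_on \<iota>0 ?I"
    by (rule ex_fresh_inj_on[OF infinite_carrier fin, of "{}"]) auto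
  let ?M0 = "item_val TG G \<iota>0 (num_deg G)"
  have "reach CT (Bc + Ba + Bx) {} ?I a \<alpha> ?M0" for \<alpha>
    using gnd by blast
  then obtain \<beta> where \<beta>: "holds_all CT \<beta> (Bc + Ba)" "\<forall>i\<in>?I. eval_uc CT \<beta> (a i) = ?M0 i"
    unfolding reach_def by auto
  obtain g where g: "rl_head R' + A = image_mset g (mset_set ?I)"
    "reach CT B\<^sub>1 V\<^sub>1 ?I g = reach CT (Bc + Ba) V\<^sub>0 ?I a"
    using state_equiv_reach[OF pre[unfolded \<sigma>] _ fin] \<beta>(1) by metis
  obtain p where p: "inj_on p (items L)" "p ` items L \<subseteq> ?I" "\<forall>x\<in>items L. g (p x) = hr x"
    "A = image_mset g (mset_set (?I - p ` items L))"
    using image_mset_union_obtain_inj[OF fin finite_items[OF L]] g(1) unfolding R'_eq by metis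
  have "reach CT B\<^sub>1 V\<^sub>1 ?I g \<beta> ?M0"
    unfolding g(2) reach_def using \<beta> by blast
  then obtain \<beta>\<^sub>1 where \<beta>\<^sub>1: "holds_all CT \<beta>\<^sub>1 B\<^sub>1" "\<forall>i\<in>?I. eval_uc CT \<beta>\<^sub>1 (g i) = ?M0 i"
    unfolding reach_def by auto
  have head_val: "eval_uc CT \<gamma> (g (p x)) = item_val TG (lhs r) (\<gamma> \<circ> \<rho> \<circ> var)
     (\<lambda>v. if v \<in> verts K then \<gamma> (\<rho> (dvar (Inl v))) else num_deg (lhs r) v) x"
    if "x \<in> items L" for \<gamma> x
  proof -
    have "eval_uc CT \<gamma> (g (p x)) = eval_uc CT (\<gamma> \<circ> \<rho>) (head_item x)"
      using that p(3) by (simp add: hr_def eval_rename_uc)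
    then show ?thesis
      unfolding eval_head_item comp_def .
  qed
  define \<xi> where "\<xi> = \<beta>\<^sub>1 \<circ> \<rho>"
  have val: "?M0 (p x) = item_val TG (lhs r) (\<xi> \<circ> var)
     (\<lambda>v. if v \<in> verts K then \<xi> (dvar (Inl v)) else num_deg (lhs r) v) x"
    if "x \<in> items L" for x
  proof -
    have "p x \<in> ?I" using that p(2) by blast
    with \<beta>\<^sub>1(2) have "eval_uc CT \<beta>\<^sub>1 (g (p x)) = ?M0 (p x)" by blast
    from this[symmetric] show ?thesis
      unfolding head_val[OF that] \<xi>_def comp_def .
  qed
  obtain fn fe where emb: "typed_embedding fn fe (lhs r) G"
    and p_eq: "\<forall>x\<in>items L. p x = map_sum fn fe x"
    and \<iota>_eq: "\<forall>x\<in>items L. (\<xi> \<circ> var) x = \<iota>0 (p x)"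
    and \<delta>_eq: "\<forall>v\<in>verts L. (if v \<in> verts K then \<xi> (dvar (Inl v)) else num_deg (lhs r) v) = num_deg G (fn v)"
    by (rule item_val_embedding[OF type_graph L G p(1,2) \<iota>0 val])
  define m where "m = (fn, fe)"
  have "inj_typed_morphism (lhs r) G m"
    using emb by (simp add: m_def inj_typed_morphism_iff)
  then interpret gt_match TG r G m
    using G by unfold_locales
  have p_m: "p x = m_item x" if "x \<in> items L" for x
    using p_eq that by (simp add: m_def)
  then have p_im: "p ` items L = m_item ` items L"
    by (rule image_cong[OF refl])
  have appl: "applicable r m G"
    unfolding applicable_iff_deg
  proof
    fix v assume "v \<in> verts L - verts K"
    then have "num_deg (lhs r) v = num_deg G (fst m v)"
      using \<delta>_eq by (auto simp: m_def)
    then show "deg (gr G) (fst m v) = deg L v"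
      using inj_num by (simp add: inj_eq)
  qed
  \<comment> \<open>The position \<open>p (Inl w)\<close> does not depend on the solution, since the
    head is a part of the store as written. Hence every solution of \<open>B\<close> gives
    \<open>v\<close> the constant degree found in the head, and the constraint on its degree is
    entailed.\<close>
  have strong: "v \<notin> fst m ` (verts L - verts K)" if "v \<in> strong_nodes CT dvar G B" for v
  proof
    assume "v \<in> fst m ` (verts L - verts K)"
    then obtain w where w: "w \<in> verts L" "w \<notin> verts K" "v = fst m w" by blast
    have "\<gamma> (dvar (Inl v)) = num_deg G v" if "holds_all CT \<gamma> B" for \<gamma>
    proof -
      have "reach CT B\<^sub>1 V\<^sub>1 ?I g \<gamma> (\<lambda>x. eval_uc CT \<gamma> (kp_item G x))"
        unfolding g(2) kp using that by (rule reach_self)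
      then obtain \<gamma>' where "\<forall>x\<in>?I. eval_uc CT \<gamma>' (g x) = eval_uc CT \<gamma> (kp_item G x)"
        unfolding reach_def by blast
      moreover have "Inl w \<in> items L" using w(1) by simp
      then have "p (Inl w) \<in> ?I" "p (Inl w) = Inl v" using p(2) p_m w(3) by (blast, simp)
      ultimately have "eval_uc CT \<gamma> (kp_item G (Inl v)) = eval_uc CT \<gamma>' (g (p (Inl w)))"
        by metis
      then have "\<gamma> (dvar (Inl v)) = num_deg (lhs r) w"
        using w head_val[of "Inl w" \<gamma>'] by (simp add: eval_chr_item)
      then show ?thesis
        using appl w unfolding applicable_iff_deg by simp
    qed
    then have "in_builtins CT (Eq (Var (dvar (Inl v))) (Num (int (deg (gr G) v)))) B"
      unfolding in_builtins_iff_entailed by simp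
    then show False
      using that by (simp add: strong_nodes_def)
  qed
  \<comment> \<open>Identifiers for new items, distinct from each other and from all those of
    \<open>G\<close>.\<close>
  obtain \<nu> :: "'n + 'e \<Rightarrow> 'd" where \<nu>: "inj_on \<nu> (items R)" "\<nu> ` items R \<inter> \<iota>0 ` ?I = {}"
    by (rule ex_fresh_inj_on[OF infinite_carrier finite_items[OF R], of "\<iota>0 ` ?I"]) (use fin in auto)
  define \<xi>\<^sub>2 where "\<xi>\<^sub>2 = rule_val (\<xi> \<circ> var) (\<lambda>v. \<xi> (dvar (Inl v))) (rhs_deg (\<lambda>v. \<xi> (dvar (Inl v)))) \<nu>"
  have \<xi>\<^sub>2_builtin: "holds_all CT \<xi>\<^sub>2 (rl_builtin enc)"
    unfolding \<xi>\<^sub>2_def by (rule rule_val_builtin)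
  have \<xi>\<^sub>2_head: "\<xi>\<^sub>2 y = \<xi> y" if "y \<in> vars_ucs (rl_head enc)" for y
    using that unfolding vars_head \<xi>\<^sub>2_def by auto
  let ?new = "vars_rule enc - vars_ucs (rl_head enc)"
  have head_sub: "vars_ucs (rl_head enc) \<subseteq> vars_rule enc"
    by (auto simp: vars_rule_def)
  \<comment> \<open>By freshness the changed variables occur neither in \<open>B\<^sub>1\<close> nor
    in \<open>A\<close>, so that store stays satisfied and the context keeps its values.\<close>
  define \<beta>\<^sub>2 where "\<beta>\<^sub>2 z = (if z \<in> \<rho> ` ?new then \<xi>\<^sub>2 (inv_into (vars_rule enc) \<rho> z) else \<beta>\<^sub>1 z)" for z
  have \<beta>\<^sub>2_\<rho>: "(\<beta>\<^sub>2 \<circ> \<rho>) y = \<xi>\<^sub>2 y" if "y \<in> vars_rule enc" for y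
  proof (cases "y \<in> vars_ucs (rl_head enc)")
    case True
    then have "\<rho> y \<notin> \<rho> ` ?new"
      using \<rho> that by (auto dest: inj_onD)
    then show ?thesis
      using True \<xi>\<^sub>2_head by (simp add: \<beta>\<^sub>2_def \<xi>_def)
  next
    case False
    then show ?thesis
      using that \<rho> by (simp add: \<beta>\<^sub>2_def)
  qed
  have new_R': "\<rho> ` ?new = vars_rule R' - vars_ucs (rl_head R')"
    unfolding vars_R' using inj_on_image_set_diff[OF \<rho> _ head_sub] by blast
  have "holds_all CT \<beta>\<^sub>2 B\<^sub>1 \<longleftrightarrow> holds_all CT \<beta>\<^sub>1 B\<^sub>1"
    using fresh(2) unfolding new_R'[symmetric] by (intro holds_all_cong) (auto simp: \<beta>\<^sub>2_def)
  then have \<beta>\<^sub>2_B: "holds_all CT \<beta>\<^sub>2 (rl_builtin R' + B\<^sub>1)"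
    using \<beta>\<^sub>1(1) \<xi>\<^sub>2_builtin holds_all_cong[of "rl_builtin enc" "\<beta>\<^sub>2 \<circ> \<rho>" \<xi>\<^sub>2 CT] \<beta>\<^sub>2_\<rho>
    unfolding R'_eq by (simp add: holds_all_rename vars_rule_def)
  have user_val: "eval_uc CT \<beta>\<^sub>2 (ur x) =
      item_val TG (rhs r) (\<xi>\<^sub>2 \<circ> var) (rhs_deg (\<lambda>v. \<xi>\<^sub>2 (dvar (Inl v)))) x" if "x \<in> items R" for x
  proof -
    have "eval_uc CT \<beta>\<^sub>2 (ur x) = eval_uc CT \<xi>\<^sub>2 (user_item x)"
      unfolding ur_def eval_rename_uc using vars_user_item[OF that] \<beta>\<^sub>2_\<rho> by (intro eval_uc_cong) blast
    then show ?thesis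
      using eval_user_item[OF \<xi>\<^sub>2_builtin] by simp
  qed
  have ctx_val: "eval_uc CT \<beta>\<^sub>2 (g x) = ?M0 x" if "x \<in> ctx_items" for x
  proof -
    have "vars_uc (g x) \<subseteq> vars_ucs A"
      unfolding p(4) p_im using that fin by (intro vars_uc_subset_vars_ucs) auto
    then have "eval_uc CT \<beta>\<^sub>2 (g x) = eval_uc CT \<beta>\<^sub>1 (g x)"
      using fresh(1) new_R' by (intro eval_uc_cong) (auto simp: \<beta>\<^sub>2_def)
    then show ?thesis using \<beta>\<^sub>1(2) that by simp
  qed
  define \<iota>P where "\<iota>P = po_case (\<xi>\<^sub>2 \<circ> var) \<iota>0"
  define \<delta>P where "\<delta>P = case_sum (rhs_deg (\<lambda>v. \<xi>\<^sub>2 (dvar (Inl v)))) (num_deg G)"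
  have \<xi>\<^sub>2_L: "\<xi>\<^sub>2 (var x) = \<iota>0 (m_item x)" if "x \<in> items L" for x
    using that \<iota>_eq p_m[OF that] by (simp add: \<xi>\<^sub>2_def)
  have \<xi>\<^sub>2_new: "\<xi>\<^sub>2 (var x) = \<nu> x" if "x \<in> items R" "x \<notin> items L" for x
    using that by (simp add: \<xi>\<^sub>2_def)
  have po_val: "eval_uc CT \<beta>\<^sub>2 (po_case ur g y) = item_val TG PO \<iota>P \<delta>P y"
    if "y \<in> items (gr PO)" for y
    unfolding po_case_comp[of "eval_uc CT \<beta>\<^sub>2"] \<iota>P_def \<delta>P_def
  proof (rule po_case_item_val[OF appl that])
    show "(\<xi>\<^sub>2 \<circ> var) (Inl v) = \<iota>0 (Inl (fst m v))" if "v \<in> verts K" for v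
      using \<xi>\<^sub>2_L[of "Inl v"] that ker_sub(1) by auto
  qed (simp_all add: user_val ctx_val)
  \<comment> \<open>An item of \<open>R - K\<close> may share its name with a deleted item of
    \<open>L\<close>; the encoding then uses one variable for both, and the new item inherits the
    identifier of the deleted one. No clash arises, because the deleted item is not in the
    context.\<close>
  have \<iota>P_inj: "inj_on \<iota>P (items (gr PO))"
  proof (rule inj_onI)
    have rr: "x = x'" if "x \<in> items R" "x' \<in> items R" "\<xi>\<^sub>2 (var x) = \<xi>\<^sub>2 (var x')" for x x'
    proof (cases "x \<in> items L \<longleftrightarrow> x' \<in> items L")
      case True
      show ?thesis
      proof (cases "x \<in> items L")
        case True
        then have "x' \<in> items L" using \<open>x \<in> items L \<longleftrightarrow> x' \<in> items L\<close> by simp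
        with True that(3) have "\<iota>0 (m_item x) = \<iota>0 (m_item x')" by (simp add: \<xi>\<^sub>2_L)
        then have "m_item x = m_item x'"
          using \<iota>0 m_item_in True \<open>x' \<in> items L\<close> by (meson image_subset_iff inj_onD)
        then show ?thesis
          using m_item_inj True \<open>x' \<in> items L\<close> by (meson inj_onD)
      next
        case False
        then show ?thesis
          using True that \<nu>(1) by (simp add: \<xi>\<^sub>2_new inj_on_eq_iff)
      qed
    next
      case False
      have "\<nu> y \<noteq> \<iota>0 (m_item z)" if "y \<in> items R" "z \<in> items L" for y z
        using that \<nu>(2) m_item_in by (auto simp: disjoint_iff)
      then show ?thesis
        using False that \<xi>\<^sub>2_L \<xi>\<^sub>2_new by metis
    qed
    have rc: "\<xi>\<^sub>2 (var x) \<noteq> \<iota>0 y" if "x \<in> items R" "y \<in> ctx_items" for x y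
    proof (cases "x \<in> items L")
      case True
      then have "m_item x \<in> ?I" "m_item x \<noteq> y" using m_item_in that(2) by auto
      then show ?thesis
        using True that(2) \<iota>0 by (auto simp: \<xi>\<^sub>2_L dest: inj_onD)
    next
      case False
      then show ?thesis
        using that \<nu>(2) by (auto simp: \<xi>\<^sub>2_new)
    qed
    fix y z
    assume yz: "y \<in> items (gr PO)" "z \<in> items (gr PO)" "\<iota>P y = \<iota>P z"
    show "y = z"
      using yz(1)
    proof (cases rule: po_items_cases)
      case y: (rhs x)
      from yz(2) show ?thesis
      proof (cases rule: po_items_cases)
        case (rhs x')
        then show ?thesis using y yz(3) rr[of x x'] by (simp add: \<iota>P_def)
      next
        case (ctx x')
        then show ?thesis using y yz(3) rc[of x x'] by (simp add: \<iota>P_def)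
      qed
    next
      case y: (ctx x)
      from yz(2) show ?thesis
      proof (cases rule: po_items_cases)
        case (rhs x')
        then show ?thesis using y yz(3) rc[of x' x] by (simp add: \<iota>P_def)
      next
        case (ctx x')
        then show ?thesis using y yz(3) \<iota>0 by (auto simp: \<iota>P_def dest: inj_onD)
      qed
    qed
  qed
  let ?P = "items (gr PO)"
  have PO: "typed_graph TG PO" using appl by (rule typed_graph_pushout)
  have finP: "finite ?P" using PO by (rule finite_items)
  have "state_equiv CT (State (image_mset (po_case ur g) (mset_set ?P)) (rl_builtin R' + B\<^sub>1) V\<^sub>1)
      (State (chr TG var dvar Kp H') B' V)"
    using state_equiv_trans[OF post equiv'] unfolding image_mset_po_case R'_eq(2) p(4) p_im .
  then obtain k where k: "chr TG var dvar Kp H' = image_mset k (mset_set ?P)"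
    "reach CT B' V ?P k = reach CT (rl_builtin R' + B\<^sub>1) V\<^sub>1 ?P (po_case ur g)"
    using state_equiv_reach[OF _ _ finP] \<beta>\<^sub>2_B by metis
  obtain q where q: "bij_betw q ?P (items (gr H'))" "\<forall>i\<in>?P. kp_item H' (q i) = k i"
    using image_mset_eq_obtain_bij[OF finP finite_items[OF H']] k(1) unfolding chr_def by metis
  \<comment> \<open>The values at \<open>\<beta>\<^sub>2\<close> are those of the pushout with
    distinct identifiers. As they are reached in the encoding of \<open>H'\<close>, they determine
    \<open>H'\<close> up to isomorphism.\<close>
  have "reach CT B' V ?P k \<beta>\<^sub>2 (item_val TG PO \<iota>P \<delta>P)"
    unfolding k(2) reach_def using \<beta>\<^sub>2_B po_val by blast
  then obtain \<gamma> where \<gamma>: "\<forall>i\<in>?P. eval_uc CT \<gamma> (k i) = item_val TG PO \<iota>P \<delta>P i"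
    unfolding reach_def by blast
  define qi where "qi = inv_into ?P q"
  have qi: "bij_betw qi (items (gr H')) ?P"
    unfolding qi_def using q(1) by (rule bij_betw_inv_into)
  have "item_val TG PO \<iota>P \<delta>P (qi x) = item_val TG H' (\<gamma> \<circ> var) (\<lambda>v. \<gamma> (dvar (Inl v))) x"
    if "x \<in> items (gr H')" for x
  proof -
    have "qi x \<in> ?P" "q (qi x) = x"
      using qi q(1) that by (auto simp: qi_def bij_betw_def bij_betw_inv_into_right f_inv_into_f inv_into_into)
    then show ?thesis using \<gamma> q(2) eval_chr_item(1) by metis
  qed
  then obtain hn he where "typed_iso hn he H' PO" and "\<forall>x\<in>items (gr H'). qi x = map_sum hn he x"
    and "\<forall>x\<in>items (gr H'). (\<gamma> \<circ> var) x = \<iota>P (qi x)"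
    and "\<forall>v\<in>verts (gr H'). \<gamma> (dvar (Inl v)) = \<delta>P (hn v)"
    by (rule item_val_bij_iso[OF type_graph H' PO qi \<iota>P_inj])
  then obtain gn ge where "typed_iso gn ge H PO"
    using iso typed_iso_comp unfolding typed_isomorphic_iff by blast
  from typed_iso_sym[OF this H] obtain trk where trk: "derivation r m G H trk"
    using pushout_iso_imp_derivation[OF appl] by blast
  have "strong_nodes CT dvar G B \<subseteq> {v \<in> verts (gr G). fst trk v \<noteq> None}"
    unfolding derivation_track[OF trk] using strong by (auto simp: strong_nodes_def)
  with trk show ?thesis by blast
qed

end

section \<open>From derivations to transitions\<close>

lemma map_uc_args: "map (eval_trm CT \<beta>) (uc_args c) = snd (eval_uc CT \<beta> c)"
  by (cases c) simp

lemma vars_uc_args: "t \<in> set (uc_args c) \<Longrightarrow> vars_trm t \<subseteq> vars_uc c"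
  by (cases c) auto

lemma state_equiv_finite_globals:
  assumes "state_equiv CT \<sigma> \<tau>"
  shows "finite (globals \<sigma>) \<longleftrightarrow> finite (globals \<tau>)"
proof -
  have step: "finite (globals \<sigma>) \<longleftrightarrow> finite (globals \<tau>)" if "state_step CT \<sigma> \<tau>" for \<sigma> \<tau>
    using that by cases auto
  show ?thesis
    using assms unfolding state_equiv_def by (induction rule: equivclp_induct) (auto dest: step)
qed

lemma bij_betw_items:
  assumes "typed_iso fn fe G H"
  shows "bij_betw (map_sum fn fe) (items (gr G)) (items (gr H))"
  unfolding bij_betw_def
proof
  have n: "inj_on fn (verts (gr G))" and e: "inj_on fe (arcs (gr G))"
    using assms by (simp_all add: typed_iso_def typed_embedding_def)
  show "inj_on (map_sum fn fe) (items (gr G))"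
  proof (rule inj_onI)
    fix x y
    assume "x \<in> items (gr G)" "y \<in> items (gr G)" "map_sum fn fe x = map_sum fn fe y"
    then show "x = y"
      by (cases x; cases y) (auto dest: inj_onD[OF n] inj_onD[OF e])
  qed
  show "map_sum fn fe ` items (gr G) = items (gr H)"
    using assms by (simp add: items_map_sum typed_iso_def items_def[of "gr H"])
qed

text \<open>The condition \<open>deleted_deg\<close> is the semantic form of the hypothesis on
  strong nodes: the degree of a deleted node is forced by \<open>B\<close>. The rule copy avoids the
  variables of \<open>Bx\<close> too, because the same \<open>Bx\<close> will witness the invariant
  of the result.\<close>

locale chr_match = chr_rule_encoding CT TG var dvar r cp + gt_match TG r G m
  for CT :: "('f, 'p, 'd) struct" and TG :: "('tn, 'te, 'l) type_graph"
    and var dvar :: "'n + 'e \<Rightarrow> 'v" and r :: "('n, 'e, 'tn, 'te) gt_rule" and cp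
    and G :: "('n, 'e, 'tn, 'te) tgraph" and m +
  fixes a :: "'n + 'e \<Rightarrow> ('l, 'f, 'v) uc" and Bc Ba Bx B :: "('f, 'p, 'v) bic multiset"
    and V\<^sub>0 V :: "'v set" and \<rho> :: "'v \<Rightarrow> 'v"
  assumes appl: "applicable r m G"
    and kp: "reach CT (Bc + Ba) V\<^sub>0 (items (gr G)) a = reach CT B V (items (gr G)) (kp_item G)"
    and gnd: "\<forall>\<alpha> M. reach CT (Bc + Ba + Bx) {} (items (gr G)) a \<alpha> M \<longleftrightarrow>
       (\<exists>\<iota>. \<forall>x\<in>items (gr G). M x = item_val TG G \<iota> (num_deg G) x)"
    and deleted_deg: "\<And>\<gamma> v. holds_all CT \<gamma> B \<Longrightarrow> v \<in> verts L - verts K \<Longrightarrow>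
       \<gamma> (dvar (Inl (fst m v))) = num_deg (lhs r) v"
    and finite_globals: "finite V\<^sub>0" "finite V"
    and \<rho>_inj: "inj_on \<rho> (vars_rule enc)"
    and \<rho>_fresh: "\<rho> ` vars_rule enc \<inter>
       (V\<^sub>0 \<union> vars_ucs (image_mset a (mset_set (items (gr G)))) \<union> vars_bics (Bc + Ba + Bx)) = {}"
begin

abbreviation "I \<equiv> items (gr G)"
abbreviation "P \<equiv> items (gr PO)"
abbreviation "E \<equiv> Bc + Ba"

lemma finite_I: "finite I" using G by (rule finite_items)
lemma PO: "typed_graph TG PO" using appl by (rule typed_graph_pushout)
lemma finite_P: "finite P" using PO by (rule finite_items)

lemma consistent: "\<exists>\<beta>. holds_all CT \<beta> (E + Bx)" "\<exists>\<beta>. holds_all CT \<beta> E"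
proof -
  have "reach CT (E + Bx) {} I a \<alpha> (item_val TG G \<iota> (num_deg G))" for \<alpha> \<iota>
    using gnd by blast
  then show "\<exists>\<beta>. holds_all CT \<beta> (E + Bx)"
    using reach_nonempty_iff by blast
  then show "\<exists>\<beta>. holds_all CT \<beta> E" by auto
qed

text \<open>At the solution \<beta> the store reads as \<open>G\<close> with identifiers \<iota> and
  degrees \<delta>. The latter need not be actual degrees, except that nodes to be deleted have the
  degree demanded by the head. Every solution of \<open>E\<close> has such a reading
  (\<open>ex_vals\<close>).\<close>

definition vals :: "('v \<Rightarrow> 'd) \<Rightarrow> ('n + 'e \<Rightarrow> 'd) \<Rightarrow> ('n \<Rightarrow> 'd) \<Rightarrow> bool" where
  "vals \<beta> \<iota> \<delta> \<longleftrightarrow> (\<forall>x\<in>I. eval_uc CT \<beta> (a x) = item_val TG G \<iota> \<delta> x) \<and>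
     (\<forall>v\<in>verts L - verts K. \<delta> (fst m v) = num_deg (lhs r) v)"

lemma kp_vals:
  assumes "holds_all CT \<gamma> B" "\<forall>x\<in>I. eval_uc CT \<beta> (a x) = eval_uc CT \<gamma> (kp_item G x)"
  shows "vals \<beta> (\<gamma> \<circ> var) (\<lambda>v. \<gamma> (dvar (Inl v)))"
  using assms deleted_deg by (auto simp: vals_def eval_chr_item)

lemma ex_vals:
  assumes "holds_all CT \<beta> E"
  obtains \<iota> \<delta> where "vals \<beta> \<iota> \<delta>"
proof -
  have "reach CT B V I (kp_item G) \<beta> (\<lambda>x. eval_uc CT \<beta> (a x))"
    using reach_self[OF assms] kp by metis
  then obtain \<gamma> where "holds_all CT \<gamma> B" "\<forall>x\<in>I. eval_uc CT \<gamma> (kp_item G x) = eval_uc CT \<beta> (a x)"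
    unfolding reach_def by blast
  then show thesis using that kp_vals by metis
qed

text \<open>The arguments in the user store of \<sigma> need not be the variables of the encoding,
  since equivalence may have replaced them by other terms. That there are enough arguments is seen
  from their values.\<close>

definition id_arg :: "'n + 'e \<Rightarrow> ('f, 'v) trm" where
  "id_arg x = hd (uc_args (a x))"

definition deg_arg :: "'n \<Rightarrow> ('f, 'v) trm" where
  "deg_arg v = uc_args (a (Inl v)) ! 1"

lemma eval_id_arg: "vals \<beta> \<iota> \<delta> \<Longrightarrow> x \<in> I \<Longrightarrow> eval_trm CT \<beta> (id_arg x) = \<iota> x \<and> id_arg x \<in> set (uc_args (a x))"
  using map_uc_args[of CT \<beta> "a x"] unfolding vals_def id_arg_def
  by (cases x) (auto simp: map_eq_Cons_conv)

lemma eval_deg_arg: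
  "vals \<beta> \<iota> \<delta> \<Longrightarrow> v \<in> verts (gr G) \<Longrightarrow>
     eval_trm CT \<beta> (deg_arg v) = \<delta> v \<and> deg_arg v \<in> set (uc_args (a (Inl v)))"
  using map_uc_args[of CT \<beta> "a (Inl v)"] unfolding vals_def deg_arg_def
  by (auto simp: map_eq_Cons_conv)

text \<open>
  Expresses the variables of the rule in terms of the arguments of the state. Substituting it in
  the rule body keeps the built-in store of the state unchanged.
\<close>

definition \<theta> :: "'v \<Rightarrow> ('f, 'v) trm" where
  "\<theta> = rule_val (\<lambda>x. id_arg (m_item x)) (\<lambda>v. deg_arg (fst m v))
     (\<lambda>v. Plus (Minus (deg_arg (fst m v)) (Num (int (deg L v)))) (Num (int (deg R v))))
     (\<lambda>x. Var (\<rho> (var x)))"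

abbreviation \<xi> :: "('v \<Rightarrow> 'd) \<Rightarrow> ('n + 'e \<Rightarrow> 'd) \<Rightarrow> ('n \<Rightarrow> 'd) \<Rightarrow> 'v \<Rightarrow> 'd" where
  "\<xi> \<beta> \<iota> \<delta> \<equiv> rule_val (\<iota> \<circ> m_item) (\<delta> \<circ> fst m) (rhs_deg (\<delta> \<circ> fst m)) (\<lambda>x. \<beta> (\<rho> (var x)))"

lemma vars_rule_cases:
  assumes "z \<in> vars_rule enc"
  obtains (lhs) x where "x \<in> items L" "z = var x"
  | (rhs) x where "x \<in> items R" "x \<notin> items L" "z = var x"
  | (copy) v where "v \<in> verts K" "z = var (Inl (cp v))"
  | (deg) v where "v \<in> verts K" "z = dvar (Inl v)"
  | (copy_deg) v where "v \<in> verts K" "z = dvar (Inl (cp v))"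
  using assms vars_enc that unfolding image_Un by blast

lemma eval_\<theta>:
  assumes "vals \<beta> \<iota> \<delta>" "z \<in> vars_rule enc"
  shows "eval_trm CT \<beta> (\<theta> z) = \<xi> \<beta> \<iota> \<delta> z"
proof -
  have ker: "eval_trm CT \<beta> (deg_arg (fst m v)) = \<delta> (fst m v)" if "v \<in> verts K" for v
    using eval_deg_arg[OF assms(1) m_in(1)] that ker_sub(1) by blast
  have lhs: "eval_trm CT \<beta> (id_arg (m_item x)) = \<iota> (m_item x)" if "x \<in> items L" for x
    using eval_id_arg[OF assms(1)] m_item_in that by blast
  have lhs': "eval_trm CT \<beta> (id_arg (Inl (fst m v))) = \<iota> (Inl (fst m v))" if "v \<in> verts K" for v
    using lhs[of "Inl v"] that ker_sub(1) by auto
  from assms(2) show ?thesis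
    by (cases rule: vars_rule_cases) (simp_all add: \<theta>_def lhs lhs' ker rhs_deg_def)
qed

lemma \<xi>_head: "z \<in> vars_ucs (rl_head enc) \<Longrightarrow> \<xi> \<beta> \<iota> \<delta> z = \<xi> \<beta>' \<iota> \<delta> z"
  unfolding vars_head by auto

lemma head_sub: "vars_ucs (rl_head enc) \<subseteq> vars_rule enc"
  by (auto simp: vars_rule_def)

definition hr :: "'n + 'e \<Rightarrow> ('l, 'f, 'v) uc" where "hr = subst_uc (Var \<circ> \<rho>) \<circ> head_item"
definition ur :: "'n + 'e \<Rightarrow> ('l, 'f, 'v) uc" where "ur = subst_uc (Var \<circ> \<rho>) \<circ> user_item"
definition u\<theta> :: "'n + 'e \<Rightarrow> ('l, 'f, 'v) uc" where "u\<theta> x = subst_uc \<theta> (user_item x)"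

lemma eval_hr:
  assumes "vals \<beta> \<iota> \<delta>" "\<And>z. z \<in> vars_ucs (rl_head enc) \<Longrightarrow> \<beta>' (\<rho> z) = \<xi> \<beta>'' \<iota> \<delta> z" "x \<in> items L"
  shows "eval_uc CT \<beta>' (hr x) = item_val TG G \<iota> \<delta> (m_item x)"
  unfolding hr_def comp_apply[of "subst_uc _"] eval_rename_uc eval_head_item item_val_matched[OF assms(3)]
proof (rule item_val_cong[OF L assms(3)])
  show "(\<beta>' \<circ> \<rho> \<circ> var) y = (\<iota> \<circ> m_item) y" if "y \<in> items L" for y
    using assms(2)[of "var y"] that by (simp add: vars_head)
  show "(if v \<in> verts K then (\<beta>' \<circ> \<rho>) (dvar (Inl v)) else num_deg (lhs r) v) = (\<delta> \<circ> fst m) v"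
    if "v \<in> verts L" for v
    using assms(1) assms(2)[of "dvar (Inl v)"] that by (auto simp: vars_head vals_def)
qed

lemma eval_u\<theta>_\<xi>:
  assumes "vals \<beta> \<iota> \<delta>" "x \<in> items R"
  shows "eval_uc CT \<beta> (u\<theta> x) = eval_uc CT (\<xi> \<beta> \<iota> \<delta>) (user_item x)"
  unfolding u\<theta>_def eval_subst_uc using vars_user_item[OF assms(2)]
  by (intro eval_uc_cong eval_\<theta>[OF assms(1)]) blast

text \<open>The case distinction is on \<open>L\<close>, not on \<open>K\<close>: an item that
  \<open>R\<close> shares with \<open>L\<close> by name uses a variable of the head, even if it is
  not in the kernel.\<close>

definition rhs_id :: "('v \<Rightarrow> 'd) \<Rightarrow> ('n + 'e \<Rightarrow> 'd) \<Rightarrow> 'n + 'e \<Rightarrow> 'd" where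
  "rhs_id \<beta> \<iota> x = (if x \<in> items L then \<iota> (m_item x) else \<beta> (\<rho> (var x)))"

lemma rhs_deg_cong: "(\<And>v. v \<in> verts K \<Longrightarrow> \<delta> v = \<delta>' v) \<Longrightarrow> rhs_deg \<delta> v = rhs_deg \<delta>' v"
  by (simp add: rhs_deg_def)

lemma eval_u\<theta>:
  assumes "vals \<beta> \<iota> \<delta>" "x \<in> items R"
  shows "eval_uc CT \<beta> (u\<theta> x) = item_val TG (rhs r) (rhs_id \<beta> \<iota>) (rhs_deg (\<delta> \<circ> fst m)) x"
  unfolding eval_u\<theta>_\<xi>[OF assms] eval_user_item[OF rule_val_builtin]
proof (rule item_val_cong[OF R assms(2)])
  show "(\<xi> \<beta> \<iota> \<delta> \<circ> var) y = rhs_id \<beta> \<iota> y" if "y \<in> items R" for y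
    using that by (cases "y \<in> items L") (simp_all add: rhs_id_def)
  show "rhs_deg (\<lambda>v. \<xi> \<beta> \<iota> \<delta> (dvar (Inl v))) v = rhs_deg (\<delta> \<circ> fst m) v" for v
    by (rule rhs_deg_cong) simp
qed

abbreviation po_id :: "('v \<Rightarrow> 'd) \<Rightarrow> ('n + 'e \<Rightarrow> 'd) \<Rightarrow> ('n + 'n) + ('e + 'e) \<Rightarrow> 'd" where
  "po_id \<beta> \<iota> \<equiv> po_case (rhs_id \<beta> \<iota>) \<iota>"

abbreviation po_deg :: "('n \<Rightarrow> 'd) \<Rightarrow> 'n + 'n \<Rightarrow> 'd" where
  "po_deg \<delta> \<equiv> case_sum (rhs_deg (\<delta> \<circ> fst m)) \<delta>"

abbreviation "C \<equiv> po_case u\<theta> a"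

lemma eval_C:
  assumes "vals \<beta> \<iota> \<delta>" "y \<in> P"
  shows "eval_uc CT \<beta> (C y) = item_val TG PO (po_id \<beta> \<iota>) (po_deg \<delta>) y"
  unfolding po_case_comp[of "eval_uc CT \<beta>"]
proof (rule po_case_item_val[OF appl assms(2)])
  show "(eval_uc CT \<beta> \<circ> u\<theta>) x = item_val TG (rhs r) (rhs_id \<beta> \<iota>) (rhs_deg (\<delta> \<circ> fst m)) x"
    if "x \<in> items R" for x
    using eval_u\<theta>[OF assms(1) that] by simp
  show "(eval_uc CT \<beta> \<circ> a) x = item_val TG G \<iota> \<delta> x" if "x \<in> ctx_items" for x
    using assms(1) that by (simp add: vals_def)
  show "rhs_id \<beta> \<iota> (Inl v) = \<iota> (Inl (fst m v))" if "v \<in> verts K" for v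
    using that ker_sub(1) by (auto simp: rhs_id_def)
qed

section \<open>The transition by a fresh copy of the rule\<close>

definition upd :: "('v \<Rightarrow> 'd) \<Rightarrow> ('v \<Rightarrow> 'd) \<Rightarrow> 'v \<Rightarrow> 'd" where
  "upd \<beta> w z = (if z \<in> \<rho> ` vars_rule enc then w (inv_into (vars_rule enc) \<rho> z) else \<beta> z)"

lemma upd_\<rho>: "z \<in> vars_rule enc \<Longrightarrow> upd \<beta> w (\<rho> z) = w z"
  using \<rho>_inj by (simp add: upd_def)

lemma upd_old:
  "z \<in> V\<^sub>0 \<union> vars_ucs (image_mset a (mset_set I)) \<union> vars_bics (E + Bx) \<Longrightarrow> upd \<beta> w z = \<beta> z"
  using \<rho>_fresh unfolding upd_def by auto

lemma eval_upd: "x \<in> I \<Longrightarrow> eval_uc CT (upd \<beta> w) (a x) = eval_uc CT \<beta> (a x)"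
  using vars_uc_subset_vars_ucs[OF finite_I, of x a] by (intro eval_uc_cong upd_old) blast

lemma holds_upd:
  "holds_all CT (upd \<beta> w) E \<longleftrightarrow> holds_all CT \<beta> E"
  "holds_all CT (upd \<beta> w) (E + Bx) \<longleftrightarrow> holds_all CT \<beta> (E + Bx)"
  by (intro holds_all_cong upd_old; simp)+

lemma vals_upd: "vals (upd \<beta> w) \<iota> \<delta> \<longleftrightarrow> vals \<beta> \<iota> \<delta>"
  by (simp add: vals_def eval_upd)

text \<open>Equations tying the head variables of the rule copy to the arguments found in the state.
  The other variables of the copy must not occur in the built-ins, by freshness, so only the head
  variables are tied.\<close>

definition T :: "('f, 'p, 'v) bic multiset" where
  "T = image_mset (\<lambda>z. Eq (Var (\<rho> z)) (\<theta> z)) (mset_set (vars_ucs (rl_head enc)))"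

lemma holds_T: "holds_all CT \<beta> T \<longleftrightarrow> (\<forall>z\<in>vars_ucs (rl_head enc). \<beta> (\<rho> z) = eval_trm CT \<beta> (\<theta> z))"
  by (simp add: T_def holds_all_image_mset)

lemma holds_T_upd:
  assumes "vals \<beta> \<iota> \<delta>"
  shows "holds_all CT (upd \<beta> (\<lambda>z. eval_trm CT \<beta> (\<theta> z))) T"
  unfolding holds_T
proof
  fix z assume z: "z \<in> vars_ucs (rl_head enc)"
  then have "z \<in> vars_rule enc" using head_sub by blast
  then show "upd \<beta> (\<lambda>z. eval_trm CT \<beta> (\<theta> z)) (\<rho> z) = eval_trm CT (upd \<beta> (\<lambda>z. eval_trm CT \<beta> (\<theta> z))) (\<theta> z)"
    using z assms by (simp add: upd_\<rho> eval_\<theta> vals_upd) (rule \<xi>_head)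
qed

lemma holds_T_head:
  assumes "vals \<beta> \<iota> \<delta>" "holds_all CT \<beta> T" "z \<in> vars_ucs (rl_head enc)"
  shows "\<beta> (\<rho> z) = \<xi> \<beta> \<iota> \<delta> z"
  using assms head_sub eval_\<theta>[OF assms(1), of z] unfolding holds_T by auto

text \<open>That the terms in \<theta> for head variables are arguments of the user store is seen at
  a single solution, which consistency provides.\<close>

lemma vars_T: "vars_bics T \<subseteq> \<rho> ` vars_ucs (rl_head enc) \<union> vars_ucs (image_mset a (mset_set I))"
proof -
  obtain \<beta> \<iota> \<delta> where vals: "vals \<beta> \<iota> \<delta>"
    using consistent(2) ex_vals by metis
  have a: "vars_uc (a x) \<subseteq> vars_ucs (image_mset a (mset_set I))" if "x \<in> I" for x
    using vars_uc_subset_vars_ucs[OF finite_I that] .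
  have id: "vars_trm (id_arg x) \<subseteq> vars_ucs (image_mset a (mset_set I))" if "x \<in> I" for x
    using eval_id_arg[OF vals that] vars_uc_args a[OF that] by blast
  have deg: "vars_trm (deg_arg v) \<subseteq> vars_ucs (image_mset a (mset_set I))" if "v \<in> verts (gr G)" for v
    using eval_deg_arg[OF vals that] vars_uc_args a[of "Inl v"] that by fastforce
  have "vars_trm (\<theta> z) \<subseteq> vars_ucs (image_mset a (mset_set I))" if z: "z \<in> vars_ucs (rl_head enc)" for z
  proof -
    consider x where "x \<in> items L" "z = var x" | v where "v \<in> verts K" "z = dvar (Inl v)"
      using z[unfolded vars_head] by blast
    then show ?thesis
    proof cases
      case 1
      then show ?thesis using id[of "m_item x"] m_item_in by (auto simp: \<theta>_def)
    next
      case 2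
      then show ?thesis using deg[of "fst m v"] m_in(1) ker_sub(1) by (auto simp: \<theta>_def)
    qed
  qed
  then show ?thesis
    unfolding T_def vars_bics_def by auto
qed

abbreviation "R' \<equiv> rename_rule \<rho> enc"

lemma R'_eq:
  "rl_head R' = image_mset hr (mset_set (items L))"
  "rl_user R' = image_mset ur (mset_set (items R))"
  "rl_builtin R' = image_mset (subst_bic (Var \<circ> \<rho>)) (rl_builtin enc)"
  unfolding rename_rule_def rl_head_enc rl_user_enc
  by (simp_all add: hr_def ur_def multiset.map_comp)

abbreviation "ctx_user \<equiv> image_mset a (mset_set ctx_items)"

text \<open>Solutions of \<open>E\<close> extend to the head variables of the copy by evaluating
  \<theta>, and \<open>T\<close> admits no other values there. Under \<open>T\<close> the matched
  constraints and the renamed head have equal values.\<close>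

lemma state_equiv_head:
  "state_equiv CT (State (image_mset a (mset_set I)) E V\<^sub>0) (State (rl_head R' + ctx_user) (E + T) V\<^sub>0)"
proof -
  define b where "b x = (if x \<in> m_item ` items L then hr (inv_into (items L) m_item x) else a x)" for x
  have b_m: "b (m_item x) = hr x" if "x \<in> items L" for x
    using that m_item_inj by (simp add: b_def)
  have "image_mset b (mset_set (m_item ` items L)) = image_mset (b \<circ> m_item) (mset_set (items L))"
    using m_item_inj by (intro image_mset_bij_betw) (simp add: bij_betw_def)
  also have "\<dots> = rl_head R'"
    unfolding R'_eq using b_m finite_items[OF L] by (intro image_mset_cong) simp
  finally have "image_mset b (mset_set (m_item ` items L)) = rl_head R'" .
  moreover have "image_mset b (mset_set ctx_items) = ctx_user"
    using finite_I by (intro image_mset_cong) (auto simp: b_def)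
  ultimately have user: "image_mset b (mset_set I) = rl_head R' + ctx_user"
    using image_mset_Diff_split[OF finite_I m_item_in, of b] by (simp add: add.commute)
  have b_val: "eval_uc CT \<beta>' (b x) = eval_uc CT \<beta> (a x)"
    if "vals \<beta> \<iota> \<delta>" "\<And>z. z \<in> vars_ucs (rl_head enc) \<Longrightarrow> \<beta>' (\<rho> z) = \<xi> \<beta>'' \<iota> \<delta> z" "x \<in> I"
      "eval_uc CT \<beta>' (a x) = eval_uc CT \<beta> (a x)"
    for \<beta> \<beta>' \<beta>'' \<iota> \<delta> x
  proof (cases "x \<in> m_item ` items L")
    case True
    then obtain y where y: "y \<in> items L" "x = m_item y" by blast
    then show ?thesis
      using eval_hr[OF that(1,2) y(1)] that(1,3) b_m by (simp add: vals_def)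
  next
    case False
    then show ?thesis using that(4) by (simp add: b_def)
  qed
  have "reach CT E V\<^sub>0 I a = reach CT (E + T) V\<^sub>0 I b"
  proof (intro ext iffI)
    fix \<alpha> M
    assume "reach CT E V\<^sub>0 I a \<alpha> M"
    then obtain \<beta> where \<beta>: "\<forall>x\<in>V\<^sub>0. \<beta> x = \<alpha> x" "holds_all CT \<beta> E" "\<forall>x\<in>I. eval_uc CT \<beta> (a x) = M x"
      unfolding reach_def by blast
    obtain \<iota> \<delta> where vals: "vals \<beta> \<iota> \<delta>" using ex_vals[OF \<beta>(2)] .
    let ?\<beta> = "upd \<beta> (\<lambda>z. eval_trm CT \<beta> (\<theta> z))"
    have "?\<beta> (\<rho> z) = \<xi> \<beta> \<iota> \<delta> z" if "z \<in> vars_ucs (rl_head enc)" for z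
      using that head_sub vals by (auto simp: upd_\<rho> eval_\<theta>)
    then have "eval_uc CT ?\<beta> (b x) = M x" if "x \<in> I" for x
      using b_val[OF vals _ that eval_upd[OF that]] \<beta>(3) that by metis
    moreover have "\<forall>x\<in>V\<^sub>0. ?\<beta> x = \<alpha> x" using \<beta>(1) by (simp add: upd_old)
    ultimately show "reach CT (E + T) V\<^sub>0 I b \<alpha> M"
      using \<beta>(2) holds_upd(1) holds_T_upd[OF vals] unfolding reach_def
      by (intro exI[of _ ?\<beta>]) simp
  next
    fix \<alpha> M
    assume "reach CT (E + T) V\<^sub>0 I b \<alpha> M"
    then obtain \<beta> where \<beta>: "\<forall>x\<in>V\<^sub>0. \<beta> x = \<alpha> x" "holds_all CT \<beta> E" "holds_all CT \<beta> T"
      "\<forall>x\<in>I. eval_uc CT \<beta> (b x) = M x"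
      unfolding reach_def by auto
    obtain \<iota> \<delta> where vals: "vals \<beta> \<iota> \<delta>" using ex_vals[OF \<beta>(2)] .
    have "eval_uc CT \<beta> (b x) = eval_uc CT \<beta> (a x)" if "x \<in> I" for x
      by (rule b_val[OF vals holds_T_head[OF vals \<beta>(3)] that refl])
    then show "reach CT E V\<^sub>0 I a \<alpha> M"
      using \<beta> unfolding reach_def by (intro exI[of _ \<beta>]) simp
  qed
  then show ?thesis
    unfolding user[symmetric]
    by (rule state_equivI[OF infinite_vars finite_globals(1,1) finite_I consistent(2)])
qed

abbreviation "\<tau> \<equiv> State (image_mset C (mset_set P)) E V\<^sub>0"

text \<open>Under \<open>T\<close> and the built-ins of the body the state determines every variable
  of the copy except the identifiers of new items. These keep their renamed variables in \<theta>
  and are free on both sides.\<close>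

lemma state_equiv_user:
  "state_equiv CT (State (rl_user R' + ctx_user) (rl_builtin R' + (E + T)) V\<^sub>0) \<tau>"
proof -
  have "reach CT E V\<^sub>0 P C = reach CT (rl_builtin R' + (E + T)) V\<^sub>0 P (po_case ur a)"
  proof (intro ext iffI)
    fix \<alpha> M
    assume "reach CT E V\<^sub>0 P C \<alpha> M"
    then obtain \<beta> where \<beta>: "\<forall>x\<in>V\<^sub>0. \<beta> x = \<alpha> x" "holds_all CT \<beta> E" "\<forall>x\<in>P. eval_uc CT \<beta> (C x) = M x"
      unfolding reach_def by blast
    obtain \<iota> \<delta> where vals: "vals \<beta> \<iota> \<delta>" using ex_vals[OF \<beta>(2)] .
    let ?\<beta> = "upd \<beta> (\<lambda>z. eval_trm CT \<beta> (\<theta> z))"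
    have \<xi>: "(?\<beta> \<circ> \<rho>) z = \<xi> \<beta> \<iota> \<delta> z" if "z \<in> vars_rule enc" for z
      using that vals by (simp add: upd_\<rho> eval_\<theta>)
    have "eval_uc CT ?\<beta> (po_case ur a y) = eval_uc CT \<beta> (C y)" if "y \<in> P" for y
      using that
    proof (cases rule: po_items_cases)
      case (rhs x)
      have "eval_uc CT ?\<beta> (ur x) = eval_uc CT (\<xi> \<beta> \<iota> \<delta>) (user_item x)"
        unfolding ur_def comp_apply[of "subst_uc _"] eval_rename_uc using vars_user_item[OF rhs(1)] \<xi> by (intro eval_uc_cong) blast
      then show ?thesis using rhs eval_u\<theta>_\<xi>[OF vals rhs(1)] by simp
    next
      case (ctx x)
      then show ?thesis by (simp add: eval_upd)
    qed
    moreover have "holds_all CT ?\<beta> (rl_builtin R')"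
      unfolding R'_eq holds_all_rename
      using holds_all_cong[of "rl_builtin enc" "?\<beta> \<circ> \<rho>" "\<xi> \<beta> \<iota> \<delta>"] \<xi> rule_val_builtin
      by (simp add: vars_rule_def)
    moreover have "\<forall>x\<in>V\<^sub>0. ?\<beta> x = \<alpha> x" using \<beta>(1) by (simp add: upd_old)
    ultimately show "reach CT (rl_builtin R' + (E + T)) V\<^sub>0 P (po_case ur a) \<alpha> M"
      using \<beta>(2,3) holds_upd(1) holds_T_upd[OF vals] unfolding reach_def
      by (intro exI[of _ ?\<beta>]) simp
  next
    fix \<alpha> M
    assume "reach CT (rl_builtin R' + (E + T)) V\<^sub>0 P (po_case ur a) \<alpha> M"
    then obtain \<beta> where \<beta>: "\<forall>x\<in>V\<^sub>0. \<beta> x = \<alpha> x" "holds_all CT \<beta> E" "holds_all CT \<beta> T"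
      "holds_all CT (\<beta> \<circ> \<rho>) (rl_builtin enc)" "\<forall>x\<in>P. eval_uc CT \<beta> (po_case ur a x) = M x"
      unfolding reach_def R'_eq by (auto simp: holds_all_rename)
    obtain \<iota> \<delta> where vals: "vals \<beta> \<iota> \<delta>" using ex_vals[OF \<beta>(2)] .
    note head = holds_T_head[OF vals \<beta>(3), unfolded vars_head]
    have "eval_uc CT \<beta> (C y) = eval_uc CT \<beta> (po_case ur a y)" if "y \<in> P" for y
      using that
    proof (cases rule: po_items_cases)
      case (rhs x)
      have "eval_uc CT \<beta> (ur x) = item_val TG (rhs r) (rhs_id \<beta> \<iota>) (rhs_deg (\<delta> \<circ> fst m)) x"
        unfolding ur_def comp_apply[of "subst_uc _"] eval_rename_uc eval_user_item[OF \<beta>(4)]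
      proof (rule item_val_cong[OF R rhs(1)])
        show "(\<beta> \<circ> \<rho> \<circ> var) y = rhs_id \<beta> \<iota> y" if "y \<in> items R" for y
          using head[of "var y"] by (auto simp: rhs_id_def)
        show "rhs_deg (\<lambda>v. (\<beta> \<circ> \<rho>) (dvar (Inl v))) v = rhs_deg (\<delta> \<circ> fst m) v" for v
          by (rule rhs_deg_cong) (use head[of "dvar (Inl _)"] in auto)
      qed
      then show ?thesis using rhs eval_u\<theta>[OF vals rhs(1)] by simp
    qed simp
    then show "reach CT E V\<^sub>0 P C \<alpha> M"
      using \<beta> unfolding reach_def by (intro exI[of _ \<beta>]) simp
  qed
  then have "state_equiv CT \<tau>
      (State (image_mset (po_case ur a) (mset_set P)) (rl_builtin R' + (E + T)) V\<^sub>0)"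
    by (rule state_equivI[OF infinite_vars finite_globals(1,1) finite_P consistent(2)])
  then show ?thesis
    unfolding image_mset_po_case[of ur a] R'_eq(2) by (rule state_equiv_sym)
qed

lemma transition: "chr_transition CT enc (State (image_mset a (mset_set I)) E V\<^sub>0) \<tau>"
proof -
  have ctx: "vars_ucs ctx_user \<subseteq> vars_ucs (image_mset a (mset_set I))"
    using finite_I by (auto simp: vars_ucs_def)
  have "vars_rule R' \<inter> (V\<^sub>0 \<union> vars_ucs ctx_user) = {}"
    using \<rho>_fresh ctx unfolding vars_rename_rule by blast
  moreover have "(vars_rule R' - vars_ucs (rl_head R')) \<inter> vars_bics (E + T) = {}"
  proof -
    have "vars_ucs (rl_head R') = \<rho> ` vars_ucs (rl_head enc)"
      by (simp add: rename_rule_def vars_rename_ucs)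
    then show ?thesis
      using \<rho>_fresh vars_T unfolding vars_rename_rule vars_bics_union by blast
  qed
  ultimately show ?thesis
    unfolding chr_transition_def using \<rho>_inj state_equiv_head state_equiv_user by blast
qed

section \<open>The state reached: its invariant and its encoding\<close>

lemma var_in_vars_rule:
  assumes "x \<in> items R" "x \<notin> items L"
  shows "var x \<in> vars_rule enc"
proof -
  have "var x \<in> vars_uc (user_item x)"
    using assms ker_sub(1) by (cases x) auto
  then show ?thesis using vars_user_item[OF assms(1)] by blast
qed

text \<open>New items may receive any identifiers: a prescription \<open>f\<close> for the result is
  met once \<iota> agrees with it on the context and on the items shared by \<open>L\<close> and
  \<open>R\<close>. Only renamed rule variables change for this.\<close>

lemma po_id_upd:
  assumes "\<And>x. x \<in> items R \<Longrightarrow> x \<in> items L \<Longrightarrow> \<iota> (m_item x) = f (rhs_item x)"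
    and "\<And>x. x \<in> ctx_items \<Longrightarrow> \<iota> x = f (ctx_item x)"
    and "\<And>x. w (var x) = f (rhs_item x)" "y \<in> P"
  shows "po_id (upd \<beta> w) \<iota> y = f y"
  using assms(4)
proof (cases rule: po_items_cases)
  case (rhs x)
  then show ?thesis
    using assms(1)[of x] assms(3) upd_\<rho>[OF var_in_vars_rule[of x]] by (auto simp: rhs_id_def)
next
  case (ctx x)
  then show ?thesis using assms(2) by simp
qed

text \<open>With the actual degrees of \<open>G\<close> the updates are computations with
  numerals.\<close>

lemma po_deg_eq: "v \<in> verts (gr PO) \<Longrightarrow> po_deg (num_deg G) v = num_deg PO v"
proof (elim pushout_simps(1)[THEN equalityD1, THEN subsetD, THEN PlusE]; hypsubst)
  fix v assume v: "v \<in> verts R"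
  show "po_deg (num_deg G) (Inl v) = num_deg PO (Inl v)"
  proof (cases "v \<in> verts K")
    case True
    then have "deg (gr G) (fst m v) = ctx_deg (fst m v) + deg L v"
      using deg_matched ker_sub(1) by blast
    then show ?thesis
      using True deg_pushout(1)[OF True] by (simp add: rhs_deg_def plus_num minus_num)
  next
    case False
    then show ?thesis using v deg_pushout(2)[of v] by (simp add: rhs_deg_def)
  qed
qed (simp add: deg_pushout(3))

text \<open>The built-ins of \<sigma> are unchanged, so the same \<open>Bx\<close> forces the
  degrees of \<open>G\<close> and thereby those of the result, while the identifiers of the result
  can be chosen freely.\<close>

lemma graph_invariant_result:
  assumes iso: "typed_iso jn je PO H'"
    and shape: "\<forall>b\<in>#Bc. const_eq b" "\<forall>b\<in>#Ba. arith_eq b" "\<forall>b\<in>#Bx. const_eq b"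
  shows "graph_invariant CT TG var dvar \<tau> H'"
proof -
  let ?j = "map_sum jn je"
  have H': "typed_graph TG H'" by (rule typed_graph_iso[OF iso PO])
  have j: "bij_betw ?j P (items (gr H'))"
    by (rule bij_betw_items[OF iso])
  have gnd_val: "eval_uc CT \<gamma> ((gnd_item H' \<circ> ?j) y) = item_val TG PO (\<gamma> \<circ> var \<circ> ?j) (num_deg PO) y"
    if "y \<in> P" for \<gamma> y
    unfolding comp_apply[of "gnd_item H'"] eval_chr_item item_val_iso[OF iso PO that]
    by (rule item_val_cong[OF PO that]) (simp_all add: deg_typed_iso[OF iso PO])
  have "reach CT (E + Bx) {} P C = reach CT {#} {} P (gnd_item H' \<circ> ?j)"
  proof (intro ext iffI)
    fix \<alpha> M
    assume "reach CT (E + Bx) {} P C \<alpha> M"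
    then obtain \<beta> where \<beta>: "holds_all CT \<beta> (E + Bx)" "\<forall>y\<in>P. eval_uc CT \<beta> (C y) = M y"
      unfolding reach_def by blast
    have "reach CT (E + Bx) {} I a \<beta> (\<lambda>x. eval_uc CT \<beta> (a x))"
      by (rule reach_self[OF \<beta>(1)])
    then obtain \<iota> where "\<forall>x\<in>I. eval_uc CT \<beta> (a x) = item_val TG G \<iota> (num_deg G) x"
      using gnd[rule_format, THEN iffD1] by metis
    then have vals: "vals \<beta> \<iota> (num_deg G)"
      using appl unfolding applicable_iff_deg by (simp add: vals_def)
    define \<gamma> where "\<gamma> = var_case (\<lambda>z. po_id \<beta> \<iota> (inv_into P ?j z)) undefined"
    have "eval_uc CT \<gamma> ((gnd_item H' \<circ> ?j) y) = M y" if "y \<in> P" for y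
      unfolding gnd_val[OF that] bspec[OF \<beta>(2) that, symmetric] eval_C[OF vals that]
      using j by (intro item_val_cong[OF PO that]) (simp_all add: \<gamma>_def po_deg_eq bij_betw_inv_into_left)
    then show "reach CT {#} {} P (gnd_item H' \<circ> ?j) \<alpha> M"
      unfolding reach_def by auto
  next
    fix \<alpha> M
    assume "reach CT {#} {} P (gnd_item H' \<circ> ?j) \<alpha> M"
    then obtain \<gamma> where \<gamma>: "\<forall>y\<in>P. eval_uc CT \<gamma> ((gnd_item H' \<circ> ?j) y) = M y"
      unfolding reach_def by blast
    let ?f = "\<gamma> \<circ> var \<circ> ?j"
    \<comment> \<open>Identifiers for \<open>G\<close> are pulled back from those of the result. A
      matched item outside \<open>R\<close> receives an unspecified value, since the result does not
      show it.\<close>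
    define \<iota> where "\<iota> x = (if x \<in> ctx_items then ?f (ctx_item x)
      else ?f (rhs_item (inv_into (items L) m_item x)))" for x
    have "reach CT (E + Bx) {} I a \<alpha> (item_val TG G \<iota> (num_deg G))"
      using gnd by blast
    then obtain \<beta> where \<beta>: "holds_all CT \<beta> (E + Bx)"
      "\<forall>x\<in>I. eval_uc CT \<beta> (a x) = item_val TG G \<iota> (num_deg G) x"
      unfolding reach_def by blast
    then have vals: "vals \<beta> \<iota> (num_deg G)"
      using appl unfolding applicable_iff_deg by (simp add: vals_def)
    let ?\<beta> = "upd \<beta> (\<lambda>z. ?f (rhs_item (inv var z)))"
    have vals': "vals ?\<beta> \<iota> (num_deg G)" using vals by (simp only: vals_upd)
    have id: "po_id ?\<beta> \<iota> y = ?f y" if "y \<in> P" for y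
      by (rule po_id_upd[OF _ _ _ that]) (simp_all add: \<iota>_def m_item_inj inj_var)
    have "eval_uc CT ?\<beta> (C y) = M y" if "y \<in> P" for y
      unfolding bspec[OF \<gamma> that, symmetric] gnd_val[OF that] eval_C[OF vals' that]
      by (rule item_val_cong[OF PO that]) (simp_all only: id po_deg_eq)
    then show "reach CT (E + Bx) {} P C \<alpha> M"
      using \<beta>(1) holds_upd(2) unfolding reach_def by (intro exI[of _ ?\<beta>]) simp
  qed
  then have "state_equiv CT (State (image_mset C (mset_set P)) (E + Bx) {})
      (State (image_mset (gnd_item H' \<circ> ?j) (mset_set P)) {#} {})"
    by (rule state_equivI[OF infinite_vars finite.emptyI finite.emptyI finite_P consistent(1)])
  then show ?thesis
    unfolding graph_invariant_def chr_def image_mset_bij_betw[OF j] using H' shape by blast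
qed

text \<open>The new store keeps \<open>B\<close> and defines the variables of \<open>H'\<close> in
  terms of those of \<open>G\<close>. As the names in \<open>H'\<close> are fresh for
  \<open>G\<close>, \<open>B\<close> and \<open>V\<close>, these definitions constrain nothing
  else.\<close>

lemma state_equiv_result:
  assumes iso: "typed_iso jn je PO H'"
    and fresh: "verts (gr H') \<inter> (verts (gr G) \<union> {v. {var (Inl v), dvar (Inl v)} \<inter> (V \<union> vars_bics B) \<noteq> {}}) = {}"
      "arcs (gr H') \<inter> (arcs (gr G) \<union> {e. var (Inr e) \<in> V \<union> vars_bics B}) = {}"
  shows "\<exists>B'. state_equiv CT \<tau> (State (chr TG var dvar Kp H') B' V)"
proof -
  let ?j = "map_sum jn je"
  have H': "typed_graph TG H'" by (rule typed_graph_iso[OF iso PO])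
  have j: "bij_betw ?j P (items (gr H'))"
    by (rule bij_betw_items[OF iso])
  have jn: "bij_betw jn (verts (gr PO)) (verts (gr H'))"
    using iso by (auto simp: typed_iso_def typed_embedding_def bij_betw_def)
  have kp_val: "eval_uc CT \<gamma> ((kp_item H' \<circ> ?j) y) =
      item_val TG PO (\<gamma> \<circ> var \<circ> ?j) (\<lambda>v. \<gamma> (dvar (Inl (jn v)))) y"
    if "y \<in> P" for \<gamma> y
    unfolding comp_apply[of "kp_item H'"] eval_chr_item item_val_iso[OF iso PO that]
    by (rule item_val_cong[OF PO that]) simp_all
  \<comment> \<open>An item of \<open>R\<close> that is not in \<open>L\<close> gets its own
    variable: its equation is trivial, and its identifier stays free.\<close>
  define ti :: "_ \<Rightarrow> ('f, 'v) trm" where "ti = po_case (\<lambda>x. Var (var (if x \<in> items L then m_item x else ?j (rhs_item x))))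
    (\<lambda>x. Var (var x))"
  define td :: "_ \<Rightarrow> ('f, 'v) trm" where "td = case_sum (\<lambda>v. if v \<in> verts K
      then Plus (Minus (Var (dvar (Inl (fst m v)))) (Num (int (deg L v)))) (Num (int (deg R v)))
      else Num (int (deg R v))) (\<lambda>v. Var (dvar (Inl v)))"
  define B' where "B' = B + image_mset (\<lambda>y. Eq (Var (var (?j y))) (ti y)) (mset_set P)
    + image_mset (\<lambda>v. Eq (Var (dvar (Inl (jn v)))) (td v)) (mset_set (verts (gr PO)))"
  have td: "eval_trm CT \<gamma> (td v) = po_deg (\<lambda>v. \<gamma> (dvar (Inl v))) v" for \<gamma> v
    by (cases v) (simp_all add: td_def rhs_deg_def)
  have B': "holds_all CT \<gamma> B' \<longleftrightarrow> holds_all CT \<gamma> B \<and> (\<forall>y\<in>P. \<gamma> (var (?j y)) = eval_trm CT \<gamma> (ti y)) \<and>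
    (\<forall>v\<in>verts (gr PO). \<gamma> (dvar (Inl (jn v))) = po_deg (\<lambda>v. \<gamma> (dvar (Inl v))) v)" for \<gamma>
    unfolding B'_def using finite_P typed_graphD(1)[OF PO]
    by (simp add: holds_all_image_mset td del: pushout_simps)
  have "reach CT E V\<^sub>0 P C = reach CT B' V P (kp_item H' \<circ> ?j)"
  proof (intro ext iffI)
    fix \<alpha> M
    assume "reach CT E V\<^sub>0 P C \<alpha> M"
    then obtain \<beta> where \<beta>: "\<forall>x\<in>V\<^sub>0. \<beta> x = \<alpha> x" "holds_all CT \<beta> E" "\<forall>x\<in>P. eval_uc CT \<beta> (C x) = M x"
      unfolding reach_def by blast
    then have "reach CT E V\<^sub>0 I a \<alpha> (\<lambda>x. eval_uc CT \<beta> (a x))"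
      unfolding reach_def by blast
    then obtain \<gamma> where \<gamma>: "\<forall>x\<in>V. \<gamma> x = \<alpha> x" "holds_all CT \<gamma> B"
      "\<forall>x\<in>I. eval_uc CT \<gamma> (kp_item G x) = eval_uc CT \<beta> (a x)"
      unfolding kp reach_def by blast
    let ?\<iota> = "\<gamma> \<circ> var" and ?\<delta> = "\<lambda>v. \<gamma> (dvar (Inl v))"
    have vals: "vals \<beta> ?\<iota> ?\<delta>" using \<gamma>(3) by (intro kp_vals[OF \<gamma>(2)]) simp
    \<comment> \<open>The old solution, overwritten on the variables of \<open>H'\<close> only;
      freshness keeps \<open>B\<close>, \<open>V\<close> and the encoding of \<open>G\<close> as
      they were.\<close>
    define \<gamma>' where "\<gamma>' z = (if z \<in> var ` items (gr H') then po_id \<beta> ?\<iota> (inv_into P ?j (inv var z))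
      else if z \<in> dvar ` Inl ` verts (gr H') then po_deg ?\<delta> (inv_into (verts (gr PO)) jn (projl (inv dvar z)))
      else \<gamma> z)" for z
    have new: "\<gamma>' (var (?j y)) = po_id \<beta> ?\<iota> y" if "y \<in> P" for y
      using that j by (simp add: \<gamma>'_def inj_var bij_betw_inv_into_left bij_betw_apply)
    have new_deg: "\<gamma>' (dvar (Inl (jn v))) = po_deg ?\<delta> v" if "v \<in> verts (gr PO)" for v
      using that jn by (auto simp: \<gamma>'_def inj_dvar bij_betw_inv_into_left bij_betw_apply simp del: pushout_simps)
    have "x \<notin> items (gr H')" if "x \<in> I" for x
      using that fresh by (cases x) (simp_all, blast+)
    then have old_var: "\<gamma>' (var x) = \<gamma> (var x)" if "x \<in> I" for x
      using that by (auto simp: \<gamma>'_def)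
    have old_dvar: "\<gamma>' (dvar (Inl v)) = \<gamma> (dvar (Inl v))" if "v \<in> verts (gr G)" for v
      using that fresh(1) by (auto simp: \<gamma>'_def)
    have old: "\<gamma>' z = \<gamma> z" if "z \<in> V \<union> vars_bics B" for z
    proof -
      have "z \<noteq> var x" if "x \<in> items (gr H')" for x
        using that fresh \<open>z \<in> V \<union> vars_bics B\<close> by (cases x) auto
      moreover have "z \<noteq> dvar (Inl v)" if "v \<in> verts (gr H')" for v
        using that fresh(1) \<open>z \<in> V \<union> vars_bics B\<close> by auto
      ultimately show ?thesis by (auto simp: \<gamma>'_def)
    qed
    have "holds_all CT \<gamma>' B"
      using \<gamma>(2) holds_all_cong[of B \<gamma>' \<gamma>] old by blast
    moreover have "\<gamma>' (var (?j y)) = eval_trm CT \<gamma>' (ti y)" if "y \<in> P" for y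
      using that
    proof (cases rule: po_items_cases)
      case (rhs x)
      show ?thesis
      proof (cases "x \<in> items L")
        case True
        then have "\<gamma>' (var (m_item x)) = \<gamma> (var (m_item x))"
          using m_item_in by (intro old_var) blast
        then show ?thesis
          unfolding new[OF that] using True rhs(2) by (simp add: ti_def rhs_id_def)
      qed (simp add: ti_def rhs(2))
    next
      case (ctx x)
      then show ?thesis
        unfolding new[OF that] by (simp add: ti_def old_var)
    qed
    moreover have "\<gamma>' (dvar (Inl (jn v))) = po_deg (\<lambda>v. \<gamma>' (dvar (Inl v))) v" if "v \<in> verts (gr PO)" for v
    proof -
      have "po_deg (\<lambda>v. \<gamma>' (dvar (Inl v))) v = po_deg ?\<delta> v"
        using that m_in(1) ker_sub(1) by (cases v) (auto simp: old_dvar subset_iff intro!: rhs_deg_cong)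
      then show ?thesis using new_deg[OF that] by simp
    qed
    ultimately have "holds_all CT \<gamma>' B'" unfolding B' by blast
    moreover have "eval_uc CT \<gamma>' ((kp_item H' \<circ> ?j) y) = M y" if "y \<in> P" for y
      unfolding kp_val[OF that] bspec[OF \<beta>(3) that, symmetric] eval_C[OF vals that]
      by (rule item_val_cong[OF PO that]) (simp_all only: new new_deg comp_apply)
    moreover have "\<forall>x\<in>V. \<gamma>' x = \<alpha> x" using \<gamma>(1) old by simp
    ultimately show "reach CT B' V P (kp_item H' \<circ> ?j) \<alpha> M"
      unfolding reach_def by blast
  next
    fix \<alpha> M
    assume "reach CT B' V P (kp_item H' \<circ> ?j) \<alpha> M"
    then obtain \<gamma> where \<gamma>: "\<forall>x\<in>V. \<gamma> x = \<alpha> x" "holds_all CT \<gamma> B'"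
      "\<forall>y\<in>P. eval_uc CT \<gamma> ((kp_item H' \<circ> ?j) y) = M y"
      unfolding reach_def by blast
    note \<gamma>B = \<gamma>(2)[unfolded B']
    let ?\<iota> = "\<gamma> \<circ> var" and ?\<delta> = "\<lambda>v. \<gamma> (dvar (Inl v))" and ?f = "\<gamma> \<circ> var \<circ> ?j"
    have "reach CT B V I (kp_item G) \<alpha> (\<lambda>x. eval_uc CT \<gamma> (kp_item G x))"
      using \<gamma>(1) \<gamma>B unfolding reach_def by blast
    then obtain \<beta> where \<beta>: "\<forall>x\<in>V\<^sub>0. \<beta> x = \<alpha> x" "holds_all CT \<beta> E"
      "\<forall>x\<in>I. eval_uc CT \<beta> (a x) = eval_uc CT \<gamma> (kp_item G x)"
      unfolding kp[symmetric] reach_def by blast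
    have vals: "vals \<beta> ?\<iota> ?\<delta>" using \<gamma>B by (intro kp_vals[OF _ \<beta>(3)]) simp
    let ?\<beta> = "upd \<beta> (\<lambda>z. ?f (rhs_item (inv var z)))"
    have vals': "vals ?\<beta> ?\<iota> ?\<delta>" using vals by (simp only: vals_upd)
    have f: "?f y = eval_trm CT \<gamma> (ti y)" if "y \<in> P" for y
      using \<gamma>B that by simp
    have id: "po_id ?\<beta> ?\<iota> y = ?f y" if "y \<in> P" for y
    proof (rule po_id_upd[OF _ _ _ that])
      show "?\<iota> (m_item x) = ?f (rhs_item x)" if "x \<in> items R" "x \<in> items L" for x
        unfolding f[OF po_item_in(1)[OF that(1)]] using that(2) by (simp add: ti_def)
      show "?\<iota> x = ?f (ctx_item x)" if "x \<in> ctx_items" for x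
        unfolding f[OF po_item_in(2)[OF that]] by (simp add: ti_def)
    qed (simp add: inj_var)
    have "eval_uc CT ?\<beta> (C y) = M y" if "y \<in> P" for y
      unfolding bspec[OF \<gamma>(3) that, symmetric] kp_val[OF that] eval_C[OF vals' that]
      by (rule item_val_cong[OF PO that]) (use \<gamma>B in \<open>simp_all only: id\<close>)
    moreover have "\<forall>x\<in>V\<^sub>0. ?\<beta> x = \<alpha> x" using \<beta>(1) by (simp add: upd_old)
    ultimately show "reach CT E V\<^sub>0 P C \<alpha> M"
      using \<beta>(2) holds_upd(1) unfolding reach_def by (intro exI[of _ ?\<beta>]) simp
  qed
  then have "state_equiv CT \<tau> (State (image_mset (kp_item H' \<circ> ?j) (mset_set P)) B' V)"
    by (rule state_equivI[OF infinite_vars finite_globals finite_P consistent(2)])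
  then show ?thesis
    unfolding chr_def image_mset_bij_betw[OF j] by blast
qed

end

context chr_rule_encoding
begin

lemma derivation_imp_transition:
  assumes G: "typed_graph TG G" and H: "typed_graph TG H" and V: "finite V"
    and equiv: "state_equiv CT \<sigma> (State (chr TG var dvar Kp G) B V)"
    and inv: "graph_invariant CT TG var dvar \<sigma> G"
    and der: "derivation r m G H trk"
    and strong: "strong_nodes CT dvar G B \<subseteq> {v \<in> verts (gr G). fst trk v \<noteq> None}"
  shows "\<exists>\<tau> H' B'. typed_graph TG H' \<and> typed_isomorphic H H' \<and> chr_transition CT enc \<sigma> \<tau> \<and>
    state_equiv CT \<tau> (State (chr TG var dvar Kp H') B' V) \<and> graph_invariant CT TG var dvar \<tau> H'"
proof -
  let ?I = "items (gr G)"
  have fin: "finite ?I" using G by (rule finite_items)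
  obtain a Bc Ba V\<^sub>0 Bx
  where \<sigma>: "\<sigma> = State (image_mset a (mset_set ?I)) (Bc + Ba) V\<^sub>0"
    and shape: "\<forall>b\<in>#Bc. const_eq b" "\<forall>b\<in>#Ba. arith_eq b" "\<forall>b\<in>#Bx. const_eq b"
    and kp: "reach CT (Bc + Ba) V\<^sub>0 ?I a = reach CT B V ?I (kp_item G)"
    and gnd: "\<forall>\<alpha> M. reach CT (Bc + Ba + Bx) {} ?I a \<alpha> M \<longleftrightarrow>
       (\<exists>\<iota>. \<forall>x\<in>?I. M x = item_val TG G \<iota> (num_deg G) x)"
    by (rule graph_invariant_family[OF G equiv inv])
  have V\<^sub>0: "finite V\<^sub>0"
    using state_equiv_finite_globals[OF equiv] V unfolding \<sigma> by simp
  obtain \<rho> :: "'v \<Rightarrow> 'v" where \<rho>: "inj_on \<rho> (vars_rule enc)" "\<rho> ` vars_rule enc \<inter>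
       (V\<^sub>0 \<union> vars_ucs (image_mset a (mset_set ?I)) \<union> vars_bics (Bc + Ba + Bx)) = {}"
    by (rule ex_fresh_inj_on[OF infinite_vars finite_vars_rule,
          of "V\<^sub>0 \<union> vars_ucs (image_mset a (mset_set ?I)) \<union> vars_bics (Bc + Ba + Bx)"])
      (use V\<^sub>0 in auto)
  have match: "inj_typed_morphism (lhs r) G m" and appl: "applicable r m G"
    using der by (auto simp: derivation_def)
  interpret gt_match TG r G m
    using G match by unfold_locales
  have "\<gamma> (dvar (Inl (fst m v))) = num_deg (lhs r) v"
    if "holds_all CT \<gamma> B" "v \<in> verts L - verts K" for \<gamma> v
  proof -
    \<comment> \<open>A deleted node has no track, so it is not strong: its degree is entailed by
      \<open>B\<close>, and applicability equates it with the degree in \<open>L\<close>.\<close>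
    have "fst m v \<notin> strong_nodes CT dvar G B"
      using strong that(2) unfolding derivation_track[OF der] by blast
    then have "\<gamma> (dvar (Inl (fst m v))) = num_deg G (fst m v)"
      using that m_in(1) by (auto simp: strong_nodes_def in_builtins_iff_entailed)
    then show ?thesis
      using appl that(2) unfolding applicable_iff_deg by simp
  qed
  then interpret chr_match CT TG var dvar r cp G m a Bc Ba Bx B V\<^sub>0 V \<rho>
    using appl kp gnd V\<^sub>0 V \<rho> by unfold_locales
  \<comment> \<open>Names to be avoided: those of \<open>G\<close> and those whose variables are
    global or occur in \<open>B\<close>. Injectivity of the variable maps keeps these sets
    finite.\<close>
  define N where "N = verts (gr G) \<union> {v. {var (Inl v), dvar (Inl v)} \<inter> (V \<union> vars_bics B) \<noteq> {}}"
  define A where "A = arcs (gr G) \<union> {e. var (Inr e) \<in> V \<union> vars_bics B}"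
  have fin_pre: "finite {x. f x \<in> V \<union> vars_bics B}" if "inj f" for f :: "'x \<Rightarrow> 'v"
    using finite_vimageI[OF _ that, of "V \<union> vars_bics B"] V by (simp add: vimage_def)
  have inj: "inj (\<lambda>v. var (Inl v))" "inj (\<lambda>v. dvar (Inl v))" "inj (\<lambda>e. var (Inr e))"
    by (auto simp: inj_def)
  have "N = verts (gr G) \<union> {v. var (Inl v) \<in> V \<union> vars_bics B} \<union> {v. dvar (Inl v) \<in> V \<union> vars_bics B}"
    unfolding N_def by auto
  then have "finite N"
    using fin_pre[OF inj(1)] fin_pre[OF inj(2)] typed_graphD(1)[OF G] by simp
  moreover have "finite A"
    using fin_pre[OF inj(3)] typed_graphD(2)[OF G] by (simp add: A_def)
  ultimately obtain jn je and H' :: "('n, 'e, 'tn, 'te) tgraph"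
    where H': "typed_iso jn je PO H'" "verts (gr H') \<inter> N = {}" "arcs (gr H') \<inter> A = {}"
    by (rule ex_fresh_typed_iso[OF infinite_nodes infinite_edges _ _ PO])
  have "typed_graph TG H'" by (rule typed_graph_iso[OF H'(1) PO])
  moreover have "typed_isomorphic H H'"
  proof -
    obtain fn fe where "typed_iso fn fe PO H"
      using derivation_imp_pushout_iso[OF der] by blast
    from typed_iso_comp[OF typed_iso_sym[OF this PO] H'(1)] show ?thesis
      unfolding typed_isomorphic_iff by blast
  qed
  moreover have "chr_transition CT enc \<sigma> \<tau>"
    unfolding \<sigma> by (rule transition)
  moreover obtain B' where "state_equiv CT \<tau> (State (chr TG var dvar Kp H') B' V)"
    using state_equiv_result[OF H'(1)] H'(2,3) unfolding N_def A_def by blast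
  moreover have "graph_invariant CT TG var dvar \<tau> H'"
    by (rule graph_invariant_result[OF H'(1) shape])
  ultimately show ?thesis by blast
qed

end

theorem mainTheorem1:
  fixes CT :: "('f, 'p, 'd) struct"
    and TG :: "('tn, 'te, 'l) type_graph"
    and S :: "('n, 'e, 'tn, 'te) gt_rule set"
    and r :: "('n, 'e, 'tn, 'te) gt_rule"
    and var dvar :: "'n + 'e \<Rightarrow> 'v"
    and cp :: "'n \<Rightarrow> 'n"
    and \<sigma> :: "('l, 'f, 'p, 'v) state"
    and G H :: "('n, 'e, 'tn, 'te) tgraph"
    and B :: "('f, 'p, 'v) bic multiset"
    and V :: "'v set"
  assumes "constraint_theory CT"
    and "infinite (UNIV :: 'n set)" and "infinite (UNIV :: 'e set)"
    and "inj var" and "inj dvar" and "range var \<inter> range dvar = {}"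
    and "gts TG S" and "r \<in> S" and "fresh_copies r cp"
    and "typed_graph TG G" and "typed_graph TG H" and "finite V"
    and "state_equiv CT \<sigma> (State (chr TG var dvar Kp G) B V)"
    and "graph_invariant CT TG var dvar \<sigma> G"
  shows "(\<exists>m trk. derivation r m G H trk \<and>
            strong_nodes CT dvar G B \<subseteq> {v \<in> verts (gr G). fst trk v \<noteq> None})
     \<longleftrightarrow>
         (\<exists>\<tau> H' B'. typed_graph TG H' \<and> typed_isomorphic H H' \<and>
            chr_transition CT (rule_encoding TG var dvar cp r) \<sigma> \<tau> \<and>
            state_equiv CT \<tau> (State (chr TG var dvar Kp H') B' V) \<and>
            graph_invariant CT TG var dvar \<tau> H')"
proof -
  have "is_type_graph TG" "gt_rule_over TG r"
    using assms(7,8) by (auto simp: gts_def)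
  then interpret chr_rule_encoding CT TG var dvar r cp
    using assms(1-6,9) by unfold_locales
  show ?thesis
    using derivation_imp_transition[OF assms(10,11,12,13,14)]
      transition_imp_derivation[OF assms(10,11) _ _ assms(13,14)] by blast
qed

end
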